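(* Let $d\in\mathbb{N}$ and let $f$ be a non-constant Bernstein function. Then $u\in V_{f(-\Delta)}$ if and only if there exists $T\in\mathcal{D}'(\mathbb{S}^{d-1})$ such that $$u(x)=\langle T, e_x|_{\mathbb{S}^{d-1}}\rangle_{\mathcal{D}'(\mathbb{S}^{d-1}),\mathcal{D}(\mathbb{S}^{d-1})}\quad\text{for all } x\in\mathbb{R}^d,$$ where $e_x(y):=e^{-ix\cdot y}$ for $x,y\in\mathbb{R}^d$.
   Context: Bernstein function: $f:[0,\infty)\to\mathbb{R}$ is a Bernstein function with (Lévy) triple $(a,b,\mu)$ if $f(\lambda)=a+b\lambda+\int_{(0,\infty)}(1-e^{-\lambda t})\,\mu(dt)$ for $\lambda>0$, where $a,b\ge 0$ and $\mu$ is a measure on $(0,\infty)$ with $\int_{(0,\infty)}(1\wedge t)\,\mu(dt)<\infty$. Fourier transform: $\hat\varphi(\xi)=\mathcal{F}(\varphi)(\xi)=\int_{\mathbb{R}^d}\varphi(x)e^{-ix\cdot\xi}\,dx$ for $\varphi\in\mathcal{S}(\mathbb{R}^d)$, extended to tempered distributions $\mathcal{S}'(\mathbb{R}^d)$ by duality. $\mathcal{Z}(\mathbb{R}^d):=\{\varphi\in\mathcal{S}(\mathbb{R}^d):\partial^\alpha\hat\varphi(0)=0 \text{ for all }\alpha\in\mathbb{N}_0^d\}$ (topology inherited from $\mathcal{S}(\mathbb{R}^d)$), and $\mathcal{Z}'(\mathbb{R}^d)$ is its topological dual. Every $u\in\mathcal{Z}'(\mathbb{R}^d)$ extends to an element of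 $\mathcal{S}'(\mathbb{R}^d)$, uniquely modulo polynomials. The operator $f(-\Delta):\mathcal{Z}(\mathbb{R}^d)\to\mathcal{Z}(\mathbb{R}^d)$ is $\varphi\mapsto\mathcal{F}^{-1}(f(|\cdot|^2)\hat\varphi)$. Solution: $u$ is a solution of $f(-\Delta)u=f(1)u$ if $u\in\mathcal{Z}'(\mathbb{R}^d)$, $\langle u,f(-\Delta)\varphi\rangle=\langle u,f(1)\varphi\rangle$ for all $\varphi\in\mathcal{Z}(\mathbb{R}^d)$, and $0\notin\operatorname{supp}\hat u$. The last condition means that $u$ has an extension in $\mathcal{S}'(\mathbb{R}^d)$ whose Fourier transform has support not containing $0$; this extension is unique and $u$ is identified with it. $V_{f(-\Delta)}$ is the vector space of all such solutions. The equality in the claim means that $u$, so identified, is the distribution given by the function on the right-hand side. $\mathbb{S}^{d-1}$ is the unit sphere of $\mathbb{R}^d$, $\mathcal{D}(\mathbb{S}^{d-1})$ is the space of smooth functions on $\mathbb{S}^{d-1}$ with its usual topology, and $\mathcal{D}'(\mathbb{S}^{d-1})$ is its topological dual.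
   Formalization: "Non-constant" is required on (0,∞) rather than [0,∞): the definition leaves f(0) free, and for f constant on (0,∞) with another value at 0 the claim fails (f(-Δ) is then a multiple of the identity on Z); with f(0)=f(0+) nothing changes. *)

theory Defs
  imports "HOL-Analysis.Analysis"
begin

section \<open>Bernstein functions\<close>

definition has_levy_triple :: "(real \<Rightarrow> real) \<Rightarrow> real \<Rightarrow> real \<Rightarrow> real measure \<Rightarrow> bool" where
  "has_levy_triple f a b \<mu> \<longleftrightarrow>
     0 \<le> a \<and> 0 \<le> b \<and>
     sets \<mu> = sets (restrict_space borel {0<..}) \<and> integrable \<mu> (\<lambda>t. min 1 t) \<and>
     (\<forall>s>0. f s = a + b * s + (LINT t|\<mu>. 1 - exp (- s * t)))"

text \<open>Only the values on the positive half-line are constrained. The value at 0 enters the operator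
  below at a single frequency only and has no effect, so non-constancy of a Bernstein function has to
  be understood on \<^term>\<open>{0<..} :: real set\<close>.\<close>

definition bernstein_function :: "(real \<Rightarrow> real) \<Rightarrow> bool" where
  "bernstein_function f \<longleftrightarrow> (\<exists>a b \<mu>. has_levy_triple f a b \<mu>)"


section \<open>Spaces of functions topologised by seminorms, and their duals\<close>

text \<open>A complex function on a set \<open>D\<close> is represented by its extension to the whole type that is
  \<open>undefined\<close> off \<open>D\<close>, so that equality of functions on \<open>D\<close> is equality in the logic; in the same
  way a functional on a function space \<open>V\<close> is an element of \<^term>\<open>extensional V\<close>.\<close>

definition seminorm_topology ::
    "'a set \<Rightarrow> ('a \<Rightarrow> complex) set \<Rightarrow> (('a \<Rightarrow> complex) \<Rightarrow> real) set \<Rightarrow> ('a \<Rightarrow> complex) topology" where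
  "seminorm_topology D V P =
     topology_generated_by
       {{\<psi> \<in> V. p (\<lambda>x\<in>D. \<psi> x - \<phi> x) < e} | p \<phi> e. p \<in> P \<and> \<phi> \<in> V \<and> 0 < e}"

definition topological_dual ::
    "'a set \<Rightarrow> ('a \<Rightarrow> complex) set \<Rightarrow> ('a \<Rightarrow> complex) topology \<Rightarrow> (('a \<Rightarrow> complex) \<Rightarrow> complex) set" where
  "topological_dual D V X =
     {u \<in> extensional V.
        (\<forall>\<phi>\<in>V. \<forall>\<psi>\<in>V. u (\<lambda>x\<in>D. \<phi> x + \<psi> x) = u \<phi> + u \<psi>) \<and>
        (\<forall>c. \<forall>\<phi>\<in>V. u (\<lambda>x\<in>D. c * \<phi> x) = c * u \<phi>) \<and>
        continuous_map X euclidean u}"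


section \<open>Smooth functions and the Schwartz space\<close>

definition partial_deriv :: "'n::finite \<Rightarrow> (real^'n \<Rightarrow> complex) \<Rightarrow> real^'n \<Rightarrow> complex" where
  "partial_deriv i \<phi> = (\<lambda>x. frechet_derivative \<phi> (at x) (axis i 1))"

text \<open>Iterated partial derivatives are indexed by lists of coordinates. For smooth functions the
  order of the entries does not matter, so a list encodes the multi-index that counts the
  occurrences of each coordinate.\<close>

definition partial_derivs :: "'n::finite list \<Rightarrow> (real^'n \<Rightarrow> complex) \<Rightarrow> real^'n \<Rightarrow> complex" where
  "partial_derivs is = foldr partial_deriv is"

definition smooth_on :: "(real^'n::finite) set \<Rightarrow> (real^'n \<Rightarrow> complex) \<Rightarrow> bool" where
  "smooth_on W \<phi> \<longleftrightarrow> open W \<and> (\<forall>is. \<forall>x\<in>W. partial_derivs is \<phi> differentiable (at x))"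

definition schwartz_space :: "(real^'n::finite \<Rightarrow> complex) set" where
  "schwartz_space =
     {\<phi>. smooth_on UNIV \<phi> \<and> (\<forall>k is. bounded (range (\<lambda>x. norm x ^ k * norm (partial_derivs is \<phi> x))))}"

definition schwartz_seminorm :: "nat \<Rightarrow> 'n::finite list \<Rightarrow> (real^'n \<Rightarrow> complex) \<Rightarrow> real" where
  "schwartz_seminorm k is \<phi> = (SUP x. norm x ^ k * norm (partial_derivs is \<phi> x))"

definition schwartz_topology :: "(real^'n::finite \<Rightarrow> complex) topology" where
  "schwartz_topology =
     seminorm_topology UNIV schwartz_space {schwartz_seminorm k is | k is. True}"

definition tempered_distributions :: "((real^'n::finite \<Rightarrow> complex) \<Rightarrow> complex) set" where
  "tempered_distributions = topological_dual UNIV schwartz_space schwartz_topology"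


section \<open>Fourier transform and support\<close>

definition fourier :: "(real^'n::finite \<Rightarrow> complex) \<Rightarrow> real^'n \<Rightarrow> complex" where
  "fourier \<phi> \<xi> = (LINT x|lborel. \<phi> x * exp (- (\<i> * complex_of_real (x \<bullet> \<xi>))))"

definition inverse_fourier :: "(real^'n::finite \<Rightarrow> complex) \<Rightarrow> real^'n \<Rightarrow> complex" where
  "inverse_fourier \<phi> x =
     (LINT \<xi>|lborel. \<phi> \<xi> * exp (\<i> * complex_of_real (x \<bullet> \<xi>))) / complex_of_real ((2 * pi) ^ CARD('n))"

definition fourier_distribution ::
    "((real^'n::finite \<Rightarrow> complex) \<Rightarrow> complex) \<Rightarrow> (real^'n \<Rightarrow> complex) \<Rightarrow> complex" where
  "fourier_distribution U = (\<lambda>\<phi>\<in>schwartz_space. U (fourier \<phi>))"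

definition test_functions :: "(real^'n::finite) set \<Rightarrow> (real^'n \<Rightarrow> complex) set" where
  "test_functions W =
     {\<phi>. smooth_on UNIV \<phi> \<and> compact (closure {x. \<phi> x \<noteq> 0}) \<and> closure {x. \<phi> x \<noteq> 0} \<subseteq> W}"

definition distribution_support :: "((real^'n::finite \<Rightarrow> complex) \<Rightarrow> complex) \<Rightarrow> (real^'n) set" where
  "distribution_support U = - \<Union>{W. open W \<and> (\<forall>\<phi>\<in>test_functions W. U \<phi> = 0)}"

definition distribution_given_by ::
    "((real^'n::finite \<Rightarrow> complex) \<Rightarrow> complex) \<Rightarrow> (real^'n \<Rightarrow> complex) \<Rightarrow> bool" where
  "distribution_given_by U g \<longleftrightarrow>
     (\<forall>\<phi>\<in>schwartz_space. integrable lborel (\<lambda>x. g x * \<phi> x)) \<and>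
     U = (\<lambda>\<phi>\<in>schwartz_space. LINT x|lborel. g x * \<phi> x)"


section \<open>The space \<open>\<Z>\<close>, the operator \<open>f(-\<Delta>)\<close> and its solution space\<close>

definition Z_space :: "(real^'n::finite \<Rightarrow> complex) set" where
  "Z_space = {\<phi> \<in> schwartz_space. \<forall>is. partial_derivs is (fourier \<phi>) 0 = 0}"

definition Z_dual :: "((real^'n::finite \<Rightarrow> complex) \<Rightarrow> complex) set" where
  "Z_dual = topological_dual UNIV Z_space (subtopology schwartz_topology Z_space)"

definition bernstein_laplacian ::
    "(real \<Rightarrow> real) \<Rightarrow> (real^'n::finite \<Rightarrow> complex) \<Rightarrow> real^'n \<Rightarrow> complex" where
  "bernstein_laplacian f \<phi> =
     inverse_fourier (\<lambda>\<xi>. complex_of_real (f ((norm \<xi>)\<^sup>2)) * fourier \<phi> \<xi>)"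

definition extension_off_zero ::
    "((real^'n::finite \<Rightarrow> complex) \<Rightarrow> complex) \<Rightarrow> ((real^'n \<Rightarrow> complex) \<Rightarrow> complex) \<Rightarrow> bool" where
  "extension_off_zero u U \<longleftrightarrow>
     U \<in> tempered_distributions \<and> restrict U Z_space = u \<and>
     0 \<notin> distribution_support (fourier_distribution U)"

definition solution_space :: "(real \<Rightarrow> real) \<Rightarrow> ((real^'n::finite \<Rightarrow> complex) \<Rightarrow> complex) set" where
  "solution_space f =
     {u \<in> Z_dual.
        (\<forall>\<phi>\<in>Z_space. u (bernstein_laplacian f \<phi>) = u (\<lambda>x. complex_of_real (f 1) * \<phi> x)) \<and>
        (\<exists>U. extension_off_zero u U)}"

text \<open>The tempered distribution with which a solution is identified; it is unique, since two
  tempered extensions differ by a polynomial, whose Fourier transform is supported in the origin.\<close>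

definition canonical_extension ::
    "((real^'n::finite \<Rightarrow> complex) \<Rightarrow> complex) \<Rightarrow> (real^'n \<Rightarrow> complex) \<Rightarrow> complex" where
  "canonical_extension u = (THE U. extension_off_zero u U)"


section \<open>Distributions on the unit sphere\<close>

text \<open>The map \<open>y \<mapsto> y / |y|\<close> is a smooth retraction of the punctured space onto the sphere. A function
  on the sphere is therefore smooth iff its extension that is homogeneous of degree 0 is smooth off
  the origin, and the derivatives of that extension, taken on the sphere, give the usual topology
  of uniform convergence of all derivatives.\<close>

definition homogeneous_extension :: "(real^'n::finite \<Rightarrow> complex) \<Rightarrow> real^'n \<Rightarrow> complex" where
  "homogeneous_extension \<psi> y = \<psi> (y /\<^sub>R norm y)"

definition sphere_functions :: "(real^'n::finite \<Rightarrow> complex) set" where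
  "sphere_functions = {\<psi> \<in> extensional (sphere 0 1). smooth_on (- {0}) (homogeneous_extension \<psi>)}"

definition sphere_seminorm :: "'n::finite list \<Rightarrow> (real^'n \<Rightarrow> complex) \<Rightarrow> real" where
  "sphere_seminorm is \<psi> = (SUP y\<in>sphere 0 1. norm (partial_derivs is (homogeneous_extension \<psi>) y))"

definition sphere_distributions :: "((real^'n::finite \<Rightarrow> complex) \<Rightarrow> complex) set" where
  "sphere_distributions =
     topological_dual (sphere 0 1) sphere_functions
       (seminorm_topology (sphere 0 1) sphere_functions (range sphere_seminorm))"

definition plane_wave :: "real^'n::finite \<Rightarrow> real^'n \<Rightarrow> complex" where
  "plane_wave x y = exp (- (\<i> * complex_of_real (x \<bullet> y)))"

end

theory Submission
  imports Defs "HOL-Probability.Probability"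
begin

text \<open>Under the Fourier transform the equation reads (f(|xi|^2) - f(1)) u^ = 0, tested against
  the Schwartz functions that vanish to infinite order at the origin; these form
  \<open>flat_space\<close>, the Fourier image of \<open>Z_space\<close>. The theorem says that such
  a u^, if it also vanishes near the origin, is a distribution living on the unit sphere itself,
  without derivatives transversal to it.

  The multiplier. Differentiating the Levy representation under the integral shows that
  \<open>symbol f\<close> is smooth off the origin with all derivatives bounded by powers of |xi|
  and 1/|xi| (\<open>bernstein_symbol_slowly_increasing\<close>). Multiplication by it therefore
  preserves \<open>flat_space\<close> (\<open>flat_mult\<close>). The derivative f'(s) = b + int t
  exp(-s t) \<mu>(dt) is positive everywhere unless f is constant
  (\<open>bernstein_increasing\<close>). Hence f(|xi|^2) - f(1) vanishes exactly on the unit sphere,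
  and only to first order.

  Solutions come from the sphere. Because the zero is simple, a Schwartz function that vanishes near
  the origin and on the sphere is (f(|xi|^2) - f(1)) \<theta> with \<theta> flat
  (\<open>symbol_division\<close>, based on \<open>hadamard_division\<close>), so u^ annihilates it.
  Since u^ also annihilates functions supported near the origin, its value at a Schwartz function
  depends only on the restriction to the sphere. Evaluating u^ at a fixed smooth extension of g
  defines T(g), and u(\<phi>) = T(F \<phi> restricted to the sphere)
  (\<open>solution_sphere_solution\<close>).

  The function on the right-hand side. F \<phi> is the integral of \<phi>(x) e_x over x, and T may
  be moved under this integral (\<open>sphere_distribution_fourier\<close>). Thus the functional
  just found is given by the function T(e_x restricted to the sphere), which grows at most
  polynomially. Conversely, \<phi> -> T(F \<phi> restricted to the sphere) is tempered, its
  transform lives on the sphere, and there the symbol equals f(1)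
  (\<open>sphere_solution_solves\<close>).

  The identification of a solution with a tempered distribution is well defined by
  \<open>extension_off_zero_unique\<close>; \<open>canonical_solution_iff\<close> then restates the
  problem for tempered distributions alone. The analytic background is the description of continuous
  functionals by seminorm estimates (\<open>topological_dual_iff\<close>) and Fourier inversion on
  the Schwartz space (\<open>fourier_fourier\<close>).\<close>

section \<open>Functions of class \<open>C\<^sup>k\<close>\<close>

text \<open>Derivatives in a fixed direction \<open>v\<close> have values in the same space as
  \<open>f\<close>, so the recursion stays within one type. The domain may be any Euclidean space,
  such as the product on which \<open>hadamard_division\<close> works; \<open>smooth_on\<close>
  covers only \<open>real^'n\<close>. Derivatives are taken in full neighbourhoods, so
  \<open>W\<close> is meant to be open.\<close>

fun Ck_on :: "nat \<Rightarrow> 'a::euclidean_space set \<Rightarrow> ('a \<Rightarrow> 'b::real_normed_vector) \<Rightarrow> bool" where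
  "Ck_on 0 W f \<longleftrightarrow> continuous_on W f"
| "Ck_on (Suc k) W f \<longleftrightarrow>
     (\<exists>f'. (\<forall>x\<in>W. (f has_derivative f' x) (at x)) \<and> (\<forall>v. Ck_on k W (\<lambda>x. f' x v)))"

lemma Ck_on_SucI:
  assumes "\<And>x. x \<in> W \<Longrightarrow> (f has_derivative f' x) (at x)" "\<And>v. Ck_on k W (\<lambda>x. f' x v)"
  shows "Ck_on (Suc k) W f"
  using assms by auto

lemma Ck_on_subset: "Ck_on k W f \<Longrightarrow> V \<subseteq> W \<Longrightarrow> Ck_on k V f"
proof (induction k arbitrary: f)
  case 0
  then show ?case by (auto intro: continuous_on_subset)
next
  case (Suc k)
  then show ?case by (auto, blast)
qed

lemma Ck_on_cong:
  assumes "open W" "\<And>x. x \<in> W \<Longrightarrow> f x = g x" "Ck_on k W f"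
  shows "Ck_on k W g"
proof (cases k)
  case 0
  then show ?thesis using assms by (auto cong: continuous_on_cong)
next
  case (Suc j)
  with assms(3) obtain f' where f': "\<And>x. x \<in> W \<Longrightarrow> (f has_derivative f' x) (at x)"
      "\<And>v. Ck_on j W (\<lambda>x. f' x v)" by auto
  have "(g has_derivative f' x) (at x)" if "x \<in> W" for x
    using has_derivative_transform_within_open[OF f'(1)[OF that] assms(1) that] assms(2) by auto
  with f'(2) Suc show ?thesis by auto
qed

lemma Ck_on_continuous: "Ck_on k W f \<Longrightarrow> continuous_on W f"
proof (cases k)
  case (Suc j)
  moreover assume "Ck_on k W f"
  ultimately show ?thesis
    by (auto intro!: continuous_at_imp_continuous_on) (metis has_derivative_continuous)
qed simp

lemma Ck_on_SucD: "Ck_on (Suc k) W f \<Longrightarrow> Ck_on k W f"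
proof (induction k arbitrary: f)
  case 0
  then show ?case using Ck_on_continuous by fastforce
next
  case (Suc k)
  from Suc.prems obtain f' where f': "\<forall>x\<in>W. (f has_derivative f' x) (at x)" 
     "\<forall>v. Ck_on (Suc k) W (\<lambda>x. f' x v)" by (subst (asm) Ck_on.simps(2)) blast
  then show ?case using Suc.IH by (subst Ck_on.simps(2)) blast
qed

lemma Ck_on_const: "Ck_on k W (\<lambda>x. c)"
proof (induction k arbitrary: c)
  case (Suc k)
  show ?case by (rule Ck_on_SucI[where f'="\<lambda>x v. 0"]) (use Suc in auto)
qed auto

lemma Ck_on_bounded_linear:
  assumes "bounded_linear L"
  shows "Ck_on k W L"
proof (cases k)
  case 0
  then show ?thesis using assms by (auto intro: linear_continuous_on)
next
  case (Suc j)
  show ?thesis unfolding Suc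
    by (rule Ck_on_SucI[where f'="\<lambda>x. L"])
       (use assms in \<open>auto intro: bounded_linear_imp_has_derivative Ck_on_const\<close>)
qed

lemma Ck_on_id: "Ck_on k W (\<lambda>x. x)"
  by (rule Ck_on_bounded_linear[OF bounded_linear_ident])

lemma Ck_on_add:
  assumes "Ck_on k W f" "Ck_on k W g"
  shows "Ck_on k W (\<lambda>x. f x + g x)"
  using assms
proof (induction k arbitrary: f g)
  case 0
  then show ?case by (auto intro: continuous_intros)
next
  case (Suc k)
  then obtain f' g' where
    "\<forall>x\<in>W. (f has_derivative f' x) (at x)" "\<forall>v. Ck_on k W (\<lambda>x. f' x v)"
    "\<forall>x\<in>W. (g has_derivative g' x) (at x)" "\<forall>v. Ck_on k W (\<lambda>x. g' x v)" by auto
  with Suc.IH show ?case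
    by (intro Ck_on_SucI[where f'="\<lambda>x v. f' x v + g' x v"]) (auto intro: has_derivative_add)
qed

lemma Ck_on_sum:
  assumes "\<And>i. i \<in> I \<Longrightarrow> Ck_on k W (f i)"
  shows "Ck_on k W (\<lambda>x. \<Sum>i\<in>I. f i x)"
  using assms by (induction I rule: infinite_finite_induct) (auto intro: Ck_on_const Ck_on_add)

lemma Ck_on_linear_compose:
  assumes "bounded_linear L" "Ck_on k W f"
  shows "Ck_on k W (\<lambda>x. L (f x))"
  using assms(2)
proof (induction k arbitrary: f)
  case 0
  then show ?case using assms(1) by (auto intro: bounded_linear.continuous_on)
next
  case (Suc k)
  then obtain f' where
    "\<forall>x\<in>W. (f has_derivative f' x) (at x)" "\<forall>v. Ck_on k W (\<lambda>x. f' x v)" by auto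
  with Suc.IH show ?case
    by (intro Ck_on_SucI[where f'="\<lambda>x v. L (f' x v)"])
       (auto intro: bounded_linear.has_derivative[OF assms(1)])
qed

lemma Ck_on_bilinear:
  assumes "bounded_bilinear B" "Ck_on k W f" "Ck_on k W g"
  shows "Ck_on k W (\<lambda>x. B (f x) (g x))"
  using assms(2-)
proof (induction k arbitrary: f g)
  case 0
  then show ?case using assms(1) by (auto intro: bounded_bilinear.continuous_on)
next
  case (Suc k)
  then obtain f' g' where
    f': "\<forall>x\<in>W. (f has_derivative f' x) (at x)" "\<forall>v. Ck_on k W (\<lambda>x. f' x v)" and
    g': "\<forall>x\<in>W. (g has_derivative g' x) (at x)" "\<forall>v. Ck_on k W (\<lambda>x. g' x v)" by auto
  have "Ck_on k W f" "Ck_on k W g" using Suc.prems Ck_on_SucD by auto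
  with Suc.IH f' g' show ?case
    by (intro Ck_on_SucI[where f'="\<lambda>x v. B (f x) (g' x v) + B (f' x v) (g x)"])
       (auto intro: bounded_bilinear.FDERIV[OF assms(1)] Ck_on_add)
qed

lemmas Ck_on_mult = Ck_on_bilinear[OF bounded_bilinear_mult]
lemmas Ck_on_scaleR = Ck_on_bilinear[OF bounded_bilinear_scaleR]
lemmas Ck_on_inner = Ck_on_bilinear[OF bounded_bilinear_inner]

text \<open>The chain rule gives \<open>f' (g x) (g' x v)\<close>, whose direction moves with
  \<open>x\<close>. Expanding \<open>g' x v\<close> in the basis makes it a sum of scalar functions
  times derivatives of \<open>f\<close> in fixed directions, composed with \<open>g\<close>; to
  these the induction hypothesis and the product rule apply.\<close>

lemma Ck_on_compose:
  fixes f :: "'b::euclidean_space \<Rightarrow> 'c::real_normed_vector"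
    and g :: "'a::euclidean_space \<Rightarrow> 'b"
  assumes "Ck_on k V f" "Ck_on k W g" "g ` W \<subseteq> V"
  shows "Ck_on k W (\<lambda>x. f (g x))"
  using assms
proof (induction k arbitrary: f)
  case 0
  then show ?case by (auto intro: continuous_on_compose2)
next
  case (Suc k)
  then obtain f' g' where
    f'0: "\<forall>x\<in>V. (f has_derivative f' x) (at x)" "\<forall>v. Ck_on k V (\<lambda>x. f' x v)" and
    g'0: "\<forall>x\<in>W. (g has_derivative g' x) (at x)" "\<forall>v. Ck_on k W (\<lambda>x. g' x v)" by auto
  note f' = bspec[OF f'0(1)] f'0(2) and g' = bspec[OF g'0(1)] g'0(2)
  have g: "Ck_on k W g" using Suc.prems(2) by (rule Ck_on_SucD)
  have der: "((\<lambda>x. f (g x)) has_derivative (\<lambda>v. f' (g x) (g' x v))) (at x)" if "x \<in> W" for x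
    using has_derivative_compose[OF g'(1) f'(1), of x] that Suc.prems(3) by auto
  have eq: "f' (g x) (g' x v) = (\<Sum>b\<in>Basis. (g' x v \<bullet> b) *\<^sub>R f' (g x) b)" if "x \<in> W" for x v
  proof -
    interpret bounded_linear "f' (g x)"
      using f'(1)[of "g x"] that Suc.prems(3) by (auto dest: has_derivative_bounded_linear)
    have "f' (g x) (g' x v) = f' (g x) (\<Sum>b\<in>Basis. (g' x v \<bullet> b) *\<^sub>R b)"
      by (simp add: euclidean_representation)
    then show ?thesis by (simp add: sum scaleR)
  qed
  have "Ck_on k W (\<lambda>x. \<Sum>b\<in>Basis. (g' x v \<bullet> b) *\<^sub>R f' (g x) b)" for v
    using Suc.IH[OF _ g Suc.prems(3)] f'(2) g'(2)
    by (intro Ck_on_sum Ck_on_scaleR Ck_on_linear_compose[OF bounded_linear_inner_left]) auto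
  then show ?case
    by (intro Ck_on_SucI[where f'="\<lambda>x v. \<Sum>b\<in>Basis. (g' x v \<bullet> b) *\<^sub>R f' (g x) b"])
       (use der eq in \<open>auto simp: fun_eq_iff\<close>)
qed

text \<open>For families closed under differentiation up to a shift of the index;
  \<open>flat_exp\<close> and the Levy integrals are of this kind.\<close>

lemma Ck_on_derivative_sequence:
  fixes g :: "nat \<Rightarrow> real \<Rightarrow> 'b::real_normed_vector"
  assumes "\<And>n t. t \<in> W \<Longrightarrow> (g n has_vector_derivative g (Suc n) t) (at t)"
  shows "Ck_on k W (g n)"
proof (induction k arbitrary: n)
  case 0
  then show ?case using assms
    by (auto intro!: continuous_at_imp_continuous_on has_vector_derivative_continuous)
next
  case (Suc k)
  show ?case
    by (rule Ck_on_SucI[where f'="\<lambda>t v. v *\<^sub>R g (Suc n) t"])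
       (use assms Suc in \<open>auto simp: has_vector_derivative_def[symmetric] intro: Ck_on_scaleR Ck_on_const\<close>)
qed

text \<open>The derivative of the reciprocal is a polynomial in the reciprocal, so each order
  follows from the previous one by the product rule.\<close>

lemma Ck_on_inverse: "Ck_on k (- {0::'a::{real_normed_field, euclidean_space}}) inverse"
proof (induction k)
  case 0
  then show ?case by (auto intro!: continuous_intros)
next
  case (Suc k)
  have "Ck_on k (- {0::'a}) (\<lambda>x. - (inverse x * v * inverse x))" for v
    by (intro Ck_on_linear_compose[OF bounded_linear_minus[OF bounded_linear_ident]] Ck_on_mult
          Suc Ck_on_const)
  then show ?case
    by (intro Ck_on_SucI[where f'="\<lambda>x v. - (inverse x * v * inverse x)"])
       (auto intro!: derivative_eq_intros)
qed

lemma Ck_on_divide: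
  fixes f g :: "'a::euclidean_space \<Rightarrow> 'b::{real_normed_field, euclidean_space}"
  assumes "Ck_on k W f" "Ck_on k W g" "\<And>x. x \<in> W \<Longrightarrow> g x \<noteq> 0"
  shows "Ck_on k W (\<lambda>x. f x / g x)"
  unfolding divide_inverse
  by (intro Ck_on_mult assms Ck_on_compose[OF Ck_on_inverse]) (use assms in auto)

lemma Ck_on_sqrt: "Ck_on k {0<..} sqrt"
proof (induction k)
  case 0
  then show ?case by (auto intro!: continuous_intros)
next
  case (Suc k)
  have "Ck_on k {0<..} (\<lambda>x. inverse (sqrt x) * (v / 2))" for v
    by (intro Ck_on_mult Ck_on_const Ck_on_compose[OF Ck_on_inverse Suc]) auto
  then show ?case
    by (intro Ck_on_SucI[where f'="\<lambda>x v. inverse (sqrt x) * (v / 2)"])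
       (auto intro!: derivative_eq_intros simp: fun_eq_iff field_simps)
qed

lemma Ck_on_norm_sq: "Ck_on k W (\<lambda>x::'a::euclidean_space. (norm x)\<^sup>2)"
  unfolding power2_norm_eq_inner by (intro Ck_on_inner Ck_on_id)

lemma Ck_on_norm: "Ck_on k (- {0}) (norm :: 'a::euclidean_space \<Rightarrow> real)"
proof -
  have "Ck_on k (- {0}) (\<lambda>x::'a. sqrt ((norm x)\<^sup>2))"
    by (intro Ck_on_compose[OF Ck_on_sqrt] Ck_on_norm_sq) auto
  then show ?thesis by simp
qed

lemma Ck_on_of_real:
  assumes "Ck_on k W f"
  shows "Ck_on k W (\<lambda>x. complex_of_real (f x))"
  by (rule Ck_on_linear_compose[OF bounded_linear_of_real assms])

text \<open>The derivative of the integral in direction \<open>v\<close> is the integral of the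
  joint derivative in direction \<open>(v, 0)\<close>, again a parameter integral with one order of
  smoothness less. The open set \<open>\<Omega>\<close> lets joint derivatives be taken at the end
  points of \<open>{0..1}\<close> too.\<close>

lemma Ck_on_parametric_integral:
  fixes g :: "'a::euclidean_space \<Rightarrow> real \<Rightarrow> 'b::banach"
  assumes "open W" "Ck_on k \<Omega> (\<lambda>p. g (fst p) (snd p))" "open \<Omega>" "W \<times> {0..1} \<subseteq> \<Omega>"
  shows "Ck_on k W (\<lambda>x. integral {0..1} (g x))"
  using assms(2)
proof (induction k arbitrary: g)
  case 0
  have "continuous_on (W \<times> cbox 0 1) (\<lambda>(x, t). g x t)"
    using 0 assms(4) by (auto simp: split_beta intro: continuous_on_subset)
  from integral_continuous_on_param[OF this] show ?case by simp
next
  case (Suc k)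
  have cg: "continuous_on \<Omega> (\<lambda>p. g (fst p) (snd p))" using Suc.prems Ck_on_continuous by blast
  obtain G where G: "\<And>p. p \<in> \<Omega> \<Longrightarrow> ((\<lambda>p. g (fst p) (snd p)) has_derivative G p) (at p)"
    "\<And>v. Ck_on k \<Omega> (\<lambda>p. G p v)" using Suc.prems by auto
  \<comment> \<open>The Leibniz rule wants the derivative in \<open>x\<close> as a bounded linear
    map that is jointly continuous; in finite dimension continuity can be checked on each argument
    separately.\<close>
  define D where "D x t = Blinfun (\<lambda>v. G (x, t) (v, 0))" for x t
  have D: "blinfun_apply (D x t) = (\<lambda>v. G (x, t) (v, 0))"
    and gD: "((\<lambda>x. g x t) has_derivative blinfun_apply (D x t)) (at x)" if "(x, t) \<in> \<Omega>" for x t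
  proof -
    have p: "((\<lambda>x. (x, t)) has_derivative (\<lambda>v. (v, 0))) (at x)"
      by (auto intro!: derivative_eq_intros)
    have "((\<lambda>x. g x t) has_derivative (\<lambda>v. G (x, t) (v, 0))) (at x)"
      using has_derivative_compose[OF p G(1)[OF that]] by simp
    moreover from this have "bounded_linear (\<lambda>v. G (x, t) (v, 0))" 
      by (rule has_derivative_bounded_linear)
    ultimately show "blinfun_apply (D x t) = (\<lambda>v. G (x, t) (v, 0))" 
      "((\<lambda>x. g x t) has_derivative blinfun_apply (D x t)) (at x)" 
      unfolding D_def by (auto simp: bounded_linear_Blinfun_apply)
  qed
  have cD: "continuous_on (U \<times> cbox 0 1) (\<lambda>(x, t). D x t)" if "U \<subseteq> W" for U
  proof (rule continuous_on_blinfun_componentwise)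
    fix i :: 'a
    have "continuous_on \<Omega> (\<lambda>p. G p (i, 0))" using G(2) Ck_on_continuous by blast
    then have "continuous_on (U \<times> cbox 0 1) (\<lambda>p. G p (i, 0))"
      using that assms(4) by (auto intro: continuous_on_subset)
    then show "continuous_on (U \<times> cbox 0 1) (\<lambda>x. blinfun_apply (case x of (x, t) \<Rightarrow> D x t) i)"
      using that assms(4) by (subst continuous_on_cong) (auto simp: D subset_iff)
  qed
  have int_g: "g x integrable_on cbox 0 1" if "x \<in> W" for x
  proof (intro integrable_continuous)
    have "(\<lambda>t. (x, t)) ` cbox 0 1 \<subseteq> \<Omega>" using assms(4) that by auto
    from continuous_on_compose2[OF cg _ this] show "continuous_on (cbox 0 1) (g x)"
      by (simp add: continuous_on_Pair)
  qed
  have int_D: "D x integrable_on cbox 0 1" if "x \<in> W" for x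
  proof (intro integrable_continuous)
    have "continuous_on (W \<times> cbox 0 1) (\<lambda>(x, t). D x t)" by (rule cD) simp
    moreover have "continuous_on (cbox 0 1) (\<lambda>t. (x, t))" by (intro continuous_intros)
    moreover have "(\<lambda>t. (x, t)) ` cbox 0 1 \<subseteq> W \<times> cbox 0 1" using that by auto
    ultimately have "continuous_on (cbox 0 1) (\<lambda>t. case (x, t) of (x, t) \<Rightarrow> D x t)"
      by (rule continuous_on_compose2)
    then show "continuous_on (cbox 0 1) (D x)" by simp
  qed
  have der: "((\<lambda>x. integral (cbox 0 1) (g x)) has_derivative integral (cbox 0 1) (D x0)) (at x0)"
    if x0: "x0 \<in> W" for x0
  proof -
    \<comment> \<open>The Leibniz rule works on a convex set, hence the passage to a ball.\<close>
    obtain e where e: "e > 0" "ball x0 e \<subseteq> W" using assms(1) x0 openE by blast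
    have "((\<lambda>x. integral (cbox 0 1) (g x)) has_derivative integral (cbox 0 1) (D x0)) 
      (at x0 within ball x0 e)"
    proof (rule leibniz_rule)
      show "((\<lambda>x. g x t) has_derivative blinfun_apply (D x t)) (at x within ball x0 e)"
        if "x \<in> ball x0 e" "t \<in> cbox 0 1" for x t
        by (rule has_derivative_at_withinI, rule gD, rule subsetD[OF assms(4)]) (use that e in auto)
      show "g x integrable_on cbox 0 1" if "x \<in> ball x0 e" for x
        using that e(2) by (blast intro: int_g)
    next
      show "x0 \<in> ball x0 e" using e(1) by simp
    qed (rule cD[OF e(2)] convex_ball)+
    then show ?thesis using e(1) by (simp add: at_within_open[of x0 "ball x0 e"])
  qed
  have ev: "blinfun_apply (integral (cbox 0 1) (D x)) v = integral (cbox 0 1) (\<lambda>t. G (x, t) (v, 0))"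
    if x: "x \<in> W" for x v
    unfolding blinfun_apply_integral[OF int_D[OF x]]
  proof (rule integral_cong)
    fix t :: real assume "t \<in> cbox 0 1"
    then have "(x, t) \<in> \<Omega>" using x assms(4) by auto
    then show "blinfun_apply (D x t) v = G (x, t) (v, 0)" by (simp add: D)
  qed
  have ck: "Ck_on k W (\<lambda>x. integral {0..1} (\<lambda>t. G (x, t) (v, 0)))" for v
    by (rule Suc.IH[of "\<lambda>x t. G (x, t) (v, 0)"]) (use G(2) in simp)
  show ?case
  proof (rule Ck_on_SucI[OF _ ck])
    fix x assume x: "x \<in> W"
    have "blinfun_apply (integral (cbox 0 1) (D x)) = (\<lambda>v. integral (cbox 0 1) (\<lambda>t. G (x, t) (v, 0)))"
      using ev[OF x] by (simp only: fun_eq_iff simp_thms)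
    with der[OF x] show "((\<lambda>x. integral {0..1} (g x)) has_derivative
        (\<lambda>v. integral {0..1} (\<lambda>t. G (x, t) (v, 0)))) (at x)"
      by (simp only: cbox_interval)
  qed
qed


section \<open>Smooth functions, their closure properties, and the Leibniz formula\<close>

section \<open>Iterated partial derivatives\<close>

lemma partial_derivs_Nil [simp]: "partial_derivs [] \<phi> = \<phi>"
  and partial_derivs_Cons [simp]: "partial_derivs (i # is) \<phi> = partial_deriv i (partial_derivs is \<phi>)"
  and partial_derivs_append: "partial_derivs (is @ js) \<phi> = partial_derivs is (partial_derivs js \<phi>)"
  by (simp_all add: partial_derivs_def)

lemma partial_deriv_eqI:
  "(f has_derivative f') (at x) \<Longrightarrow> partial_deriv i f x = f' (axis i 1)"
  unfolding partial_deriv_def by (metis frechet_derivative_at)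

lemma partial_derivs_cong_open:
  assumes "open W" "\<And>x. x \<in> W \<Longrightarrow> f x = g x" "x \<in> W"
  shows "partial_derivs is f x = partial_derivs is g x"
  using assms(3)
proof (induction "is" arbitrary: x)
  case Nil
  then show ?case using assms by simp
next
  case (Cons i "is")
  have "(partial_derivs is f has_derivative D) (at x) \<longleftrightarrow> (partial_derivs is g has_derivative D) (at x)" for D
    using has_derivative_transform_within_open[OF _ assms(1) Cons.prems] Cons.IH by metis
  then show ?case by (simp add: partial_deriv_def frechet_derivative_def)
qed

lemma frechet_derivative_partial:
  fixes \<phi> :: "real^'n::finite \<Rightarrow> complex"
  assumes "\<phi> differentiable (at x)"
  shows "(\<phi> has_derivative (\<lambda>v. \<Sum>i\<in>UNIV. (v $ i) *\<^sub>R partial_deriv i \<phi> x)) (at x)"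
proof -
  let ?D = "frechet_derivative \<phi> (at x)"
  have D: "(\<phi> has_derivative ?D) (at x)" using assms frechet_derivative_works by blast
  then interpret bounded_linear ?D by (rule has_derivative_bounded_linear)
  have "?D v = (\<Sum>i\<in>UNIV. (v $ i) *\<^sub>R partial_deriv i \<phi> x)" for v
  proof -
    have "?D v = ?D (\<Sum>i\<in>UNIV. (v $ i) *\<^sub>R axis i 1)"
      using basis_expansion[of v] by (simp add: scalar_mult_eq_scaleR)
    then show ?thesis by (simp add: sum scaleR partial_deriv_def)
  qed
  then have "?D = (\<lambda>v. \<Sum>i\<in>UNIV. (v $ i) *\<^sub>R partial_deriv i \<phi> x)" by (rule ext)
  with D show ?thesis by simp
qed

lemma smooth_onD_open: "smooth_on W \<phi> \<Longrightarrow> open W"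
  by (simp add: smooth_on_def)

lemma smooth_on_partial_derivs: "smooth_on W \<phi> \<Longrightarrow> smooth_on W (partial_derivs is \<phi>)"
  unfolding smooth_on_def by (simp flip: partial_derivs_append)

lemma smooth_on_partial_deriv: "smooth_on W \<phi> \<Longrightarrow> smooth_on W (partial_deriv i \<phi>)"
  using smooth_on_partial_derivs[of W \<phi> "[i]"] by simp

lemma smooth_on_differentiable: "smooth_on W \<phi> \<Longrightarrow> x \<in> W \<Longrightarrow> \<phi> differentiable (at x)"
  unfolding smooth_on_def by (metis partial_derivs_Nil)

lemma smooth_on_has_derivative:
  "smooth_on W \<phi> \<Longrightarrow> x \<in> W \<Longrightarrow>
    (\<phi> has_derivative (\<lambda>v. \<Sum>i\<in>UNIV. (v $ i) *\<^sub>R partial_deriv i \<phi> x)) (at x)"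
  by (intro frechet_derivative_partial smooth_on_differentiable)

lemma smooth_on_imp_Ck_on: "smooth_on W \<phi> \<Longrightarrow> Ck_on k W \<phi>"
proof (induction k arbitrary: \<phi>)
  case 0
  then show ?case
    by (auto intro!: continuous_at_imp_continuous_on differentiable_imp_continuous_within
        smooth_on_differentiable)
next
  case (Suc k)
  have "Ck_on k W (partial_deriv i \<phi>)" for i
    by (intro Suc.IH smooth_on_partial_deriv Suc.prems)
  then show ?case
    by (intro Ck_on_SucI[OF smooth_on_has_derivative[OF Suc.prems]])
       (auto intro!: Ck_on_sum Ck_on_linear_compose[OF bounded_linear_scaleR_right])
qed

lemma Ck_on_partial_deriv:
  assumes "open W" "Ck_on (Suc k) W \<phi>"
  shows "Ck_on k W (partial_deriv i \<phi>)"
proof -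
  obtain f' where f': "\<forall>x\<in>W. (\<phi> has_derivative f' x) (at x)" "\<forall>v. Ck_on k W (\<lambda>x. f' x v)"
    using assms(2) by auto
  show ?thesis
    by (rule Ck_on_cong[OF assms(1), of "\<lambda>x. f' x (axis i 1)"])
       (use f' in \<open>auto simp: partial_deriv_eqI\<close>)
qed

text \<open>A partial derivative is a directional derivative, and every directional derivative is a
  linear combination of partial ones. Through this bridge \<open>smooth_on\<close> inherits sums,
  products and compositions from \<open>Ck_on\<close>.\<close>

lemma smooth_on_iff_Ck_on: "smooth_on W \<phi> \<longleftrightarrow> open W \<and> (\<forall>k. Ck_on k W \<phi>)"
proof (intro iffI conjI allI)
  assume *: "open W \<and> (\<forall>k. Ck_on k W \<phi>)"
  have ck: "Ck_on k W (partial_derivs is \<phi>)" for k "is"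
  proof (induction "is" arbitrary: k)
    case (Cons i "is")
    show ?case unfolding partial_derivs_Cons by (rule Ck_on_partial_deriv) (use * Cons in blast)+
  qed (use * in simp)
  have "partial_derivs is \<phi> differentiable (at x)" if "x \<in> W" for "is" x
    using ck[of "Suc 0" "is"] that unfolding Ck_on.simps differentiable_def by blast
  with * show "smooth_on W \<phi>"
    unfolding smooth_on_def by blast
qed (auto simp: smooth_onD_open smooth_on_imp_Ck_on)

lemma smooth_on_continuous: "smooth_on W \<phi> \<Longrightarrow> continuous_on W \<phi>"
  using smooth_on_imp_Ck_on Ck_on_continuous by blast

lemma smooth_on_subset: "smooth_on W \<phi> \<Longrightarrow> open V \<Longrightarrow> V \<subseteq> W \<Longrightarrow> smooth_on V \<phi>"
  unfolding smooth_on_def by auto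

lemma smooth_on_cong: "smooth_on W f \<Longrightarrow> (\<And>x. x \<in> W \<Longrightarrow> f x = g x) \<Longrightarrow> smooth_on W g"
  unfolding smooth_on_iff_Ck_on using Ck_on_cong by blast

lemma smooth_on_const: "open W \<Longrightarrow> smooth_on W (\<lambda>x. c)"
  by (simp add: smooth_on_iff_Ck_on Ck_on_const)

lemma smooth_on_add: "smooth_on W f \<Longrightarrow> smooth_on W g \<Longrightarrow> smooth_on W (\<lambda>x. f x + g x)"
  by (simp add: smooth_on_iff_Ck_on Ck_on_add)

lemma smooth_on_mult: "smooth_on W f \<Longrightarrow> smooth_on W g \<Longrightarrow> smooth_on W (\<lambda>x. f x * g x)"
  by (simp add: smooth_on_iff_Ck_on Ck_on_mult)

lemma smooth_on_cmult: "smooth_on W f \<Longrightarrow> smooth_on W (\<lambda>x. c * f x)"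
  by (intro smooth_on_mult smooth_on_const smooth_onD_open)

lemma smooth_on_minus: "smooth_on W f \<Longrightarrow> smooth_on W (\<lambda>x. - f x)"
  using smooth_on_cmult[of W f "-1"] by simp

lemma smooth_on_diff: "smooth_on W f \<Longrightarrow> smooth_on W g \<Longrightarrow> smooth_on W (\<lambda>x. f x - g x)"
  using smooth_on_add[of W f "\<lambda>x. - g x"] smooth_on_minus[of W g] by simp

lemma smooth_on_sum:
  "open W \<Longrightarrow> (\<And>i. i \<in> I \<Longrightarrow> smooth_on W (f i)) \<Longrightarrow> smooth_on W (\<lambda>x. \<Sum>i\<in>I. f i x)"
  by (simp add: smooth_on_iff_Ck_on Ck_on_sum)

lemma smooth_on_coord: "open W \<Longrightarrow> smooth_on W (\<lambda>x. complex_of_real (x $ i))"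
  by (simp add: smooth_on_iff_Ck_on Ck_on_of_real Ck_on_bounded_linear bounded_linear_vec_nth)

lemma smooth_on_local:
  assumes "open W" "\<And>x. x \<in> W \<Longrightarrow> \<exists>V. x \<in> V \<and> smooth_on V \<phi>"
  shows "smooth_on W \<phi>"
  using assms unfolding smooth_on_def by blast

lemma partial_deriv_add:
  "f differentiable (at x) \<Longrightarrow> g differentiable (at x) \<Longrightarrow>
    partial_deriv i (\<lambda>x. f x + g x) x = partial_deriv i f x + partial_deriv i g x"
  unfolding partial_deriv_def[of i f] partial_deriv_def[of i g] frechet_derivative_works
  by (rule partial_deriv_eqI[OF has_derivative_add])

lemma partial_derivs_add:
  assumes "smooth_on W f" "smooth_on W g" "x \<in> W"
  shows "partial_derivs is (\<lambda>x. f x + g x) x = partial_derivs is f x + partial_derivs is g x"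
  using assms(3)
proof (induction "is" arbitrary: x)
  case (Cons i "is")
  have "partial_derivs [i] (partial_derivs is (\<lambda>x. f x + g x)) x
      = partial_derivs [i] (\<lambda>x. partial_derivs is f x + partial_derivs is g x) x"
    by (rule partial_derivs_cong_open[OF smooth_onD_open[OF assms(1)]]) (use Cons in auto)
  then show ?case
    using Cons.prems assms
    by (simp add: partial_deriv_add smooth_on_differentiable[OF smooth_on_partial_derivs])
qed simp

lemma partial_derivs_cmult:
  assumes "smooth_on W f" "x \<in> W"
  shows "partial_derivs is (\<lambda>x. c * f x) x = c * partial_derivs is f x"
  using assms(2)
proof (induction "is" arbitrary: x)
  case (Cons i "is")
  have "partial_derivs [i] (partial_derivs is (\<lambda>x. c * f x)) x
      = partial_derivs [i] (\<lambda>x. c * partial_derivs is f x) x"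
    by (rule partial_derivs_cong_open[OF smooth_onD_open[OF assms(1)]]) (use Cons in auto)
  also have "\<dots> = c * partial_deriv i (partial_derivs is f) x"
  proof -
    have "(partial_derivs is f has_derivative frechet_derivative (partial_derivs is f) (at x)) (at x)"
      using Cons.prems assms(1) smooth_on_differentiable[OF smooth_on_partial_derivs]
        frechet_derivative_works by blast
    from has_derivative_mult_right[OF this, of c] show ?thesis
      by (simp add: partial_deriv_eqI) (simp add: partial_deriv_def)
  qed
  finally show ?case by simp
qed simp

lemma partial_derivs_minus:
  "smooth_on W f \<Longrightarrow> x \<in> W \<Longrightarrow> partial_derivs is (\<lambda>x. - f x) x = - partial_derivs is f x"
  using partial_derivs_cmult[of W f x "is" "-1"] by simp

lemma partial_derivs_diff:
  "smooth_on W f \<Longrightarrow> smooth_on W g \<Longrightarrow> x \<in> W \<Longrightarrow>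
    partial_derivs is (\<lambda>x. f x - g x) x = partial_derivs is f x - partial_derivs is g x"
  using partial_derivs_add[of W f "\<lambda>x. - g x" x "is"]
  by (simp add: partial_derivs_minus smooth_on_minus)

lemma partial_derivs_const:
  "partial_derivs is (\<lambda>x. c) = (\<lambda>x. if is = [] then c else 0)"
proof (induction "is")
  case (Cons i "is")
  have "partial_deriv i (\<lambda>x::real^'n. d) = (\<lambda>x. 0)" for i and d :: complex
    by (rule ext) (simp add: partial_deriv_def)
  note * = this[of i]
  show ?case unfolding partial_derivs_Cons Cons by (cases "is = []") (simp_all add: *)
qed simp

lemma partial_derivs_sum:
  assumes "open W" "\<And>i. i \<in> I \<Longrightarrow> smooth_on W (f i)" "x \<in> W"
  shows "partial_derivs is (\<lambda>x. \<Sum>i\<in>I. f i x) x = (\<Sum>i\<in>I. partial_derivs is (f i) x)"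
  using assms(2)
proof (induction I rule: infinite_finite_induct)
  case (insert j J)
  then show ?case
    by (simp add: partial_derivs_add[OF _ _ assms(3)] smooth_on_sum[OF assms(1)])
qed (simp_all add: partial_derivs_const)

text \<open>The ways to distribute the derivations of an iterated derivative over the factors of a product.\<close>

fun leibniz_splits :: "'a list \<Rightarrow> ('a list \<times> 'a list) list" where
  "leibniz_splits [] = [([], [])]"
| "leibniz_splits (i # is) = concat (map (\<lambda>(a, b). [(i # a, b), (a, i # b)]) (leibniz_splits is))"

lemma length_leibniz_splits:
  "(a, b) \<in> set (leibniz_splits is) \<Longrightarrow> length a + length b = length is"
  by (induction "is" arbitrary: a b) auto

lemma has_derivative_sum_list:
  assumes "\<And>p. p \<in> set ps \<Longrightarrow> (F p has_derivative F' p) (at x)"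
  shows "((\<lambda>x. \<Sum>p\<leftarrow>ps. F p x) has_derivative (\<lambda>v. \<Sum>p\<leftarrow>ps. F' p v)) (at x)"
  using assms by (induction ps) (auto intro!: has_derivative_add)

text \<open>\<open>leibniz_splits\<close> lists pairs with repetition, so the binomial coefficients
  of the multi-index formula appear as repeated summands.\<close>

lemma partial_derivs_mult:
  assumes "smooth_on W f" "smooth_on W g" "x \<in> W"
  shows "partial_derivs is (\<lambda>x. f x * g x) x
    = (\<Sum>p\<leftarrow>leibniz_splits is. partial_derivs (fst p) f x * partial_derivs (snd p) g x)"
  using assms(3)
proof (induction "is" arbitrary: x)
  case (Cons i "is")
  let ?D = "\<lambda>p v. partial_derivs (fst p) f x * frechet_derivative (partial_derivs (snd p) g) (at x) v
      + frechet_derivative (partial_derivs (fst p) f) (at x) v * partial_derivs (snd p) g x"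
  have "partial_derivs [i] (partial_derivs is (\<lambda>x. f x * g x)) x
      = partial_derivs [i] (\<lambda>x. \<Sum>p\<leftarrow>leibniz_splits is. partial_derivs (fst p) f x * partial_derivs (snd p) g x) x"
    by (rule partial_derivs_cong_open[OF smooth_onD_open[OF assms(1)]]) (use Cons in auto)
  also have "\<dots> = (\<Sum>p\<leftarrow>leibniz_splits is. ?D p (axis i 1))"
  proof -
    have "((\<lambda>x. partial_derivs (fst p) f x * partial_derivs (snd p) g x) has_derivative ?D p) (at x)" for p
      by (intro has_derivative_mult)
        (use Cons.prems assms(1,2) smooth_on_differentiable[OF smooth_on_partial_derivs]
        frechet_derivative_works in blast)+
    from has_derivative_sum_list[where ps="leibniz_splits is" and F'="?D", OF this]
    show ?thesis by (simp add: partial_deriv_eqI)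
  qed
  also have "\<dots> = (\<Sum>p\<leftarrow>leibniz_splits (i # is). partial_derivs (fst p) f x * partial_derivs (snd p) g x)"
  proof -
    have "(\<Sum>p\<leftarrow>ps. ?D p (axis i 1)) = (\<Sum>p\<leftarrow>concat (map (\<lambda>(a, b). [(i # a, b), (a, i # b)]) ps).
         partial_derivs (fst p) f x * partial_derivs (snd p) g x)" for ps
      by (induction ps) (auto simp: partial_deriv_def)
    then show ?thesis by simp
  qed
  finally show ?case by simp
qed simp

lemma norm_partial_derivs_mult_le:
  assumes "smooth_on W f" "smooth_on W g" "x \<in> W"
  shows "norm (partial_derivs is (\<lambda>x. f x * g x) x)
    \<le> (\<Sum>p\<leftarrow>leibniz_splits is. norm (partial_derivs (fst p) f x) * norm (partial_derivs (snd p) g x))"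
proof -
  have "norm (\<Sum>p\<leftarrow>ps. F p) \<le> (\<Sum>p\<leftarrow>ps. norm (F p))" for F :: "_ \<Rightarrow> complex" and ps :: "('n list \<times> 'n list) list"
    by (induction ps) (auto intro: norm_triangle_le)
  then show ?thesis unfolding partial_derivs_mult[OF assms] norm_mult[symmetric] .
qed

section \<open>A smooth step function built from exp(-1/t)\<close>

section \<open>A smooth cutoff\<close>

text \<open>The family contains exp(-1/t), extended by zero, and is closed under differentiation:
  the derivative of p(1/t) exp(-1/t) is q(1/t) exp(-1/t) with q(x) = x^2 (p(x) - p'(x)).\<close>

definition flat_exp :: "real poly \<Rightarrow> real \<Rightarrow> real" where
  "flat_exp p t = (if 0 < t then poly p (1 / t) * exp (- 1 / t) else 0)"

lemma poly_over_exp_tendsto_0: "((\<lambda>x::real. poly p x * exp (- x)) \<longlongrightarrow> 0) at_top"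
proof -
  have "((\<lambda>x::real. \<Sum>i\<le>degree p. coeff p i * (x ^ i / exp x)) \<longlongrightarrow> (\<Sum>i\<le>degree p. coeff p i * 0)) at_top"
    by (intro tendsto_sum tendsto_mult tendsto_const tendsto_power_div_exp_0)
  then show ?thesis
    by (simp add: poly_altdef sum_distrib_right exp_minus field_simps sum_divide_distrib)
qed

lemma flat_exp_has_derivative:
  "(flat_exp p has_vector_derivative flat_exp ([:0, 0, 1:] * (p - pderiv p)) t) (at t)"
proof -
  consider "t > 0" | "t < 0" | "t = 0" by linarith
  then have "(flat_exp p has_real_derivative flat_exp ([:0, 0, 1:] * (p - pderiv p)) t) (at t)"
  proof cases
    case 1
    have "((\<lambda>t. poly p (1 / t) * exp (- 1 / t)) has_real_derivative
        flat_exp ([:0, 0, 1:] * (p - pderiv p)) t) (at t)"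
      using 1 by (auto intro!: derivative_eq_intros DERIV_chain2[OF poly_DERIV]
        simp: flat_exp_def field_simps power2_eq_square)
    then show ?thesis
      by (rule has_field_derivative_transform_within_open[where S="{0<..}"])
         (use 1 in \<open>auto simp: flat_exp_def\<close>)
  next
    case 2
    show ?thesis
      by (rule has_field_derivative_transform_within_open[where f="\<lambda>_. 0" and S="{..<0}"])
         (use 2 in \<open>auto simp: flat_exp_def\<close>)
  next
    case 3
    \<comment> \<open>The difference quotient at the origin carries an extra factor 1/h; it is
      absorbed by passing from \<open>p\<close> to \<open>pCons 0 p\<close>.\<close>
    have "((\<lambda>h. poly (pCons 0 p) (inverse h) * exp (- inverse h)) \<longlongrightarrow> 0) (at_right 0)"
      by (rule filterlim_compose[OF poly_over_exp_tendsto_0 filterlim_inverse_at_top_right])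
    then have "((\<lambda>h. flat_exp p h / h) \<longlongrightarrow> 0) (at_right 0)"
      by (rule Lim_transform_eventually)
         (auto simp: eventually_at_right_field flat_exp_def field_simps intro!: exI[of _ 1])
    moreover have "((\<lambda>h. flat_exp p h / h) \<longlongrightarrow> 0) (at_left 0)"
      by (rule Lim_transform_eventually[OF tendsto_const])
         (auto simp: eventually_at_left_field flat_exp_def intro!: exI[of _ "-1"])
    ultimately have "((\<lambda>h. flat_exp p h / h) \<longlongrightarrow> 0) (at 0)"
      using filterlim_at_split by blast
    then show ?thesis by (simp add: 3 DERIV_def flat_exp_def)
  qed
  then show ?thesis by (simp add: has_real_derivative_iff_has_vector_derivative)
qed

lemma Ck_on_flat_exp: "Ck_on k UNIV (flat_exp 1)"
proof -
  define q :: "nat \<Rightarrow> real poly" where "q n = ((\<lambda>p. [:0, 0, 1:] * (p - pderiv p)) ^^ n) 1" for n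
  have "Ck_on k UNIV (flat_exp (q 0))"
    by (rule Ck_on_derivative_sequence[of _ "\<lambda>n. flat_exp (q n)"])
       (use flat_exp_has_derivative in \<open>simp add: q_def\<close>)
  then show ?thesis by (simp add: q_def)
qed

text \<open>The denominator is positive because 2 - t and t - 1 are never both nonpositive.\<close>

definition cutoff :: "real \<Rightarrow> real" where
  "cutoff t = flat_exp 1 (2 - t) / (flat_exp 1 (2 - t) + flat_exp 1 (t - 1))"

lemma cutoff_eq_1: "t \<le> 1 \<Longrightarrow> cutoff t = 1"
  and cutoff_eq_0: "2 \<le> t \<Longrightarrow> cutoff t = 0"
  by (auto simp: cutoff_def flat_exp_def)

lemma Ck_on_cutoff: "Ck_on k UNIV cutoff"
proof -
  have lin: "Ck_on k UNIV (\<lambda>t::real. 2 - t)" "Ck_on k UNIV (\<lambda>t::real. t - 1)"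
    using Ck_on_add[OF Ck_on_const[of k UNIV "2::real"] Ck_on_linear_compose[OF bounded_linear_minus[OF bounded_linear_ident] Ck_on_id]]
      Ck_on_add[OF Ck_on_id Ck_on_const[of k UNIV "-1::real"]] by auto
  have pos: "flat_exp 1 (2 - t) + flat_exp 1 (t - 1) > 0" for t
  proof -
    have "flat_exp 1 s \<ge> 0" "s > 0 \<Longrightarrow> flat_exp 1 s > 0" for s by (auto simp: flat_exp_def)
    moreover have "2 - t > 0 \<or> t - 1 > 0" by linarith
    ultimately show ?thesis by (metis add_pos_nonneg add_nonneg_pos)
  qed
  have "Ck_on k UNIV (\<lambda>t. flat_exp 1 (2 - t) / (flat_exp 1 (2 - t) + flat_exp 1 (t - 1)))"
    by (intro Ck_on_divide Ck_on_add Ck_on_compose[OF Ck_on_flat_exp] lin)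
       (use pos in \<open>auto simp: less_imp_neq[symmetric]\<close>)
  then show ?thesis by (simp add: cutoff_def[abs_def])
qed

declare restrict_apply [simp del] restrict_apply' [simp]

section \<open>Continuity of linear functionals in terms of seminorm estimates\<close>

section \<open>Continuity with respect to a family of seminorms\<close>

text \<open>The estimate that expresses continuity for a topology given by seminorms.
  \<open>q\<close> is an arbitrary real function, typically the norm of a functional or a seminorm
  taken after an operator, so that estimates can be composed (\<open>dominated_compose\<close>)
  without returning to open sets.\<close>

definition dominated :: "'f set \<Rightarrow> ('f \<Rightarrow> real) set \<Rightarrow> ('f \<Rightarrow> real) \<Rightarrow> bool" where
  "dominated V P q \<longleftrightarrow>
     (\<exists>F C. finite F \<and> F \<subseteq> P \<and> 0 \<le> C \<and> (\<forall>\<phi>\<in>V. q \<phi> \<le> C * (\<Sum>p\<in>F. p \<phi>)))"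

lemma dominated_mono:
  "dominated V P q' \<Longrightarrow> (\<And>\<phi>. \<phi> \<in> V \<Longrightarrow> q \<phi> \<le> q' \<phi>) \<Longrightarrow> dominated V P q"
  unfolding dominated_def by (meson order_trans)

lemma dominated_member: "p \<in> P \<Longrightarrow> dominated V P p"
  unfolding dominated_def by (intro exI[of _ "{p}"] exI[of _ 1]) auto

lemma dominated_zero: "dominated V P (\<lambda>_. 0)"
  unfolding dominated_def by (intro exI[of _ "{}"] exI[of _ 0]) auto

lemma dominated_cmult:
  assumes "dominated V P q" "0 \<le> c"
  shows "dominated V P (\<lambda>\<phi>. c * q \<phi>)"
proof -
  obtain F C where FC: "finite F" "F \<subseteq> P" "0 \<le> C" "\<And>\<phi>. \<phi> \<in> V \<Longrightarrow> q \<phi> \<le> C * (\<Sum>p\<in>F. p \<phi>)"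
    using assms(1) unfolding dominated_def by blast
  show ?thesis unfolding dominated_def
    by (rule exI[of _ F], rule exI[of _ "c * C"])
      (use FC assms(2) in \<open>auto simp: mult.assoc intro: mult_left_mono\<close>)
qed

lemma dominated_add:
  assumes nonneg: "\<forall>p\<in>P. \<forall>\<phi>\<in>V. 0 \<le> p \<phi>"
    and "dominated V P q" "dominated V P r"
  shows "dominated V P (\<lambda>\<phi>. q \<phi> + r \<phi>)"
proof -
  obtain F C where F: "finite F" "F \<subseteq> P" "0 \<le> C" "\<And>\<phi>. \<phi> \<in> V \<Longrightarrow> q \<phi> \<le> C * (\<Sum>p\<in>F. p \<phi>)"
    using assms(2) unfolding dominated_def by blast
  obtain G D where G: "finite G" "G \<subseteq> P" "0 \<le> D" "\<And>\<phi>. \<phi> \<in> V \<Longrightarrow> r \<phi> \<le> D * (\<Sum>p\<in>G. p \<phi>)"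
    using assms(3) unfolding dominated_def by blast
  have "q \<phi> + r \<phi> \<le> (C + D) * (\<Sum>p\<in>F \<union> G. p \<phi>)" if "\<phi> \<in> V" for \<phi>
  proof -
    have "(\<Sum>p\<in>F. p \<phi>) \<le> (\<Sum>p\<in>F \<union> G. p \<phi>)" "(\<Sum>p\<in>G. p \<phi>) \<le> (\<Sum>p\<in>F \<union> G. p \<phi>)"
      by (rule sum_mono2; use F(1,2) G(1,2) nonneg that in blast)+
    then have "C * (\<Sum>p\<in>F. p \<phi>) \<le> C * (\<Sum>p\<in>F \<union> G. p \<phi>)" "D * (\<Sum>p\<in>G. p \<phi>) \<le> D * (\<Sum>p\<in>F \<union> G. p \<phi>)"
      using F(3) G(3) by (auto intro: mult_left_mono)
    with F(4)[OF that] G(4)[OF that] show ?thesis by (simp add: distrib_right)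
  qed
  then show ?thesis unfolding dominated_def
    by (intro exI[of _ "F \<union> G"] exI[of _ "C + D"]) (use F G in auto)
qed

lemma dominated_sum:
  assumes "\<forall>p\<in>P. \<forall>\<phi>\<in>V. 0 \<le> p \<phi>"
    and "\<And>i. i \<in> I \<Longrightarrow> dominated V P (q i)"
  shows "dominated V P (\<lambda>\<phi>. \<Sum>i\<in>I. q i \<phi>)"
  using assms(2)
  by (induction I rule: infinite_finite_induct)
     (auto intro: dominated_zero dominated_add[of P V, OF assms(1)])

lemma dominated_sum_list:
  assumes "\<forall>p\<in>P. \<forall>\<phi>\<in>V. 0 \<le> p \<phi>"
    and "\<And>i. i \<in> set is \<Longrightarrow> dominated V P (q i)"
  shows "dominated V P (\<lambda>\<phi>. \<Sum>i\<leftarrow>is. q i \<phi>)"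
  using assms(2)
  by (induction "is") (auto intro: dominated_zero dominated_add[of P V, OF assms(1)])

lemma dominated_compose:
  assumes nonneg: "\<forall>p\<in>P. \<forall>\<phi>\<in>V. 0 \<le> p \<phi>"
    and A: "\<And>\<phi>. \<phi> \<in> V \<Longrightarrow> A \<phi> \<in> V'" "\<And>p. p \<in> P' \<Longrightarrow> dominated V P (\<lambda>\<phi>. p (A \<phi>))"
    and q: "dominated V' P' q"
  shows "dominated V P (\<lambda>\<phi>. q (A \<phi>))"
proof -
  obtain F C where F: "finite F" "F \<subseteq> P'" "0 \<le> C" "\<And>\<phi>. \<phi> \<in> V' \<Longrightarrow> q \<phi> \<le> C * (\<Sum>p\<in>F. p \<phi>)"
    using q unfolding dominated_def by blast
  have "dominated V P (\<lambda>\<phi>. C * (\<Sum>p\<in>F. p (A \<phi>)))"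
    by (rule dominated_cmult[OF dominated_sum[of P V, OF nonneg] F(3)]) (use A F in auto)
  then show ?thesis by (rule dominated_mono) (use A F in auto)
qed

text \<open>The common setting of the Schwartz space and of the smooth functions on the sphere, so
  that both duals are described by one theorem. Sums and multiples are restricted to
  \<open>D\<close> because members of \<open>V\<close> are extensional.\<close>

locale seminorm_space =
  fixes D :: "'a set" and V :: "('a \<Rightarrow> complex) set" and P :: "(('a \<Rightarrow> complex) \<Rightarrow> real) set"
  assumes ext: "V \<subseteq> extensional D"
    and V_ne: "V \<noteq> {}" and P_ne: "P \<noteq> {}"
    and add_mem: "\<phi> \<in> V \<Longrightarrow> \<psi> \<in> V \<Longrightarrow> (\<lambda>x\<in>D. \<phi> x + \<psi> x) \<in> V"
    and cmult_mem: "\<phi> \<in> V \<Longrightarrow> (\<lambda>x\<in>D. c * \<phi> x) \<in> V"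
    and triangle: "p \<in> P \<Longrightarrow> \<phi> \<in> V \<Longrightarrow> \<psi> \<in> V \<Longrightarrow> p (\<lambda>x\<in>D. \<phi> x + \<psi> x) \<le> p \<phi> + p \<psi>"
    and cmult: "p \<in> P \<Longrightarrow> \<phi> \<in> V \<Longrightarrow> p (\<lambda>x\<in>D. c * \<phi> x) = norm c * p \<phi>"
begin

abbreviation X where "X \<equiv> seminorm_topology D V P"

lemma restrict_id: "\<phi> \<in> V \<Longrightarrow> restrict \<phi> D = \<phi>"
  using ext extensional_restrict by blast

lemma diff_eq: "(\<lambda>x\<in>D. \<phi> x - \<psi> x :: complex) = (\<lambda>x\<in>D. \<phi> x + (\<lambda>x\<in>D. (-1) * \<psi> x) x)"
  by (auto simp: fun_eq_iff restrict_apply)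

lemma diff_mem: "\<phi> \<in> V \<Longrightarrow> \<psi> \<in> V \<Longrightarrow> (\<lambda>x\<in>D. \<phi> x - \<psi> x) \<in> V"
  unfolding diff_eq by (intro add_mem cmult_mem)

lemma zero_mem: "(\<lambda>x\<in>D. 0) \<in> V"
  using cmult_mem[of _ 0] V_ne by auto

lemma at_zero: "p \<in> P \<Longrightarrow> p (\<lambda>x\<in>D. 0) = 0"
  using cmult[of p _ 0] V_ne by auto

lemma diff_self: "p \<in> P \<Longrightarrow> p (\<lambda>x\<in>D. \<phi> x - \<phi> x) = 0"
  using at_zero by simp

lemma nonneg:
  assumes "p \<in> P" "\<phi> \<in> V"
  shows "0 \<le> p \<phi>"
proof -
  have "p (\<lambda>x\<in>D. \<phi> x + (\<lambda>x\<in>D. (-1) * \<phi> x) x) \<le> p \<phi> + p (\<lambda>x\<in>D. (-1) * \<phi> x)"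
    by (intro triangle cmult_mem assms)
  also have "(\<lambda>x\<in>D. \<phi> x + (\<lambda>x\<in>D. (-1) * \<phi> x) x) = (\<lambda>x\<in>D. 0)" by (auto simp: fun_eq_iff restrict_apply)
  finally show ?thesis unfolding cmult[OF assms] at_zero[OF assms(1)] by simp
qed

lemma diff_triangle:
  assumes "p \<in> P" "\<phi> \<in> V" "\<psi> \<in> V" "\<eta> \<in> V"
  shows "p (\<lambda>x\<in>D. \<phi> x - \<eta> x) \<le> p (\<lambda>x\<in>D. \<phi> x - \<psi> x) + p (\<lambda>x\<in>D. \<psi> x - \<eta> x)"
proof -
  have "(\<lambda>x\<in>D. \<phi> x - \<eta> x) = (\<lambda>x\<in>D. (\<lambda>x\<in>D. \<phi> x - \<psi> x) x + (\<lambda>x\<in>D. \<psi> x - \<eta> x) x)"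
    by (auto simp: fun_eq_iff restrict_apply)
  then show ?thesis using triangle[OF assms(1) diff_mem[OF assms(2,3)] diff_mem[OF assms(3,4)]] by simp
qed

lemma openin_basic:
  "p \<in> P \<Longrightarrow> \<phi> \<in> V \<Longrightarrow> 0 < e \<Longrightarrow> openin X {\<psi> \<in> V. p (\<lambda>x\<in>D. \<psi> x - \<phi> x) < e}"
  unfolding seminorm_topology_def openin_topology_generated_by_iff
  by (rule generate_topology_on.Basis) auto

lemma topspace_X: "topspace X = V"
proof
  show "topspace X \<subseteq> V" unfolding seminorm_topology_def topology_generated_by_topspace by auto
  show "V \<subseteq> topspace X"
  proof
    fix \<phi> assume "\<phi> \<in> V"
    moreover obtain p where "p \<in> P" using P_ne by auto
    ultimately show "\<phi> \<in> topspace X"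
      using openin_subset[OF openin_basic[of p \<phi> 1]] diff_self[of p \<phi>] by fastforce
  qed
qed

lemma openin_nbhd:
  assumes "openin X U" "\<phi> \<in> U"
  shows "\<exists>F e. finite F \<and> F \<subseteq> P \<and> 0 < e \<and> {\<psi> \<in> V. \<forall>p\<in>F. p (\<lambda>x\<in>D. \<psi> x - \<phi> x) < e} \<subseteq> U"
proof -
  have "generate_topology_on {{\<psi> \<in> V. p (\<lambda>x\<in>D. \<psi> x - \<phi> x) < e} | p \<phi> e. p \<in> P \<and> \<phi> \<in> V \<and> 0 < e} U"
    using assms(1) unfolding seminorm_topology_def openin_topology_generated_by_iff .
  then show ?thesis using assms(2)
  proof (induction U arbitrary: \<phi>)
    case (Int A B)
    from Int.IH(1)[of \<phi>] Int.prems obtain F e where F: "finite F" "F \<subseteq> P" "0 < e"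
        "{\<psi> \<in> V. \<forall>p\<in>F. p (\<lambda>x\<in>D. \<psi> x - \<phi> x) < e} \<subseteq> A" by blast
    from Int.IH(2)[of \<phi>] Int.prems obtain G d where G: "finite G" "G \<subseteq> P" "0 < d"
        "{\<psi> \<in> V. \<forall>p\<in>G. p (\<lambda>x\<in>D. \<psi> x - \<phi> x) < d} \<subseteq> B" by blast
    note FG = F(1-3) G(1-3) and * = F(4) G(4)
    have "{\<psi> \<in> V. \<forall>p\<in>F \<union> G. p (\<lambda>x\<in>D. \<psi> x - \<phi> x) < min e d} \<subseteq> A \<inter> B"
      using * by auto
    then show ?case using FG by (intro exI[of _ "F \<union> G"] exI[of _ "min e d"]) auto
  next
    case (UN K)
    then obtain k where "k \<in> K" "\<phi> \<in> k" by auto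
    from UN.IH[OF this] obtain F e where "finite F" "F \<subseteq> P" "0 < e"
      "{\<psi> \<in> V. \<forall>p\<in>F. p (\<lambda>x\<in>D. \<psi> x - \<phi> x) < e} \<subseteq> k" by blast
    with \<open>k \<in> K\<close> show ?case by (intro exI[of _ F] exI[of _ e]) blast
  next
    case (Basis s)
    then obtain p \<phi>0 e where s: "s = {\<psi> \<in> V. p (\<lambda>x\<in>D. \<psi> x - \<phi>0 x) < e}" "p \<in> P" "\<phi>0 \<in> V" "0 < e"
      by blast
    have \<phi>: "\<phi> \<in> V" "p (\<lambda>x\<in>D. \<phi> x - \<phi>0 x) < e" using Basis s by auto
    \<comment> \<open>Recentring: the ball around \<open>\<phi>\<close> whose radius is what the
      distance from \<open>\<phi>0\<close> leaves of \<open>e\<close> lies inside the given ball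
      around \<open>\<phi>0\<close>.\<close>
    have "{\<psi> \<in> V. \<forall>p\<in>{p}. p (\<lambda>x\<in>D. \<psi> x - \<phi> x) < e - p (\<lambda>x\<in>D. \<phi> x - \<phi>0 x)} \<subseteq> s"
      unfolding s(1) using diff_triangle[OF s(2) _ \<phi>(1) s(3)] by force
    then show ?case using s \<phi> by (intro exI[of _ "{p}"] exI[of _ "e - p (\<lambda>x\<in>D. \<phi> x - \<phi>0 x)"]) auto
  qed auto
qed

text \<open>Continuity at zero bounds a linear functional by 1 where finitely many seminorms are
  small, and scaling spreads the bound to all of \<open>V\<close>. Conversely, the estimate applied
  to differences gives continuity at every point.\<close>

lemma topological_dual_iff:
  "u \<in> topological_dual D V X \<longleftrightarrow>
     u \<in> extensional V \<and>
     (\<forall>\<phi>\<in>V. \<forall>\<psi>\<in>V. u (\<lambda>x\<in>D. \<phi> x + \<psi> x) = u \<phi> + u \<psi>) \<and>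
     (\<forall>c. \<forall>\<phi>\<in>V. u (\<lambda>x\<in>D. c * \<phi> x) = c * u \<phi>) \<and>
     dominated V P (\<lambda>\<phi>. norm (u \<phi>))"
proof -
  have "continuous_map X euclidean u \<longleftrightarrow> dominated V P (\<lambda>\<phi>. norm (u \<phi>))"
    if add: "\<And>\<phi> \<psi>. \<phi> \<in> V \<Longrightarrow> \<psi> \<in> V \<Longrightarrow> u (\<lambda>x\<in>D. \<phi> x + \<psi> x) = u \<phi> + u \<psi>"
      and cm: "\<And>c \<phi>. \<phi> \<in> V \<Longrightarrow> u (\<lambda>x\<in>D. c * \<phi> x) = c * u \<phi>"
  proof
    assume cont: "continuous_map X euclidean u"
    have u0: "u (\<lambda>x\<in>D. 0) = 0" using cm[OF zero_mem, of 0] by simp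
    have "openin X {\<phi> \<in> topspace X. u \<phi> \<in> ball 0 1}"
      using cont unfolding continuous_map_def open_openin[symmetric] by blast
    then have "\<exists>F e. finite F \<and> F \<subseteq> P \<and> 0 < e \<and>
        {\<psi> \<in> V. \<forall>p\<in>F. p (\<lambda>x\<in>D. \<psi> x - (\<lambda>x\<in>D. 0) x) < e} \<subseteq> {\<phi> \<in> topspace X. u \<phi> \<in> ball 0 1}"
      by (rule openin_nbhd) (use u0 zero_mem in \<open>simp add: topspace_X\<close>)
    then obtain F e where F: "finite F" "F \<subseteq> P" "0 < e"
        and sub: "{\<psi> \<in> V. \<forall>p\<in>F. p (\<lambda>x\<in>D. \<psi> x - (\<lambda>x\<in>D. 0) x) < e} \<subseteq> {\<phi> \<in> topspace X. u \<phi> \<in> ball 0 1}"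
      by blast
    have bd: "norm (u \<psi>) < 1" if "\<psi> \<in> V" "\<And>p. p \<in> F \<Longrightarrow> p \<psi> < e" for \<psi>
    proof -
      have "(\<lambda>x\<in>D. \<psi> x - (\<lambda>x\<in>D. 0) x) = \<psi>" by (subst (2) restrict_id[OF that(1), symmetric]) (rule restrict_ext, simp)
      then show ?thesis using sub that by auto
    qed
    have "norm (u \<phi>) \<le> (2 / e) * (\<Sum>p\<in>F. p \<phi>)" if \<phi>: "\<phi> \<in> V" for \<phi>
    proof (rule field_le_epsilon)
      fix \<delta> :: real assume \<delta>: "\<delta> > 0"
      \<comment> \<open>The term with \<open>\<delta>\<close> keeps \<open>s\<close> positive even
        if all these seminorms vanish at \<open>\<phi>\<close>. Scaling by \<open>t\<close> moves
        \<open>\<phi>\<close> into the neighbourhood, and the resulting bound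
        \<open>2 * s / e\<close> exceeds the desired one by exactly \<open>\<delta>\<close>.\<close>
      define s where "s = (\<Sum>p\<in>F. p \<phi>) + \<delta> * e / 2"
      have s0: "s > 0" unfolding s_def using F \<delta> \<phi> nonneg
        by (intro add_nonneg_pos sum_nonneg) auto
      define t where "t = e / (2 * s)"
      have t: "t > 0" "t * (2 * s) = e" using F(3) s0 by (auto simp: t_def)
      have "p (\<lambda>x\<in>D. complex_of_real t * \<phi> x) < e" if p: "p \<in> F" for p
      proof -
        have "p \<phi> \<le> (\<Sum>p\<in>F. p \<phi>)" using member_le_sum[OF p, of "\<lambda>p. p \<phi>"] F nonneg \<phi> by auto
        also have "\<dots> \<le> s" using \<delta> F(3) by (simp add: s_def)
        also have "\<dots> < 2 * s" using s0 by simp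
        finally have "t * p \<phi> < e" using t by (metis mult_less_cancel_left_pos)
        moreover have "p (\<lambda>x\<in>D. complex_of_real t * \<phi> x) = t * p \<phi>"
          using cmult[of p \<phi> "complex_of_real t"] p F \<phi> t by auto
        ultimately show ?thesis by simp
      qed
      then have "norm (u (\<lambda>x\<in>D. complex_of_real t * \<phi> x)) < 1"
        by (intro bd cmult_mem \<phi>)
      then have "t * norm (u \<phi>) < 1"
        using t by (simp add: cm[OF \<phi>] norm_mult)
      then have "norm (u \<phi>) \<le> 2 * s / e" using F(3) s0 by (simp add: t_def field_simps)
      then show "norm (u \<phi>) \<le> (2 / e) * (\<Sum>p\<in>F. p \<phi>) + \<delta>"
        using F(3) by (simp add: s_def field_simps)
    qed
    then show "dominated V P (\<lambda>\<phi>. norm (u \<phi>))"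
      unfolding dominated_def using F by (intro exI[of _ F] exI[of _ "2 / e"]) auto
  next
    assume "dominated V P (\<lambda>\<phi>. norm (u \<phi>))"
    then obtain F0 C where F0: "finite F0" "F0 \<subseteq> P" "0 \<le> C" "\<And>\<phi>. \<phi> \<in> V \<Longrightarrow> norm (u \<phi>) \<le> C * (\<Sum>p\<in>F0. p \<phi>)"
      unfolding dominated_def by blast
    have udiff: "u (\<lambda>x\<in>D. \<phi> x - \<psi> x) = u \<phi> - u \<psi>" if "\<phi> \<in> V" "\<psi> \<in> V" for \<phi> \<psi>
      unfolding diff_eq using add[OF that(1) cmult_mem[OF that(2), of "-1"]] cm[OF that(2), of "-1"] by simp
    show "continuous_map X euclidean u"
      unfolding continuous_map_def
    proof (intro conjI allI impI)
      fix T :: "complex set" assume "openin euclidean T"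
      then have T: "open T" by simp
      show "openin X {\<phi> \<in> topspace X. u \<phi> \<in> T}"
      proof (subst openin_subopen, intro ballI)
        fix \<phi> assume \<phi>: "\<phi> \<in> {\<phi> \<in> topspace X. u \<phi> \<in> T}"
        then have \<phi>V: "\<phi> \<in> V" by (simp add: topspace_X)
        obtain r where r: "r > 0" "ball (u \<phi>) r \<subseteq> T" using T \<phi> openE by blast
        \<comment> \<open>Chosen so that \<open>C\<close> times a sum of \<open>card F0\<close>
          terms equal to \<open>e\<close> stays below \<open>r\<close>; the summand 1 keeps the
          denominator positive if \<open>C\<close> is zero or \<open>F0\<close> is empty.\<close>
        define e where "e = r / (C * card F0 + 1)"
        have pos: "C * card F0 + 1 > 0" using F0(3) by (simp add: add_nonneg_pos)
        then have e: "e > 0" using r by (simp add: e_def)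
        obtain p0 where p0: "p0 \<in> P" using P_ne by auto
        \<comment> \<open>\<open>p0\<close> makes the index set nonempty, so that the intersection
          stays inside \<open>V\<close> even if \<open>F0\<close> is empty.\<close>
        let ?B = "\<Inter>p\<in>insert p0 F0. {\<psi> \<in> V. p (\<lambda>x\<in>D. \<psi> x - \<phi> x) < e}"
        have "openin X ?B"
          by (rule openin_INT2) (use F0 p0 openin_basic \<phi>V e in auto)
        moreover have "\<phi> \<in> ?B" using \<phi>V e F0 p0 by (auto simp: at_zero)
        moreover have "?B \<subseteq> {\<phi> \<in> topspace X. u \<phi> \<in> T}"
        proof
          fix \<psi> assume \<psi>: "\<psi> \<in> ?B"
          then have \<psi>V: "\<psi> \<in> V" by auto
          have "norm (u \<psi> - u \<phi>) \<le> C * (\<Sum>p\<in>F0. p (\<lambda>x\<in>D. \<psi> x - \<phi> x))"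
            using F0(4)[OF diff_mem[OF \<psi>V \<phi>V]] udiff[OF \<psi>V \<phi>V] by simp
          also have "\<dots> \<le> C * (\<Sum>p\<in>F0. e)"
            by (intro mult_left_mono sum_mono F0(3)) (use \<psi> in force)
          also have "\<dots> < r" using pos r(1) F0(3) by (simp add: e_def field_simps)
          finally have "u \<psi> \<in> ball (u \<phi>) r" by (simp add: dist_norm norm_minus_commute)
          then show "\<psi> \<in> {\<phi> \<in> topspace X. u \<phi> \<in> T}" using r \<psi>V by (auto simp: topspace_X)
        qed
        ultimately show "\<exists>T'. openin X T' \<and> \<phi> \<in> T' \<and> T' \<subseteq> {\<phi> \<in> topspace X. u \<phi> \<in> T}" by blast
      qed
    qed auto
  qed
  then show ?thesis unfolding topological_dual_def by blast
qed

end

section \<open>Polynomial growth of all derivatives relative to a weight\<close>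

section \<open>Slowly increasing functions\<close>

definition polybounded :: "'a set \<Rightarrow> ('a \<Rightarrow> real) \<Rightarrow> ('a \<Rightarrow> real) \<Rightarrow> bool" where
  "polybounded W w F \<longleftrightarrow> (\<exists>C\<ge>0. \<exists>N. \<forall>x\<in>W. F x \<le> C * w x ^ N)"

lemma polyboundedI: "(\<And>x. x \<in> W \<Longrightarrow> F x \<le> C * w x ^ N) \<Longrightarrow> 0 \<le> C \<Longrightarrow> polybounded W w F"
  unfolding polybounded_def by blast

lemma polybounded_mono:
  "polybounded W w G \<Longrightarrow> (\<And>x. x \<in> W \<Longrightarrow> F x \<le> G x) \<Longrightarrow> polybounded W w F"
  unfolding polybounded_def by (meson order_trans)

lemma polybounded_const: "polybounded W w (\<lambda>x. c)"
  by (rule polyboundedI[of _ _ "\<bar>c\<bar>" _ 0]) auto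

lemma polybounded_weight: "polybounded W w w"
  by (rule polyboundedI[of _ _ 1 _ 1]) auto

lemma polybounded_add:
  assumes "\<And>x. x \<in> W \<Longrightarrow> 1 \<le> w x" "polybounded W w F" "polybounded W w G"
  shows "polybounded W w (\<lambda>x. F x + G x)"
proof -
  obtain C N D M where *: "0 \<le> C" "0 \<le> D" "\<And>x. x \<in> W \<Longrightarrow> F x \<le> C * w x ^ N"
    "\<And>x. x \<in> W \<Longrightarrow> G x \<le> D * w x ^ M"
    using assms(2,3) unfolding polybounded_def by blast
  show ?thesis
  proof (rule polyboundedI)
    fix x assume x: "x \<in> W"
    have "w x ^ N \<le> w x ^ (N + M)" "w x ^ M \<le> w x ^ (N + M)"
      using assms(1)[OF x] by (auto intro: power_increasing)
    then have "C * w x ^ N \<le> C * w x ^ (N + M)" "D * w x ^ M \<le> D * w x ^ (N + M)"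
      using * by (auto intro: mult_left_mono)
    with *(3,4)[OF x] show "F x + G x \<le> (C + D) * w x ^ (N + M)" by (simp add: distrib_right)
  qed (use * in simp)
qed

lemma polybounded_mult:
  assumes "\<And>x. x \<in> W \<Longrightarrow> 1 \<le> w x" "polybounded W w F" "polybounded W w G"
    and "\<And>x. x \<in> W \<Longrightarrow> 0 \<le> F x" "\<And>x. x \<in> W \<Longrightarrow> 0 \<le> G x"
  shows "polybounded W w (\<lambda>x. F x * G x)"
proof -
  obtain C N D M where *: "0 \<le> C" "0 \<le> D" "\<And>x. x \<in> W \<Longrightarrow> F x \<le> C * w x ^ N"
    "\<And>x. x \<in> W \<Longrightarrow> G x \<le> D * w x ^ M"
    using assms(2,3) unfolding polybounded_def by blast
  show ?thesis
  proof (rule polyboundedI)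
    fix x assume x: "x \<in> W"
    have "F x * G x \<le> (C * w x ^ N) * (D * w x ^ M)"
      using * x assms(4,5) by (intro mult_mono) (auto intro: order_trans)
    then show "F x * G x \<le> (C * D) * w x ^ (N + M)" by (simp add: power_add mult_ac)
  qed (use * in simp)
qed

lemma polybounded_sum_list:
  assumes "\<And>x. x \<in> W \<Longrightarrow> 1 \<le> w x" "\<And>p. p \<in> set ps \<Longrightarrow> polybounded W w (F p)"
  shows "polybounded W w (\<lambda>x. \<Sum>p\<leftarrow>ps. F p x)"
  using assms(2) by (induction ps) (auto intro: polybounded_const polybounded_add[OF assms(1)])

text \<open>\<open>n\<close> bounds the order of the derivatives that are controlled; a weight \<open>w \<ge> 1\<close> that blows up at
  the boundary of \<open>W\<close> permits polynomial growth towards that boundary.\<close>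

definition slowly_increasing ::
    "nat \<Rightarrow> (real^'n::finite) set \<Rightarrow> (real^'n \<Rightarrow> real) \<Rightarrow> (real^'n \<Rightarrow> complex) \<Rightarrow> bool" where
  "slowly_increasing n W w g \<longleftrightarrow>
     smooth_on W g \<and> (\<forall>is. length is \<le> n \<longrightarrow> polybounded W w (\<lambda>x. norm (partial_derivs is g x)))"

lemma slowly_increasing_smooth: "slowly_increasing n W w g \<Longrightarrow> smooth_on W g"
  by (simp add: slowly_increasing_def)

lemma slowly_increasing_cong:
  assumes "slowly_increasing n W w f" "\<And>x. x \<in> W \<Longrightarrow> f x = g x"
  shows "slowly_increasing n W w g"
proof -
  have s: "smooth_on W f" using assms(1) by (rule slowly_increasing_smooth)
  have "polybounded W w (\<lambda>x. norm (partial_derivs is g x))" if "length is \<le> n" for "is"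
    by (rule polybounded_mono[of _ _ "\<lambda>x. norm (partial_derivs is f x)"])
      (use assms that partial_derivs_cong_open[OF smooth_onD_open[OF s], of f g] in
        \<open>auto simp: slowly_increasing_def\<close>)
  then show ?thesis using smooth_on_cong[OF s assms(2)] by (simp add: slowly_increasing_def)
qed

text \<open>The induction step of all symbol estimates. Lists are split at their last entry, which
  is the derivative applied first, so only the first partial derivatives of \<open>g\<close> have to
  be computed and recognised.\<close>

lemma slowly_increasing_Suc:
  assumes "smooth_on W g" "polybounded W w (\<lambda>x. norm (g x))"
    "\<And>i. slowly_increasing n W w (partial_deriv i g)"
  shows "slowly_increasing (Suc n) W w g"
  unfolding slowly_increasing_def
proof (intro conjI allI impI)
  fix "is" :: "'a list" assume "length is \<le> Suc n"
  then show "polybounded W w (\<lambda>x. norm (partial_derivs is g x))"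
    using assms(2,3) by (cases "is" rule: rev_cases) (auto simp: partial_derivs_append slowly_increasing_def)
qed (rule assms)

lemma slowly_increasing_partial_deriv:
  assumes "slowly_increasing (Suc n) W w g"
  shows "slowly_increasing n W w (partial_deriv i g)"
proof -
  have "polybounded W w (\<lambda>x. norm (partial_derivs is (partial_deriv i g) x))" if "length is \<le> n" for "is"
    using assms that unfolding slowly_increasing_def
    by (auto dest!: spec[of _ "is @ [i]"] simp: partial_derivs_append)
  then show ?thesis
    using assms by (simp add: slowly_increasing_def smooth_on_partial_deriv)
qed

lemma slowly_increasing_polybounded:
  "slowly_increasing n W w g \<Longrightarrow> polybounded W w (\<lambda>x. norm (g x))"
  unfolding slowly_increasing_def by (metis le0 list.size(3) partial_derivs_Nil)

lemma slowly_increasing_SucD: "slowly_increasing (Suc n) W w g \<Longrightarrow> slowly_increasing n W w g"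
  unfolding slowly_increasing_def by auto

lemma slowly_increasing_const:
  "open W \<Longrightarrow> slowly_increasing n W w (\<lambda>x. c)"
  unfolding slowly_increasing_def
  by (auto simp: smooth_on_const partial_derivs_const polybounded_const)

lemma slowly_increasing_add:
  assumes w: "\<And>x. x \<in> W \<Longrightarrow> 1 \<le> w x" and "slowly_increasing n W w f" "slowly_increasing n W w g"
  shows "slowly_increasing n W w (\<lambda>x. f x + g x)"
proof -
  have s: "smooth_on W f" "smooth_on W g" using assms slowly_increasing_smooth by blast+
  have "polybounded W w (\<lambda>x. norm (partial_derivs is (\<lambda>x. f x + g x) x))" if "length is \<le> n" for "is"
    by (rule polybounded_mono[OF polybounded_add[of W w "\<lambda>x. norm (partial_derivs is f x)" 
            "\<lambda>x. norm (partial_derivs is g x)"]])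
      (use assms that in \<open>auto simp: slowly_increasing_def partial_derivs_add[OF s] norm_triangle_ineq\<close>)
  then show ?thesis using s by (simp add: slowly_increasing_def smooth_on_add)
qed

lemma slowly_increasing_mult:
  assumes w: "\<And>x. x \<in> W \<Longrightarrow> 1 \<le> w x" and "slowly_increasing n W w f" "slowly_increasing n W w g"
  shows "slowly_increasing n W w (\<lambda>x. f x * g x)"
proof -
  have s: "smooth_on W f" "smooth_on W g" using assms slowly_increasing_smooth by blast+
  have "polybounded W w (\<lambda>x. norm (partial_derivs is (\<lambda>x. f x * g x) x))" if len: "length is \<le> n" for "is"
  proof (rule polybounded_mono[OF polybounded_sum_list norm_partial_derivs_mult_le[OF s]])
    fix p assume p: "p \<in> set (leibniz_splits is)"
    then have "length (fst p) \<le> n" "length (snd p) \<le> n"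
      using length_leibniz_splits[of "fst p" "snd p" "is"] len by auto
    then show "polybounded W w (\<lambda>x. norm (partial_derivs (fst p) f x) * norm (partial_derivs (snd p) g x))"
      using assms by (intro polybounded_mult) (auto simp: slowly_increasing_def)
  qed (use w in auto)
  then show ?thesis using s by (simp add: slowly_increasing_def smooth_on_mult)
qed

lemma slowly_increasing_cmult:
  assumes "\<And>x. x \<in> W \<Longrightarrow> 1 \<le> w x" "slowly_increasing n W w f"
  shows "slowly_increasing n W w (\<lambda>x. c * f x)"
  using slowly_increasing_mult[OF assms(1) slowly_increasing_const assms(2)]
    slowly_increasing_smooth[OF assms(2)] smooth_onD_open by blast

lemma partial_deriv_coord:
  "partial_deriv i (\<lambda>x::real^'n::finite. complex_of_real (x $ j)) = (\<lambda>x. if i = j then 1 else 0)"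
proof
  fix x :: "real^'n"
  have "bounded_linear (\<lambda>x::real^'n. complex_of_real (x $ j))"
    by (intro bounded_linear_compose[OF bounded_linear_of_real] bounded_linear_vec_nth)
  then have "((\<lambda>x::real^'n. complex_of_real (x $ j)) has_derivative (\<lambda>x. complex_of_real (x $ j))) (at x)"
    by (rule bounded_linear_imp_has_derivative)
  then show "partial_deriv i (\<lambda>x::real^'n. complex_of_real (x $ j)) x = (if i = j then 1 else 0)"
    by (simp add: partial_deriv_eqI axis_def)
qed

lemma slowly_increasing_coord:
  assumes "open W" "\<And>x. x \<in> W \<Longrightarrow> 1 + norm x \<le> w x"
  shows "slowly_increasing n W w (\<lambda>x. complex_of_real (x $ j))"
proof -
  have "polybounded W w (\<lambda>x. norm (complex_of_real (x $ j)))"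
  proof (rule polybounded_mono[OF polybounded_weight])
    fix x assume "x \<in> W"
    then show "norm (complex_of_real (x $ j)) \<le> w x"
      using assms(2)[of x] component_le_norm_cart[of x j] by simp
  qed
  then show ?thesis
  proof (induction n)
    case 0
    then show ?case using assms by (simp add: slowly_increasing_def smooth_on_coord)
  next
    case (Suc n)
    then show ?case
      using assms by (intro slowly_increasing_Suc)
        (auto simp: smooth_on_coord partial_deriv_coord slowly_increasing_const)
  qed
qed

lemma partial_deriv_inverse:
  assumes "f differentiable (at x)" "f x \<noteq> 0"
  shows "partial_deriv i (\<lambda>x. inverse (f x)) x = - (partial_deriv i f x * (inverse (f x) * inverse (f x)))"
proof -
  have "(f has_derivative frechet_derivative f (at x)) (at x)"
    using assms(1) frechet_derivative_works by blast
  from Deriv.has_derivative_inverse[OF assms(2) this] show ?thesis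
    by (simp add: partial_deriv_eqI) (simp add: partial_deriv_def)
qed

lemma smooth_on_inverse:
  assumes "smooth_on W g" "\<And>x. x \<in> W \<Longrightarrow> g x \<noteq> 0"
  shows "smooth_on W (\<lambda>x. inverse (g x))"
  using assms unfolding smooth_on_iff_Ck_on
  by (intro conjI allI Ck_on_compose[OF Ck_on_inverse]) auto

text \<open>The lower bound controls 1/g, and the derivative -g'/g^2 is a product of functions that
  are already controlled at the lower order.\<close>

lemma slowly_increasing_inverse:
  assumes w: "\<And>x. x \<in> W \<Longrightarrow> 1 \<le> w x" and g: "\<And>n. slowly_increasing n W w g"
    and c: "\<And>x. x \<in> W \<Longrightarrow> c \<le> norm (g x)" "0 < c"
  shows "slowly_increasing n W w (\<lambda>x. inverse (g x))"
proof (induction n)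
  have s: "smooth_on W g" using g slowly_increasing_smooth by blast
  have nz: "g x \<noteq> 0" if "x \<in> W" for x using c that by force
  note si = smooth_on_inverse[OF s nz]
  have pb: "polybounded W w (\<lambda>x. norm (inverse (g x)))"
    by (rule polybounded_mono[OF polybounded_const[of _ _ "inverse c"]])
      (use c in \<open>auto simp: norm_inverse intro!: le_imp_inverse_le\<close>)
  {
    case 0
    show ?case using si pb by (simp add: slowly_increasing_def)
  next
    case (Suc n)
    have "slowly_increasing n W w (partial_deriv i (\<lambda>x. inverse (g x)))" for i
    proof (rule slowly_increasing_cong)
      show "slowly_increasing n W w (\<lambda>x. (- 1) * (partial_deriv i g x * (inverse (g x) * inverse (g x))))"
        using slowly_increasing_partial_deriv[OF g] Suc w
        by (intro slowly_increasing_cmult slowly_increasing_mult) auto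
    qed (use s nz in \<open>simp add: partial_deriv_inverse smooth_on_differentiable\<close>)
    with si pb show ?case by (rule slowly_increasing_Suc)
  }
qed

section \<open>Seminorms, tempered distributions and continuous operators\<close>

section \<open>The Schwartz space\<close>

definition schwartz_seminorms :: "((real^'n::finite \<Rightarrow> complex) \<Rightarrow> real) set" where
  "schwartz_seminorms = {schwartz_seminorm k is | k is. True}"

abbreviation schwartz_dominated :: "((real^'n::finite \<Rightarrow> complex) \<Rightarrow> real) \<Rightarrow> bool" where
  "schwartz_dominated \<equiv> dominated schwartz_space schwartz_seminorms"

lemma schwartz_smooth: "\<phi> \<in> schwartz_space \<Longrightarrow> smooth_on UNIV \<phi>"
  by (simp add: schwartz_space_def)

lemma schwartz_spaceI:
  assumes "smooth_on UNIV \<phi>" "\<And>k is. \<exists>C. \<forall>x. norm x ^ k * norm (partial_derivs is \<phi> x) \<le> C"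
  shows "\<phi> \<in> schwartz_space"
proof -
  have "bounded (range (\<lambda>x. norm x ^ k * norm (partial_derivs is \<phi> x)))" for k "is"
    using assms(2)[of k "is"] by (auto simp: bounded_iff abs_mult)
  with assms(1) show ?thesis by (simp add: schwartz_space_def)
qed

lemma schwartz_seminorm_upper:
  assumes "\<phi> \<in> schwartz_space"
  shows "norm x ^ k * norm (partial_derivs is \<phi> x) \<le> schwartz_seminorm k is \<phi>"
  unfolding schwartz_seminorm_def
  by (rule cSUP_upper) (use assms in \<open>auto simp: schwartz_space_def intro: bounded_imp_bdd_above\<close>)

lemma schwartz_seminorm_least:
  "(\<And>x. norm x ^ k * norm (partial_derivs is \<phi> x) \<le> C) \<Longrightarrow> schwartz_seminorm k is \<phi> \<le> C"
  unfolding schwartz_seminorm_def by (rule cSUP_least) auto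

lemma schwartz_add: 
  assumes "\<phi> \<in> schwartz_space" "\<psi> \<in> schwartz_space"
  shows "(\<lambda>x. \<phi> x + \<psi> x) \<in> schwartz_space"
    and "schwartz_seminorm k is (\<lambda>x. \<phi> x + \<psi> x) \<le> schwartz_seminorm k is \<phi> + schwartz_seminorm k is \<psi>"
proof -
  note s = schwartz_smooth[OF assms(1)] schwartz_smooth[OF assms(2)]
  have *: "norm x ^ k * norm (partial_derivs is (\<lambda>x. \<phi> x + \<psi> x) x)
      \<le> schwartz_seminorm k is \<phi> + schwartz_seminorm k is \<psi>" for x k "is"
  proof -
    have "norm x ^ k * norm (partial_derivs is (\<lambda>x. \<phi> x + \<psi> x) x) \<le>
       norm x ^ k * (norm (partial_derivs is \<phi> x) + norm (partial_derivs is \<psi> x))"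
      by (rule mult_left_mono) (auto simp: partial_derivs_add[OF s] norm_triangle_ineq)
    then show ?thesis using schwartz_seminorm_upper[OF assms(1), of x k "is"]
        schwartz_seminorm_upper[OF assms(2), of x k "is"] by (simp add: distrib_left)
  qed
  show "(\<lambda>x. \<phi> x + \<psi> x) \<in> schwartz_space"
    by (rule schwartz_spaceI) (use s * in \<open>auto intro: smooth_on_add\<close>)
  show "schwartz_seminorm k is (\<lambda>x. \<phi> x + \<psi> x) \<le> schwartz_seminorm k is \<phi> + schwartz_seminorm k is \<psi>"
    by (rule schwartz_seminorm_least[OF *])
qed

lemma schwartz_cmult_mem:
  assumes "\<phi> \<in> schwartz_space"
  shows "(\<lambda>x. c * \<phi> x) \<in> schwartz_space"
proof (rule schwartz_spaceI)
  note s = schwartz_smooth[OF assms]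
  show "smooth_on UNIV (\<lambda>x. c * \<phi> x)" using s by (rule smooth_on_cmult)
  have "norm x ^ k * norm (partial_derivs is (\<lambda>x. c * \<phi> x) x) \<le> norm c * schwartz_seminorm k is \<phi>" for k "is" x
    using mult_left_mono[OF schwartz_seminorm_upper[OF assms, of x k "is"], of "norm c"]
    by (simp add: partial_derivs_cmult[OF s] norm_mult mult_ac)
  then show "\<exists>C. \<forall>x. norm x ^ k * norm (partial_derivs is (\<lambda>x. c * \<phi> x) x) \<le> C" for k "is" by blast
qed

lemma schwartz_seminorm_cmult:
  assumes "\<phi> \<in> schwartz_space"
  shows "schwartz_seminorm k is (\<lambda>x. c * \<phi> x) = norm c * schwartz_seminorm k is \<phi>"
proof -
  have le: "schwartz_seminorm k is (\<lambda>x. c * \<phi> x) \<le> norm c * schwartz_seminorm k is \<phi>"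
    if "\<phi> \<in> schwartz_space" for \<phi> :: "real^'a \<Rightarrow> complex" and c
    by (rule schwartz_seminorm_least)
      (use mult_left_mono[OF schwartz_seminorm_upper[OF that, of _ k "is"], of "norm c"] in
       \<open>simp add: partial_derivs_cmult[OF schwartz_smooth[OF that]] norm_mult mult_ac\<close>)
  show ?thesis
  proof (cases "c = 0")
    case True
    have "norm (0::real^'a) ^ k * norm (partial_derivs is (\<lambda>x. c * \<phi> x) 0) \<le> schwartz_seminorm k is (\<lambda>x. c * \<phi> x)"
      by (rule schwartz_seminorm_upper[OF schwartz_cmult_mem[OF assms]])
    then have "0 \<le> schwartz_seminorm k is (\<lambda>x. c * \<phi> x)" by (rule order_trans[rotated]) simp
    with le[OF assms, of c] True show ?thesis by simp
  next
    case False
    have "norm c * schwartz_seminorm k is \<phi> = norm c * schwartz_seminorm k is (\<lambda>x. inverse c * (c * \<phi> x))"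
      using False by (simp flip: mult.assoc)
    also have "\<dots> \<le> norm c * (norm (inverse c) * schwartz_seminorm k is (\<lambda>x. c * \<phi> x))"
      by (intro mult_left_mono le schwartz_cmult_mem assms) simp
    also have "\<dots> = schwartz_seminorm k is (\<lambda>x. c * \<phi> x)" using False by (simp add: norm_inverse)
    finally show ?thesis using le[OF assms, of c] by (rule antisym[rotated])
  qed
qed

lemma schwartz_minus: "\<phi> \<in> schwartz_space \<Longrightarrow> (\<lambda>x. - \<phi> x) \<in> schwartz_space"
  using schwartz_cmult_mem[of \<phi> "-1"] by simp

lemma schwartz_diff:
  "\<phi> \<in> schwartz_space \<Longrightarrow> \<psi> \<in> schwartz_space \<Longrightarrow> (\<lambda>x. \<phi> x - \<psi> x) \<in> schwartz_space"
  using schwartz_add(1)[of \<phi> "\<lambda>x. - \<psi> x"] schwartz_minus[of \<psi>] by simp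

lemma schwartz_zero: "(\<lambda>x. 0) \<in> schwartz_space"
  by (rule schwartz_spaceI) (auto simp: smooth_on_const partial_derivs_const)

interpretation schwartz: seminorm_space UNIV schwartz_space schwartz_seminorms
proof
  show "(schwartz_space :: (real^'a \<Rightarrow> complex) set) \<noteq> {}" using schwartz_zero by blast
qed (auto simp: schwartz_seminorms_def restrict_UNIV schwartz_add schwartz_cmult_mem schwartz_seminorm_cmult)

lemma schwartz_nonneg: "\<forall>p\<in>schwartz_seminorms. \<forall>\<phi>\<in>schwartz_space. 0 \<le> p \<phi>"
  using schwartz.nonneg by blast

lemma tempered_distributions_iff:
  "U \<in> tempered_distributions \<longleftrightarrow>
     U \<in> extensional schwartz_space \<and>
     (\<forall>\<phi>\<in>schwartz_space. \<forall>\<psi>\<in>schwartz_space. U (\<lambda>x. \<phi> x + \<psi> x) = U \<phi> + U \<psi>) \<and>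
     (\<forall>c. \<forall>\<phi>\<in>schwartz_space. U (\<lambda>x. c * \<phi> x) = c * U \<phi>) \<and>
     schwartz_dominated (\<lambda>\<phi>. norm (U \<phi>))"
  unfolding tempered_distributions_def schwartz_topology_def schwartz_seminorms_def[symmetric]
    schwartz.topological_dual_iff restrict_UNIV ..

lemma schwartz_dominated_seminorm: "schwartz_dominated (schwartz_seminorm k is)"
  by (rule dominated_member) (auto simp: schwartz_seminorms_def)

lemmas schwartz_dominated_add = dominated_add[where P=schwartz_seminorms, OF schwartz_nonneg]
lemmas schwartz_dominated_sum = dominated_sum[where P=schwartz_seminorms, OF schwartz_nonneg]
lemmas schwartz_dominated_sum_list = dominated_sum_list[where P=schwartz_seminorms, OF schwartz_nonneg]

text \<open>Continuity of a self-map of the Schwartz space in the form of estimates; linearity is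
  treated separately where it matters.\<close>

definition schwartz_operator :: "((real^'n::finite \<Rightarrow> complex) \<Rightarrow> real^'n \<Rightarrow> complex) \<Rightarrow> bool" where
  "schwartz_operator A \<longleftrightarrow>
     (\<forall>\<phi>\<in>schwartz_space. A \<phi> \<in> schwartz_space) \<and>
     (\<forall>k is. schwartz_dominated (\<lambda>\<phi>. schwartz_seminorm k is (A \<phi>)))"

lemma schwartz_operatorI:
  assumes "\<And>\<phi>. \<phi> \<in> schwartz_space \<Longrightarrow> smooth_on UNIV (A \<phi>)"
    and "\<And>k is. \<exists>q. schwartz_dominated q \<and>
      (\<forall>\<phi>\<in>schwartz_space. \<forall>x. norm x ^ k * norm (partial_derivs is (A \<phi>) x) \<le> q \<phi>)"
  shows "schwartz_operator A"
  unfolding schwartz_operator_def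
proof (intro conjI ballI allI)
  show "A \<phi> \<in> schwartz_space" if "\<phi> \<in> schwartz_space" for \<phi>
    by (rule schwartz_spaceI) (use assms that in blast)+
  fix k "is"
  obtain q where "schwartz_dominated q" 
    "\<forall>\<phi>\<in>schwartz_space. \<forall>x. norm x ^ k * norm (partial_derivs is (A \<phi>) x) \<le> q \<phi>"
    using assms(2) by blast
  then show "schwartz_dominated (\<lambda>\<phi>. schwartz_seminorm k is (A \<phi>))"
    by (auto intro: dominated_mono schwartz_seminorm_least)
qed

lemma schwartz_operator_mem: "schwartz_operator A \<Longrightarrow> \<phi> \<in> schwartz_space \<Longrightarrow> A \<phi> \<in> schwartz_space"
  by (simp add: schwartz_operator_def)

lemma schwartz_operator_dominated:
  assumes "schwartz_operator A" "schwartz_dominated q"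
  shows "schwartz_dominated (\<lambda>\<phi>. q (A \<phi>))"
  by (rule dominated_compose[OF schwartz_nonneg _ _ assms(2)])
    (use assms(1) in \<open>auto simp: schwartz_operator_def schwartz_seminorms_def\<close>)

lemma schwartz_operator_compose:
  assumes "schwartz_operator A" "schwartz_operator B"
  shows "schwartz_operator (\<lambda>\<phi>. A (B \<phi>))"
  using assms schwartz_operator_dominated[OF assms(2)]
  by (auto simp: schwartz_operator_def)

lemma schwartz_operator_partial_deriv: "schwartz_operator (partial_deriv i)"
proof (rule schwartz_operatorI)
  fix k "is"
  show "\<exists>q. schwartz_dominated q \<and>
      (\<forall>\<phi>\<in>schwartz_space. \<forall>x. norm x ^ k * norm (partial_derivs is (partial_deriv i \<phi>) x) \<le> q \<phi>)"
    by (rule exI[of _ "schwartz_seminorm k (is @ [i])"])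
      (use schwartz_seminorm_upper[of _ _ k "is @ [i]"] in
        \<open>simp add: schwartz_dominated_seminorm partial_derivs_append\<close>)
qed (use schwartz_smooth smooth_on_partial_deriv in blast)

lemma schwartz_partial_deriv: "\<phi> \<in> schwartz_space \<Longrightarrow> partial_deriv i \<phi> \<in> schwartz_space"
  by (rule schwartz_operator_mem[OF schwartz_operator_partial_deriv])

lemma one_plus_power_le: "(1 + r) ^ N \<le> 2 ^ N * (1 + r ^ N)" if "0 \<le> r" for r :: real
proof -
  have "(1 + r) ^ N \<le> (2 * max 1 r) ^ N" by (rule power_mono) (use that in auto)
  also have "\<dots> \<le> 2 ^ N * (1 + r ^ N)" unfolding power_mult_distrib
    by (rule mult_left_mono) (use that in \<open>auto simp: max_def\<close>)
  finally show ?thesis .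
qed

text \<open>In each Leibniz term the growth of the derivative of \<open>g\<close> costs a fixed
  power of |x|, which a seminorm with a larger exponent pays for.\<close>

lemma schwartz_operator_mult:
  assumes "\<And>n. slowly_increasing n UNIV (\<lambda>x. 1 + norm x) g"
  shows "schwartz_operator (\<lambda>\<phi> x. g x * \<phi> x)"
proof (rule schwartz_operatorI)
  have sg: "smooth_on UNIV g" using assms slowly_increasing_smooth by blast
  then show "smooth_on UNIV (\<lambda>x. g x * \<phi> x)" if "\<phi> \<in> schwartz_space" for \<phi>
    using schwartz_smooth[OF that] by (rule smooth_on_mult)
  fix k and "is" :: "'a list"
  have "\<exists>C N. 0 \<le> C \<and> (\<forall>x. norm (partial_derivs a g x) \<le> C * (1 + norm x) ^ N)" for a
    using assms[of "length a"] unfolding slowly_increasing_def polybounded_def by auto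
  then obtain C N where CN: "\<And>a. 0 \<le> C a" "\<And>a x. norm (partial_derivs a g x) \<le> C a * (1 + norm x) ^ N a"
    by metis
  define q where "q p \<phi> = C (fst p) * (2 ^ N (fst p) *
      (schwartz_seminorm k (snd p) \<phi> + schwartz_seminorm (k + N (fst p)) (snd p) \<phi>))"
    for p :: "'a list \<times> 'a list" and \<phi>
  have "norm x ^ k * norm (partial_derivs is (\<lambda>x. g x * \<phi> x) x) \<le> (\<Sum>p\<leftarrow>leibniz_splits is. q p \<phi>)"
    if \<phi>: "\<phi> \<in> schwartz_space" for \<phi> x
  proof -
    have "norm x ^ k * norm (partial_derivs is (\<lambda>x. g x * \<phi> x) x) \<le>
       norm x ^ k * (\<Sum>p\<leftarrow>leibniz_splits is. norm (partial_derivs (fst p) g x) * norm (partial_derivs (snd p) \<phi> x))"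
      by (intro mult_left_mono norm_partial_derivs_mult_le[OF sg schwartz_smooth[OF \<phi>]]) auto
    also have "\<dots> = (\<Sum>p\<leftarrow>leibniz_splits is. norm x ^ k * (norm (partial_derivs (fst p) g x) * norm (partial_derivs (snd p) \<phi> x)))"
      by (simp add: sum_list_const_mult)
    also have "\<dots> \<le> (\<Sum>p\<leftarrow>leibniz_splits is. q p \<phi>)"
    proof (rule sum_list_mono)
      fix p :: "'a list \<times> 'a list"
      let ?N = "N (fst p)" and ?D = "norm (partial_derivs (snd p) \<phi> x)"
      have "norm x ^ k * (norm (partial_derivs (fst p) g x) * ?D)
          \<le> norm x ^ k * ((C (fst p) * (2 ^ ?N * (1 + norm x ^ ?N))) * ?D)"
        by (intro mult_left_mono mult_right_mono order_trans[OF CN(2)] one_plus_power_le CN(1)) auto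
      also have "\<dots> = C (fst p) * (2 ^ ?N * (norm x ^ k * ?D + norm x ^ (k + ?N) * ?D))"
        by (simp add: algebra_simps power_add)
      also have "\<dots> \<le> q p \<phi>" unfolding q_def
        by (intro mult_left_mono add_mono schwartz_seminorm_upper \<phi> CN(1)) auto
      finally show "norm x ^ k * (norm (partial_derivs (fst p) g x) * ?D) \<le> q p \<phi>" .
    qed
    finally show ?thesis .
  qed
  moreover have "schwartz_dominated (\<lambda>\<phi>. \<Sum>p\<leftarrow>leibniz_splits is. q p \<phi>)"
    unfolding q_def
    by (intro schwartz_dominated_sum_list dominated_cmult schwartz_dominated_add
        schwartz_dominated_seminorm CN(1)) auto
  ultimately show "\<exists>q. schwartz_dominated q \<and>
      (\<forall>\<phi>\<in>schwartz_space. \<forall>x. norm x ^ k * norm (partial_derivs is (\<lambda>x. g x * \<phi> x) x) \<le> q \<phi>)"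
    by blast
qed

lemma schwartz_operator_coord: "schwartz_operator (\<lambda>\<phi> x. complex_of_real (x $ j) * \<phi> x)"
  by (rule schwartz_operator_mult) (simp add: slowly_increasing_coord)

lemma schwartz_operator_cmult: "schwartz_operator (\<lambda>\<phi> x. c * \<phi> x)"
  by (rule schwartz_operator_mult) (simp add: slowly_increasing_const)

lemma partial_derivs_reflect:
  assumes "smooth_on UNIV \<phi>"
  shows "partial_derivs is (\<lambda>x. \<phi> (- x)) x = (- 1) ^ length is * partial_derivs is \<phi> (- x)"
proof (induction "is" arbitrary: x)
  case (Cons i "is")
  have "(partial_derivs is \<phi> has_derivative frechet_derivative (partial_derivs is \<phi>) (at (- x))) (at (- x))"
    using smooth_on_differentiable[OF smooth_on_partial_derivs[OF assms], of "- x"]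
      frechet_derivative_works by blast
  from has_derivative_compose[of uminus uminus x UNIV, OF _ this]
  have d: "((\<lambda>x. partial_derivs is \<phi> (- x)) has_derivative
      (\<lambda>v. frechet_derivative (partial_derivs is \<phi>) (at (- x)) (- v))) (at x)"
    by (simp add: has_derivative_minus[OF has_derivative_ident])
  have "linear (frechet_derivative (partial_derivs is \<phi>) (at (- x)))"
    using smooth_on_differentiable[OF smooth_on_partial_derivs[OF assms], of "- x"]
    by (simp add: linear_frechet_derivative)
  moreover have "partial_derivs is (\<lambda>x. \<phi> (- x)) = (\<lambda>x. (- 1) ^ length is * partial_derivs is \<phi> (- x))"
    using Cons by (rule ext)
  ultimately show ?case
    using has_derivative_mult_right[OF d, of "(-1) ^ length is"]
    by (simp add: partial_deriv_eqI linear_neg) (simp add: partial_deriv_def)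
qed simp

lemma smooth_on_reflect: "smooth_on UNIV \<phi> \<Longrightarrow> smooth_on UNIV (\<lambda>x. \<phi> (- x))"
  unfolding smooth_on_iff_Ck_on
  by (intro conjI allI Ck_on_compose[of _ UNIV \<phi> UNIV uminus]
      Ck_on_bounded_linear[OF bounded_linear_minus[OF bounded_linear_ident]]) auto

lemma schwartz_operator_reflect: "schwartz_operator (\<lambda>\<phi> x. \<phi> (- x))"
proof (rule schwartz_operatorI)
  fix k "is"
  show "\<exists>q. schwartz_dominated q \<and>
      (\<forall>\<phi>\<in>schwartz_space. \<forall>x. norm x ^ k * norm (partial_derivs is (\<lambda>x. \<phi> (- x)) x) \<le> q \<phi>)"
    by (rule exI[of _ "schwartz_seminorm k is"])
      (use schwartz_seminorm_upper[of _ "- x" k "is" for x] in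
        \<open>auto simp: schwartz_dominated_seminorm partial_derivs_reflect[OF schwartz_smooth] norm_mult norm_power\<close>)
qed (use schwartz_smooth smooth_on_reflect in blast)

lemma partial_derivs_outside:
  assumes "\<And>x. R < norm x \<Longrightarrow> \<phi> x = 0" "R < norm x"
  shows "partial_derivs is \<phi> x = 0"
proof -
  have "open {x::real^'a. R < norm x}" by (intro open_Collect_less continuous_intros)
  then have "partial_derivs is \<phi> x = partial_derivs is (\<lambda>x. 0) x"
    by (rule partial_derivs_cong_open) (use assms in simp_all)
  then show ?thesis by (simp add: partial_derivs_const)
qed

lemma smooth_bounded_on_compact:
  assumes "smooth_on W \<phi>" "compact K" "K \<subseteq> W"
  shows "\<exists>C\<ge>0. \<forall>x\<in>K. norm (partial_derivs is \<phi> x) \<le> C"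
proof -
  have "compact (partial_derivs is \<phi> ` K)"
    by (rule compact_continuous_image[OF continuous_on_subset[OF smooth_on_continuous[OF
            smooth_on_partial_derivs[OF assms(1)]] assms(3)] assms(2)])
  then have "bounded (partial_derivs is \<phi> ` K)" by (rule compact_imp_bounded)
  then obtain C where C: "\<forall>y\<in>partial_derivs is \<phi> ` K. norm y \<le> C"
    unfolding bounded_iff by blast
  have "norm (partial_derivs is \<phi> x) \<le> max 0 C" if "x \<in> K" for x
    using bspec[OF C imageI[OF that]] by simp
  then show ?thesis by (intro exI[of _ "max 0 C"]) simp
qed

lemma bounded_support_derivs_bounded:
  assumes "smooth_on UNIV \<phi>" "\<And>x. R < norm x \<Longrightarrow> \<phi> x = 0"
  shows "\<exists>C\<ge>0. \<forall>x. norm (partial_derivs is \<phi> x) \<le> C"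
proof -
  obtain C where C: "C \<ge> 0" "\<forall>x\<in>cball 0 R. norm (partial_derivs is \<phi> x) \<le> C"
    using smooth_bounded_on_compact[OF assms(1), of "cball 0 R" "is"] by auto
  have "norm (partial_derivs is \<phi> x) \<le> C" for x
  proof (cases "R < norm x")
    case True
    then show ?thesis using partial_derivs_outside[OF assms(2) True] C(1) by simp
  next
    case False
    then show ?thesis using C(2) by simp
  qed
  then show ?thesis using C(1) by blast
qed

lemma slowly_increasing_bounded_support:
  assumes "smooth_on UNIV \<phi>" "\<And>x. R < norm x \<Longrightarrow> \<phi> x = 0"
  shows "slowly_increasing n UNIV w \<phi>"
proof -
  have "polybounded UNIV w (\<lambda>x. norm (partial_derivs is \<phi> x))" for "is"
  proof -
    obtain C where C: "\<forall>x. norm (partial_derivs is \<phi> x) \<le> C"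
      using bounded_support_derivs_bounded[OF assms] by blast
    show ?thesis by (rule polybounded_mono[OF polybounded_const[of UNIV w C]]) (use C in simp)
  qed
  then show ?thesis using assms(1) by (simp add: slowly_increasing_def)
qed

lemma bounded_support_schwartz:
  assumes "smooth_on UNIV \<phi>" "\<And>x. R < norm x \<Longrightarrow> \<phi> x = 0"
  shows "\<phi> \<in> schwartz_space"
proof (rule schwartz_spaceI[OF assms(1)])
  fix k "is"
  obtain C where C: "C \<ge> 0" "\<And>x. norm (partial_derivs is \<phi> x) \<le> C"
    using bounded_support_derivs_bounded[OF assms] by blast
  have "norm x ^ k * norm (partial_derivs is \<phi> x) \<le> \<bar>R\<bar> ^ k * C" for x
  proof (cases "R < norm x")
    case True
    then show ?thesis using partial_derivs_outside[OF assms(2) True] C by simp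
  next
    case False
    then show ?thesis using C by (intro mult_mono power_mono) auto
  qed
  then show "\<exists>C. \<forall>x. norm x ^ k * norm (partial_derivs is \<phi> x) \<le> C" by blast
qed

section \<open>Domination by an integrable product of one-dimensional functions\<close>

section \<open>Integrability of Schwartz functions\<close>

text \<open>Lebesgue measure is the image of a product of one-dimensional Lebesgue measures, so
  functions that factor over the coordinates are integrated factor by factor. This serves both
  \<open>majorant\<close> and \<open>gaussian\<close>.\<close>

lemma
  fixes g :: "'a::euclidean_space \<Rightarrow> real \<Rightarrow> 'b::{real_normed_field, banach, second_countable_topology}"
  assumes g: "\<And>b. b \<in> Basis \<Longrightarrow> integrable lborel (g b)"
  shows integrable_prod_Basis: "integrable lborel (\<lambda>x. \<Prod>b\<in>Basis. g b (x \<bullet> b))"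
    and integral_prod_Basis: "(LINT x|lborel. (\<Prod>b\<in>Basis. g b (x \<bullet> b))) = (\<Prod>b\<in>Basis. (LINT t|lborel. g b t))"
proof -
  interpret product_sigma_finite "\<lambda>_::'a. lborel :: real measure" ..
  let ?T = "\<lambda>f. \<Sum>b\<in>Basis. f b *\<^sub>R (b::'a)"
  have T: "?T \<in> measurable (\<Pi>\<^sub>M b\<in>Basis. lborel) borel" by measurable
  have m [measurable]: "g b \<in> borel_measurable borel" if "b \<in> Basis" for b
    using borel_measurable_integrable[OF g[OF that]] by simp
  have M: "(\<lambda>x. \<Prod>b\<in>Basis. g b (x \<bullet> b)) \<in> borel_measurable borel" by measurable
  have e: "(\<Prod>b\<in>Basis. g b (?T f \<bullet> b)) = (\<Prod>b\<in>Basis. g b (f b))" for f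
    by (intro prod.cong refl) (simp add: inner_sum_left inner_Basis if_distrib cong: if_cong)
  show "integrable lborel (\<lambda>x. \<Prod>b\<in>Basis. g b (x \<bullet> b))"
    by (subst lborel_eq) (simp only: integrable_distr_eq[OF T M] e, intro product_integrable_prod g finite_Basis)
  show "(LINT x|lborel. (\<Prod>b\<in>Basis. g b (x \<bullet> b))) = (\<Prod>b\<in>Basis. (LINT t|lborel. g b t))"
    by (subst lborel_eq) (simp only: integral_distr[OF T M] e, intro product_integral_prod g finite_Basis)
qed

text \<open>An integrable function whose reciprocal grows only polynomially; the product form
  reduces its integrability to one variable.\<close>

definition majorant :: "'a::euclidean_space \<Rightarrow> real" where
  "majorant x = (\<Prod>b\<in>Basis. inverse (1 + (x \<bullet> b)\<^sup>2))"

lemma integrable_majorant: "integrable lborel majorant"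
proof -
  have "integrable lborel (\<lambda>t::real. inverse (1 + t\<^sup>2))"
    using integrable_inverse_1_plus_square by (simp add: set_integrable_def)
  from integrable_prod_Basis[OF this] show ?thesis by (simp add: majorant_def[abs_def])
qed

lemma majorant_pos: "0 < majorant x"
  unfolding majorant_def by (intro prod_pos) (simp add: add_pos_nonneg)

lemma inverse_majorant_le: "inverse (majorant x) \<le> 2 ^ DIM('a) * (1 + norm x ^ (2 * DIM('a)))"
  for x :: "'a::euclidean_space"
proof -
  have "inverse (majorant x) = (\<Prod>b\<in>Basis. 1 + (x \<bullet> b)\<^sup>2)"
    by (simp add: majorant_def prod_inversef[symmetric] o_def flip: prod_dividef)
  also have "\<dots> \<le> (\<Prod>b\<in>(Basis::'a set). 1 + (norm x)\<^sup>2)"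
  proof (intro prod_mono conjI)
    fix b :: 'a assume "b \<in> Basis"
    then have "\<bar>x \<bullet> b\<bar> \<le> \<bar>norm x\<bar>" using Basis_le_norm by auto
    then show "1 + (x \<bullet> b)\<^sup>2 \<le> 1 + (norm x)\<^sup>2" by (simp only: abs_le_square_iff add_le_cancel_left)
  qed (simp add: add_nonneg_nonneg)
  also have "\<dots> = (1 + (norm x)\<^sup>2) ^ DIM('a)" by simp
  also have "\<dots> \<le> 2 ^ DIM('a) * (1 + norm x ^ (2 * DIM('a)))"
    using one_plus_power_le[of "(norm x)\<^sup>2" "DIM('a)"] by (simp add: power_mult)
  finally show ?thesis .
qed

definition schwartz_sup :: "(real^'n::finite \<Rightarrow> complex) \<Rightarrow> real" where
  "schwartz_sup \<phi> = 2 ^ DIM(real^'n) * (schwartz_seminorm 0 [] \<phi> + schwartz_seminorm (2 * DIM(real^'n)) [] \<phi>)"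

lemma schwartz_dominated_sup: "schwartz_dominated schwartz_sup"
  unfolding schwartz_sup_def[abs_def]
  by (intro dominated_cmult schwartz_dominated_add schwartz_dominated_seminorm) auto

lemma schwartz_le_majorant:
  assumes "\<phi> \<in> schwartz_space"
  shows "norm (\<phi> x) \<le> schwartz_sup \<phi> * majorant x"
proof -
  let ?d = "DIM(real^'a)"
  have "inverse (majorant x) * norm (\<phi> x) \<le> (2 ^ ?d * (1 + norm x ^ (2 * ?d))) * norm (\<phi> x)"
    by (intro mult_right_mono inverse_majorant_le) auto
  also have "\<dots> = 2 ^ ?d * (norm x ^ 0 * norm (partial_derivs [] \<phi> x) + norm x ^ (2 * ?d) * norm (partial_derivs [] \<phi> x))"
    by (simp add: algebra_simps)
  also have "\<dots> \<le> schwartz_sup \<phi>"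
    unfolding schwartz_sup_def by (intro mult_left_mono add_mono schwartz_seminorm_upper assms) auto
  finally show ?thesis using majorant_pos[of x] by (simp add: field_simps)
qed

lemma schwartz_continuous: "\<phi> \<in> schwartz_space \<Longrightarrow> continuous_on A \<phi>"
  using smooth_on_continuous[OF schwartz_smooth] continuous_on_subset by blast

lemma schwartz_measurable: "\<phi> \<in> schwartz_space \<Longrightarrow> \<phi> \<in> borel_measurable borel"
  by (intro borel_measurable_continuous_onI schwartz_continuous)

lemma schwartz_integrable:
  assumes "\<phi> \<in> schwartz_space"
  shows "integrable lborel \<phi>"
proof (rule Bochner_Integration.integrable_bound)
  show "integrable lborel (\<lambda>x::real^'a. schwartz_sup \<phi> * majorant x)"
    by (simp add: integrable_majorant)
qed (use schwartz_le_majorant[OF assms] schwartz_measurable[OF assms] in \<open>auto intro: order_trans[OF _ abs_ge_self]\<close>)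

definition schwartz_L1 :: "(real^'n::finite \<Rightarrow> complex) \<Rightarrow> real" where
  "schwartz_L1 \<phi> = (LINT x|lborel. norm (\<phi> x))"

lemma schwartz_dominated_L1: "schwartz_dominated schwartz_L1"
proof (rule dominated_mono)
  show "schwartz_dominated (\<lambda>\<phi>::real^'a \<Rightarrow> complex. (LINT x|lborel. majorant (x::real^'a)) * schwartz_sup \<phi>)"
    by (intro dominated_cmult schwartz_dominated_sup Bochner_Integration.integral_nonneg)
       (simp add: less_imp_le majorant_pos)
  fix \<phi> :: "real^'a \<Rightarrow> complex" assume \<phi>: "\<phi> \<in> schwartz_space"
  have "schwartz_L1 \<phi> \<le> (LINT x|lborel. schwartz_sup \<phi> * majorant (x::real^'a))"
    unfolding schwartz_L1_def
    by (intro integral_mono) (use \<phi> schwartz_le_majorant schwartz_integrable integrable_majorant in auto)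
  then show "schwartz_L1 \<phi> \<le> (LINT x|lborel. majorant (x::real^'a)) * schwartz_sup \<phi>"
    by (simp add: mult.commute)
qed

text \<open>The reciprocal of \<open>majorant\<close> costs the power 2d and the multiplier the
  power N. Expanding (1 + |x|^(2d)) (1 + |x|^N) yields the four seminorms collected in
  \<open>B\<close>.\<close>

lemma schwartz_integrable_bounded_mult:
  assumes "\<phi> \<in> schwartz_space" "g \<in> borel_measurable borel" "\<And>x. norm (g x) \<le> C * (1 + norm x) ^ N"
  shows "integrable lborel (\<lambda>x. g x * \<phi> x)"
proof -
  let ?d = "DIM(real^'a)"
  have C: "0 \<le> C" using order_trans[OF norm_ge_zero assms(3)[of 0]] by simp
  define S where "S k = schwartz_seminorm k [] \<phi>" for k
  have S: "norm x ^ k * norm (\<phi> x) \<le> S k" for k x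
    using schwartz_seminorm_upper[OF assms(1), of x k "[]"] by (simp add: S_def)
  define B where "B = S 0 + S (2 * ?d) + S N + S (N + 2 * ?d)"
  have bd: "norm (g x * \<phi> x) \<le> (C * 2 ^ N * 2 ^ ?d * B) * majorant x" for x
  proof -
    let ?r = "norm x"
    have "(1 + ?r ^ (2 * ?d)) * ((1 + ?r ^ N) * norm (\<phi> x)) =
        ?r ^ 0 * norm (\<phi> x) + ?r ^ (2 * ?d) * norm (\<phi> x) + ?r ^ N * norm (\<phi> x) + ?r ^ (N + 2 * ?d) * norm (\<phi> x)"
      unfolding power_add distrib_left distrib_right power_0 by (simp only: mult_ac add_ac mult_1_left mult_1_right)
    also have "\<dots> \<le> B" unfolding B_def by (intro add_mono S)
    finally have B: "(1 + ?r ^ (2 * ?d)) * ((1 + ?r ^ N) * norm (\<phi> x)) \<le> B" .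
    have "norm (g x) \<le> C * (2 ^ N * (1 + ?r ^ N))"
      using order_trans[OF assms(3)[of x] mult_left_mono[OF one_plus_power_le C]] by simp
    then have "norm (g x * \<phi> x) \<le> C * (2 ^ N * (1 + ?r ^ N)) * norm (\<phi> x)"
      unfolding norm_mult by (rule mult_right_mono) simp
    then have "inverse (majorant x) * norm (g x * \<phi> x)
        \<le> (2 ^ ?d * (1 + ?r ^ (2 * ?d))) * (C * (2 ^ N * (1 + ?r ^ N)) * norm (\<phi> x))"
      by (rule mult_mono[OF inverse_majorant_le]) auto
    also have "\<dots> = C * 2 ^ N * 2 ^ ?d * ((1 + ?r ^ (2 * ?d)) * ((1 + ?r ^ N) * norm (\<phi> x)))"
      by (simp only: mult_ac)
    also have "\<dots> \<le> C * 2 ^ N * 2 ^ ?d * B"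
      by (rule mult_left_mono[OF B]) (simp add: C)
    finally have "majorant x * (inverse (majorant x) * norm (g x * \<phi> x)) \<le> majorant x * (C * 2 ^ N * 2 ^ ?d * B)"
      using majorant_pos[of x] by (intro mult_left_mono) auto
    moreover have "majorant x * (inverse (majorant x) * z) = z" for z using majorant_pos[of x] by simp
    ultimately show ?thesis by (simp only: mult.commute)
  qed
  show ?thesis
  proof (rule Bochner_Integration.integrable_bound)
    show "integrable lborel (\<lambda>x::real^'a. (C * 2 ^ N * 2 ^ ?d * B) * majorant x)"
      by (simp add: integrable_majorant)
    show "(\<lambda>x. g x * \<phi> x) \<in> borel_measurable lborel"
      using schwartz_measurable[OF assms(1)] assms(2) by simp
    show "AE x in lborel. norm (g x * \<phi> x) \<le> norm (C * 2 ^ N * 2 ^ ?d * B * majorant x)"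
      by (rule AE_I2) (rule order_trans[OF bd], simp)
  qed
qed

section \<open>Functions vanishing to infinite order at the origin and their multipliers\<close>

section \<open>Schwartz functions that are flat at the origin\<close>

text \<open>One explicit second-order remainder replaces a limit argument. The Fourier transform,
  the Levy integrals and flat functions at the origin are all differentiated in this way.\<close>

lemma has_derivative_quadratic:
  fixes f :: "'a::real_normed_vector \<Rightarrow> 'b::real_normed_vector"
  assumes "bounded_linear D" "0 < r"
    and "\<And>h. norm h < r \<Longrightarrow> norm (f (x + h) - f x - D h) \<le> K * (norm h)\<^sup>2"
  shows "(f has_derivative D) (at x)"
  unfolding has_derivative_at_alt
proof (intro conjI allI impI)
  fix e :: real assume e: "e > 0"
  show "\<exists>d>0. \<forall>y. norm (y - x) < d \<longrightarrow> norm (f y - f x - D (y - x)) \<le> e * norm (y - x)"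
  proof (intro exI[of _ "min r (e / (\<bar>K\<bar> + 1))"] conjI allI impI)
    fix y assume y: "norm (y - x) < min r (e / (\<bar>K\<bar> + 1))"
    have "norm (f y - f x - D (y - x)) \<le> K * norm (y - x) * norm (y - x)"
      using assms(3)[of "y - x"] y by (simp add: power2_eq_square)
    also have "\<dots> \<le> e * norm (y - x)"
    proof (rule mult_right_mono)
      have "K * norm (y - x) \<le> (\<bar>K\<bar> + 1) * norm (y - x)" by (rule mult_right_mono) auto
      also have "\<dots> \<le> e" using y by (simp add: field_simps)
      finally show "K * norm (y - x) \<le> e" .
    qed simp
    finally show "norm (f y - f x - D (y - x)) \<le> e * norm (y - x)" .
  qed (use e assms(2) in simp)
qed (rule assms)

text \<open>The Fourier image of \<open>Z_space\<close>, on which f(-Laplace) acts as multiplication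
  by the symbol.\<close>

definition flat_space :: "(real^'n::finite \<Rightarrow> complex) set" where
  "flat_space = {\<psi> \<in> schwartz_space. \<forall>is. partial_derivs is \<psi> 0 = 0}"

lemma flat_schwartz: "\<psi> \<in> flat_space \<Longrightarrow> \<psi> \<in> schwartz_space"
  by (simp add: flat_space_def)

text \<open>Controls growth at infinity and blow-up at the origin at once. With division by zero
  giving zero, its value at the origin is 1, so the lower bounds hold everywhere.\<close>

definition punctured_weight :: "'a::real_normed_vector \<Rightarrow> real" where
  "punctured_weight x = 1 + norm x + 1 / norm x"

lemma punctured_weight_ge: "1 + norm x \<le> punctured_weight x"
  and punctured_weight_ge_1: "1 \<le> punctured_weight x"
  by (auto simp: punctured_weight_def)

lemma punctured_weight_power_le:
  "punctured_weight x ^ N \<le> 3 ^ N * (1 + norm x ^ N + (1 / norm x) ^ N)"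
proof -
  have "punctured_weight x ^ N \<le> (3 * max 1 (max (norm x) (1 / norm x))) ^ N"
    by (rule power_mono) (auto simp: punctured_weight_def)
  also have "\<dots> \<le> 3 ^ N * (1 + norm x ^ N + (1 / norm x) ^ N)"
    unfolding power_mult_distrib by (rule mult_left_mono) (auto simp: max_def)
  finally show ?thesis .
qed

lemma norm_difference_le_partial_derivs:
  assumes "smooth_on UNIV \<phi>" "\<And>i y. norm y \<le> r \<Longrightarrow> norm (partial_deriv i \<phi> y) \<le> B i"
    and "norm x \<le> r" "norm y \<le> r"
  shows "norm (\<phi> x - \<phi> y) \<le> (\<Sum>i\<in>UNIV. B i) * norm (x - y)"
proof (rule differentiable_bound[where S="cball 0 r"])
  fix z :: "real^'a" assume z: "z \<in> cball 0 r"
  show "(\<phi> has_derivative (\<lambda>v. \<Sum>i\<in>UNIV. (v $ i) *\<^sub>R partial_deriv i \<phi> z)) (at z within cball 0 r)"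
    by (rule has_derivative_at_withinI[OF smooth_on_has_derivative[OF assms(1)]]) simp
  show "onorm (\<lambda>v. \<Sum>i\<in>UNIV. (v $ i) *\<^sub>R partial_deriv i \<phi> z) \<le> (\<Sum>i\<in>UNIV. B i)"
  proof (rule onorm_le)
    fix v :: "real^'a"
    have "norm (\<Sum>i\<in>UNIV. (v $ i) *\<^sub>R partial_deriv i \<phi> z) \<le> (\<Sum>i\<in>UNIV. norm v * B i)"
    proof (rule sum_norm_le)
      fix i
      show "norm ((v $ i) *\<^sub>R partial_deriv i \<phi> z) \<le> norm v * B i"
        unfolding norm_scaleR using z by (intro mult_mono component_le_norm_cart assms(2)) auto
    qed
    then show "norm (\<Sum>i\<in>UNIV. (v $ i) *\<^sub>R partial_deriv i \<phi> z) \<le> (\<Sum>i\<in>UNIV. B i) * norm v"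
      by (simp add: sum_distrib_left mult.commute)
  qed
qed (use assms in auto)

text \<open>Every derivative vanishes at the origin. By the mean value inequality on the ball of
  radius |x|, a bound of order m for all derivatives one step higher improves to order m +
  1.\<close>

lemma flat_decay:
  assumes "\<psi> \<in> flat_space"
  shows "\<exists>C\<ge>0. \<forall>x. norm (partial_derivs is \<psi> x) \<le> C * norm x ^ m"
proof (induction m arbitrary: "is")
  case 0
  have "norm (partial_derivs is \<psi> x) \<le> \<bar>schwartz_seminorm 0 is \<psi>\<bar>" for x
    using schwartz_seminorm_upper[OF flat_schwartz[OF assms], of x 0 "is"] by simp
  then show ?case by (intro exI[of _ "\<bar>schwartz_seminorm 0 is \<psi>\<bar>"]) simp
next
  case (Suc m)
  have "\<forall>i. \<exists>C\<ge>0. \<forall>x. norm (partial_derivs (i # is) \<psi> x) \<le> C * norm x ^ m" using Suc by blast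
  then obtain C where C: "\<And>i. 0 \<le> C i" "\<And>i x. norm (partial_deriv i (partial_derivs is \<psi>) x) \<le> C i * norm x ^ m"
    unfolding partial_derivs_Cons by metis
  have "norm (partial_derivs is \<psi> x) \<le> (\<Sum>i\<in>UNIV. C i) * norm x ^ Suc m" for x
  proof -
    have "norm (partial_derivs is \<psi> x - partial_derivs is \<psi> 0) \<le> (\<Sum>i\<in>UNIV. C i * norm x ^ m) * norm (x - 0)"
    proof (rule norm_difference_le_partial_derivs[where r="norm x"])
      show "smooth_on UNIV (partial_derivs is \<psi>)"
        by (rule smooth_on_partial_derivs[OF schwartz_smooth[OF flat_schwartz[OF assms]]])
      fix i and y :: "real^'a" assume "norm y \<le> norm x"
      then show "norm (partial_deriv i (partial_derivs is \<psi>) y) \<le> C i * norm x ^ m"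
        using C by (intro order_trans[OF C(2)] mult_left_mono power_mono) auto
    qed auto
    then show ?thesis using assms by (simp add: flat_space_def sum_distrib_right mult_ac)
  qed
  then show ?case using C(1) by (intro exI[of _ "\<Sum>i\<in>UNIV. C i"]) (auto intro: sum_nonneg)
qed

lemma flat_weighted_bound:
  assumes "\<psi> \<in> flat_space"
  shows "\<exists>C. \<forall>x\<in>- {0}. punctured_weight x ^ N * norm (partial_derivs is \<psi> x) \<le> C"
proof -
  obtain C where C: "C \<ge> 0" "\<And>x. norm (partial_derivs is \<psi> x) \<le> C * norm x ^ N"
    using flat_decay[OF assms] by blast
  have "punctured_weight x ^ N * norm (partial_derivs is \<psi> x)
      \<le> 3 ^ N * (schwartz_seminorm 0 is \<psi> + schwartz_seminorm N is \<psi> + C)" if x: "x \<noteq> 0" for x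
  proof -
    have "punctured_weight x ^ N * norm (partial_derivs is \<psi> x)
       \<le> (3 ^ N * (1 + norm x ^ N + (1 / norm x) ^ N)) * norm (partial_derivs is \<psi> x)"
      by (rule mult_right_mono[OF punctured_weight_power_le]) simp
    also have "\<dots> = 3 ^ N * (norm x ^ 0 * norm (partial_derivs is \<psi> x) +
        norm x ^ N * norm (partial_derivs is \<psi> x) + (1 / norm x) ^ N * norm (partial_derivs is \<psi> x))"
      by (simp only: power_0 distrib_right mult.assoc)
    also have "\<dots> \<le> 3 ^ N * (schwartz_seminorm 0 is \<psi> + schwartz_seminorm N is \<psi> + C)"
    proof (intro mult_left_mono add_mono schwartz_seminorm_upper flat_schwartz assms)
      have "(1 / norm x) ^ N * norm (partial_derivs is \<psi> x) \<le> (1 / norm x) ^ N * (C * norm x ^ N)"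
        by (rule mult_left_mono[OF C(2)]) simp
      then show "(1 / norm x) ^ N * norm (partial_derivs is \<psi> x) \<le> C"
        using x by (simp add: power_divide)
    qed simp
    finally show ?thesis .
  qed
  then show ?thesis by (intro exI) auto
qed

text \<open>The weighted bound with N = 2 makes every iterated derivative off the origin O(|x|^2).
  If its value at the origin is 0, it is differentiable there with derivative 0, so inductively all
  derivatives exist and vanish at the origin; the other powers of the weight give the decay at
  infinity.\<close>

lemma flat_spaceI:
  fixes G :: "real^'n::finite \<Rightarrow> complex"
  assumes sm: "smooth_on (- {0}) G" and "G 0 = 0"
    and bd: "\<And>N is. \<exists>C. \<forall>x\<in>- {0}. punctured_weight x ^ N * norm (partial_derivs is G x) \<le> C"
  shows "G \<in> flat_space"
proof -
  have der: "(partial_derivs is G has_derivative (\<lambda>v. 0)) (at 0)" if "partial_derivs is G 0 = 0" for "is"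
  proof -
    obtain C where C: "\<And>x. x \<noteq> 0 \<Longrightarrow> (punctured_weight x)\<^sup>2 * norm (partial_derivs is G x) \<le> C"
      using bd[of 2 "is"] by auto
    have "norm (partial_derivs is G x) \<le> C * (norm x)\<^sup>2" if x: "x \<noteq> 0" for x
    proof -
      have "1 / norm x \<le> punctured_weight x" by (simp add: punctured_weight_def)
      then have "(1 / norm x)\<^sup>2 * norm (partial_derivs is G x) \<le> (punctured_weight x)\<^sup>2 * norm (partial_derivs is G x)"
        by (intro mult_right_mono power_mono) auto
      then have "(1 / norm x)\<^sup>2 * norm (partial_derivs is G x) \<le> C" using C[OF x] by linarith
      then show ?thesis using x by (simp add: power_divide field_simps)
    qed
    then have "norm (partial_derivs is G (0 + h) - partial_derivs is G 0 - 0) \<le> C * (norm h)\<^sup>2" for h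
      using that by (cases "h = 0") auto
    then show ?thesis by (rule has_derivative_quadratic[OF bounded_linear_zero zero_less_one])
  qed
  have zero: "partial_derivs is G 0 = 0" for "is"
  proof (induction "is")
    case (Cons i "is")
    show ?case unfolding partial_derivs_Cons by (rule partial_deriv_eqI[OF der[OF Cons]])
  qed (simp add: \<open>G 0 = 0\<close>)
  have "partial_derivs is G differentiable (at x)" for "is" x
    using der[OF zero] smooth_on_differentiable[OF smooth_on_partial_derivs[OF sm], of x "is"]
    by (cases "x = 0") (auto simp: differentiable_def)
  then have "smooth_on UNIV G" by (simp add: smooth_on_def)
  moreover have "\<exists>C. \<forall>x. norm x ^ k * norm (partial_derivs is G x) \<le> C" for k "is"
  proof -
    obtain C where C: "\<And>x. x \<noteq> 0 \<Longrightarrow> punctured_weight x ^ k * norm (partial_derivs is G x) \<le> C"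
      using bd[of k "is"] by auto
    have "norm x ^ k * norm (partial_derivs is G x) \<le> \<bar>C\<bar>" for x
    proof (cases "x = 0")
      case False
      have "norm x ^ k \<le> punctured_weight x ^ k"
        using punctured_weight_ge[of x] by (intro power_mono) auto
      then have "norm x ^ k * norm (partial_derivs is G x) \<le> punctured_weight x ^ k * norm (partial_derivs is G x)"
        by (rule mult_right_mono) simp
      then show ?thesis using C[OF False] by linarith
    qed (simp add: zero)
    then show ?thesis by blast
  qed
  ultimately show ?thesis using zero by (simp add: flat_space_def schwartz_spaceI)
qed

lemma flat_mult_bound:
  assumes g: "\<And>n. slowly_increasing n W punctured_weight g" and W: "W \<subseteq> - {0}" and \<psi>: "\<psi> \<in> flat_space"
  shows "\<exists>C. \<forall>x\<in>W. punctured_weight x ^ N * norm (partial_derivs is (\<lambda>x. g x * \<psi> x) x) \<le> C"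
proof -
  have sg: "smooth_on W g" using g slowly_increasing_smooth by blast
  have s\<psi>: "smooth_on W \<psi>"
    by (rule smooth_on_subset[OF schwartz_smooth[OF flat_schwartz[OF \<psi>]] smooth_onD_open[OF sg]]) simp
  let ?F = "\<lambda>p x. punctured_weight x ^ N * (norm (partial_derivs (fst p) g x) * norm (partial_derivs (snd p) \<psi> x))"
  have "\<exists>C. \<forall>x\<in>W. ?F p x \<le> C" for p
  proof -
    obtain C M where C: "C \<ge> 0" "\<And>x. x \<in> W \<Longrightarrow> norm (partial_derivs (fst p) g x) \<le> C * punctured_weight x ^ M"
      using g[of "length (fst p)"] unfolding slowly_increasing_def polybounded_def
      by (metis order_refl)
    obtain D where D: "\<And>x. x \<noteq> 0 \<Longrightarrow> punctured_weight x ^ (N + M) * norm (partial_derivs (snd p) \<psi> x) \<le> D"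
      using flat_weighted_bound[OF \<psi>, of "N + M" "snd p"] by auto
    have "?F p x \<le> C * D" if x: "x \<in> W" for x
    proof -
      have "?F p x \<le> punctured_weight x ^ N * ((C * punctured_weight x ^ M) * norm (partial_derivs (snd p) \<psi> x))"
        using punctured_weight_ge_1[of x]
        by (intro mult_left_mono mult_right_mono C(2) x) auto
      also have "\<dots> = C * (punctured_weight x ^ (N + M) * norm (partial_derivs (snd p) \<psi> x))"
        by (simp add: power_add mult_ac)
      also have "\<dots> \<le> C * D" by (rule mult_left_mono[OF D C(1)]) (use x W in auto)
      finally show ?thesis .
    qed
    then show ?thesis by auto
  qed
  then obtain C where C: "\<And>p x. x \<in> W \<Longrightarrow> ?F p x \<le> C p" by metis
  have "punctured_weight x ^ N * norm (partial_derivs is (\<lambda>x. g x * \<psi> x) x) \<le> (\<Sum>p\<leftarrow>leibniz_splits is. C p)"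
    if x: "x \<in> W" for x
  proof -
    have "punctured_weight x ^ N * norm (partial_derivs is (\<lambda>x. g x * \<psi> x) x) \<le> (\<Sum>p\<leftarrow>leibniz_splits is. ?F p x)"
      unfolding sum_list_const_mult
      using punctured_weight_ge_1[of x] x
      by (intro mult_left_mono norm_partial_derivs_mult_le[OF sg s\<psi>]) auto
    also have "\<dots> \<le> (\<Sum>p\<leftarrow>leibniz_splits is. C p)" by (rule sum_list_mono[OF C[OF x]])
    finally show ?thesis .
  qed
  then show ?thesis by blast
qed

text \<open>The multiplier may be singular at the origin like a power of 1/|x|, as the symbol and
  its derivatives can be; flat functions absorb any such power. This is why f(-Laplace) maps
  \<open>Z_space\<close> to itself.\<close>

lemma flat_mult:
  assumes g: "\<And>n. slowly_increasing n (- {0}) punctured_weight g" and \<psi>: "\<psi> \<in> flat_space"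
  shows "(\<lambda>x. g x * \<psi> x) \<in> flat_space"
proof (rule flat_spaceI[OF _ _ flat_mult_bound[OF g subset_refl \<psi>]])
  have "smooth_on (- {0}) g" using g slowly_increasing_smooth by blast
  moreover have "smooth_on (- {0}) \<psi>"
    by (rule smooth_on_subset[OF schwartz_smooth[OF flat_schwartz[OF \<psi>]]]) auto
  ultimately show "smooth_on (- {0}) (\<lambda>x. g x * \<psi> x)" by (rule smooth_on_mult)
  have "partial_derivs [] \<psi> 0 = 0" using \<psi> unfolding flat_space_def by blast
  then show "g 0 * \<psi> 0 = 0" by simp
qed

section \<open>The Fourier transform as a continuous operator that exchanges derivatives and
  monomials\<close>

section \<open>The Fourier transform on the Schwartz space\<close>

lemma plane_wave_norm [simp]: "norm (plane_wave x y) = 1"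
  unfolding plane_wave_def by simp

lemma plane_wave_sym: "plane_wave x y = plane_wave y x"
  by (simp add: plane_wave_def inner_commute)

lemma plane_wave_add: "plane_wave x (y + z) = plane_wave x y * plane_wave x z"
  by (simp add: plane_wave_def inner_add_right distrib_left flip: exp_add)

lemma continuous_on_plane_wave:
  "continuous_on A f \<Longrightarrow> continuous_on A g \<Longrightarrow> continuous_on A (\<lambda>x. plane_wave (f x) (g x))"
  unfolding plane_wave_def by (intro continuous_intros)

lemma plane_wave_measurable [measurable]:
  assumes "f \<in> borel_measurable M" "g \<in> borel_measurable M"
  shows "(\<lambda>x. plane_wave (f x) (g x)) \<in> borel_measurable M"
  unfolding plane_wave_def using assms by measurable

lemma fourier_eq: "fourier \<phi> \<xi> = (LINT x|lborel. plane_wave x \<xi> * \<phi> x)"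
  by (simp add: fourier_def plane_wave_def mult.commute)

lemma schwartz_integrable_plane_wave:
  assumes "\<phi> \<in> schwartz_space"
  shows "integrable lborel (\<lambda>x. plane_wave x \<xi> * \<phi> x)"
  by (rule schwartz_integrable_bounded_mult[OF assms, where C=1 and N=0]) (auto intro: plane_wave_measurable)

lemma norm_fourier_le:
  assumes "\<phi> \<in> schwartz_space"
  shows "norm (fourier \<phi> \<xi>) \<le> schwartz_L1 \<phi>"
proof -
  have "norm (fourier \<phi> \<xi>) \<le> (LINT x|lborel. norm (plane_wave x \<xi> * \<phi> x))"
    unfolding fourier_eq by (rule integral_norm_bound)
  then show ?thesis by (simp add: schwartz_L1_def norm_mult)
qed

text \<open>The factor that the derivatives \<open>is\<close> in the variable \<open>y\<close> bring
  down from \<open>plane_wave x y\<close>.\<close>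

definition frequency_monomial :: "'n::finite list \<Rightarrow> real^'n \<Rightarrow> complex" where
  "frequency_monomial is x = (\<Prod>j\<leftarrow>is. - (\<i> * complex_of_real (x $ j)))"

lemma frequency_monomial_simps [simp]:
  "frequency_monomial [] x = 1"
  "frequency_monomial (j # is) x = - (\<i> * complex_of_real (x $ j)) * frequency_monomial is x"
  by (simp_all add: frequency_monomial_def)

lemma slowly_increasing_frequency_monomial:
  "slowly_increasing n UNIV (\<lambda>x. 1 + norm x) (frequency_monomial is)"
proof (induction "is")
  case Nil
  have "frequency_monomial [] = (\<lambda>x::real^'a. 1)" by auto
  then show ?case by (simp add: slowly_increasing_const)
next
  case (Cons j "is")
  have "slowly_increasing n UNIV (\<lambda>x. 1 + norm x)
      (\<lambda>x. ((- \<i>) * complex_of_real (x $ j)) * frequency_monomial is x)"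
    by (rule slowly_increasing_mult[OF _ slowly_increasing_cmult[OF _ slowly_increasing_coord] Cons]) auto
  then show ?case by (rule slowly_increasing_cong) simp
qed

lemma schwartz_operator_frequency_monomial:
  "schwartz_operator (\<lambda>\<phi> x. frequency_monomial is x * \<phi> x)"
  by (rule schwartz_operator_mult[OF slowly_increasing_frequency_monomial])

lemma schwartz_frequency_monomial:
  "\<phi> \<in> schwartz_space \<Longrightarrow> (\<lambda>x. frequency_monomial is x * \<phi> x) \<in> schwartz_space"
  by (rule schwartz_operator_mem[OF schwartz_operator_frequency_monomial])

lemma norm_plane_wave_approx:
  "norm (plane_wave x h - 1 + \<i> * complex_of_real (x \<bullet> h)) \<le> (norm x)\<^sup>2 * (norm h)\<^sup>2"
proof -
  have eq: "iexp (- (x \<bullet> h)) - (\<Sum>k\<le>1. (\<i> * complex_of_real (- (x \<bullet> h)))^k / fact k)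
      = plane_wave x h - 1 + \<i> * complex_of_real (x \<bullet> h)"
    by (simp add: plane_wave_def algebra_simps)
  have "norm (plane_wave x h - 1 + \<i> * complex_of_real (x \<bullet> h)) \<le> (x \<bullet> h)\<^sup>2 / 2"
    using iexp_approx1[of "- (x \<bullet> h)" 1, unfolded eq] by (simp add: power2_eq_square fact_numeral abs_mult)
  also have "\<dots> \<le> (x \<bullet> h)\<^sup>2" by simp
  also have "\<dots> \<le> (norm x * norm h)\<^sup>2"
    using Cauchy_Schwarz_ineq2[of x h] by (metis abs_ge_zero power2_abs power_mono)
  finally show ?thesis by (simp add: power_mult_distrib)
qed

text \<open>The second-order remainder of the plane wave is at most |x|^2 |h|^2, and |x|^2
  |\<phi>(x)| is integrable; integration gives the quadratic estimate of
  \<open>has_derivative_quadratic\<close>.\<close>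

lemma fourier_has_derivative:
  fixes \<phi> :: "real^'n::finite \<Rightarrow> complex"
  assumes \<phi>: "\<phi> \<in> schwartz_space"
  shows "(fourier \<phi> has_derivative
     (\<lambda>h. \<Sum>j\<in>UNIV. (h $ j) *\<^sub>R fourier (\<lambda>x. frequency_monomial [j] x * \<phi> x) \<xi>)) (at \<xi>)"
proof (rule has_derivative_quadratic[OF _ zero_less_one])
  let ?D = "\<lambda>h. \<Sum>j\<in>UNIV. (h $ j) *\<^sub>R fourier (\<lambda>x. frequency_monomial [j] x * \<phi> x) \<xi>"
  show "bounded_linear ?D"
    by (intro bounded_linear_sum bounded_linear_compose[OF bounded_linear_scaleR_left bounded_linear_vec_nth])
  fix h :: "real^'n"
  define F where "F j x = plane_wave x \<xi> * (frequency_monomial [j] x * \<phi> x)" for j x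
  define A where "A x = plane_wave x (\<xi> + h) * \<phi> x - plane_wave x \<xi> * \<phi> x - (\<Sum>j\<in>UNIV. (h $ j) *\<^sub>R F j x)" for x
  have i1: "integrable lborel (\<lambda>x. plane_wave x \<eta> * \<phi> x)" for \<eta>
    by (rule schwartz_integrable_plane_wave[OF \<phi>])
  have i2: "integrable lborel (F j)" for j
    unfolding F_def by (rule schwartz_integrable_plane_wave[OF schwartz_frequency_monomial[OF \<phi>]])
  have i3: "integrable lborel (\<lambda>x. \<Sum>j\<in>UNIV. (h $ j) *\<^sub>R F j x)"
    by (intro Bochner_Integration.integrable_sum integrable_scaleR_right i2)
  have iA: "integrable lborel A"
    unfolding A_def by (intro Bochner_Integration.integrable_diff i1 i3)
  have iN: "integrable lborel (\<lambda>x. (norm h)\<^sup>2 * ((norm x)\<^sup>2 * norm (\<phi> x)))"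
  proof -
    have "integrable lborel (\<lambda>x. complex_of_real ((norm x)\<^sup>2) * \<phi> x)"
      by (rule schwartz_integrable_bounded_mult[OF \<phi>, where C=1 and N=2])
        (auto simp: norm_power intro!: power_mono)
    from integrable_norm[OF this] show ?thesis by (simp add: norm_mult norm_power)
  qed
  have "?D h = (LINT x|lborel. (\<Sum>j\<in>UNIV. (h $ j) *\<^sub>R F j x))"
    unfolding fourier_eq F_def[symmetric]
    by (subst Bochner_Integration.integral_sum) (simp_all add: i2)
  then have "fourier \<phi> (\<xi> + h) - fourier \<phi> \<xi> - ?D h = (LINT x|lborel. A x)"
    unfolding A_def fourier_eq[of \<phi>]
      Bochner_Integration.integral_diff[OF Bochner_Integration.integrable_diff[OF i1 i1] i3]
      Bochner_Integration.integral_diff[OF i1 i1] by simp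
  also have "norm (LINT x|lborel. A x) \<le> (LINT x|lborel. (norm h)\<^sup>2 * ((norm x)\<^sup>2 * norm (\<phi> x)))"
  proof (rule order_trans[OF integral_norm_bound integral_mono[OF integrable_norm[OF iA] iN]])
    fix x :: "real^'n"
    have "(\<Sum>j\<in>UNIV. (h $ j) *\<^sub>R F j x) = - (\<i> * complex_of_real (x \<bullet> h)) * (plane_wave x \<xi> * \<phi> x)"
      by (simp add: F_def inner_vec_def scaleR_conv_of_real sum_distrib_left sum_distrib_right
          sum_negf[symmetric] mult_ac)
    then have "A x = (plane_wave x h - 1 + \<i> * complex_of_real (x \<bullet> h)) * (plane_wave x \<xi> * \<phi> x)"
      by (simp add: A_def plane_wave_add algebra_simps)
    then show "norm (A x) \<le> (norm h)\<^sup>2 * ((norm x)\<^sup>2 * norm (\<phi> x))"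
      using mult_right_mono[OF norm_plane_wave_approx[of x h], of "norm (\<phi> x)"]
      by (simp add: norm_mult mult_ac)
  qed
  also have "\<dots> = (LINT x|lborel. (norm x)\<^sup>2 * norm (\<phi> x)) * (norm h)\<^sup>2" by simp
  finally show "norm (fourier \<phi> (\<xi> + h) - fourier \<phi> \<xi> - ?D h)
      \<le> (LINT x|lborel. (norm x)\<^sup>2 * norm (\<phi> x)) * (norm h)\<^sup>2" .
qed

lemma partial_deriv_fourier:
  assumes "\<phi> \<in> schwartz_space"
  shows "partial_deriv j (fourier \<phi>) = fourier (\<lambda>x. frequency_monomial [j] x * \<phi> x)"
proof
  fix \<xi>
  show "partial_deriv j (fourier \<phi>) \<xi> = fourier (\<lambda>x. frequency_monomial [j] x * \<phi> x) \<xi>"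
    unfolding partial_deriv_eqI[OF fourier_has_derivative[OF assms]]
    by (simp add: axis_def if_distrib[of "\<lambda>c. c *\<^sub>R _"] del: frequency_monomial_simps cong: if_cong)
qed

lemma partial_derivs_fourier:
  assumes "\<phi> \<in> schwartz_space"
  shows "partial_derivs is (fourier \<phi>) = fourier (\<lambda>x. frequency_monomial is x * \<phi> x)"
proof (induction "is")
  case (Cons j "is")
  show ?case unfolding partial_derivs_Cons Cons partial_deriv_fourier[OF schwartz_frequency_monomial[OF assms]]
    by (simp add: mult.assoc)
qed simp

lemma smooth_on_fourier:
  assumes "\<phi> \<in> schwartz_space"
  shows "smooth_on UNIV (fourier \<phi>)"
proof -
  have "partial_derivs is (fourier \<phi>) differentiable (at x)" for "is" x
    unfolding partial_derivs_fourier[OF assms]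
    using fourier_has_derivative[OF schwartz_frequency_monomial[OF assms]] differentiableI by blast
  then show ?thesis by (simp add: smooth_on_def)
qed

lemma integral_affine:
  fixes f :: "'a::euclidean_space \<Rightarrow> 'b::{banach, second_countable_topology}"
  assumes "c \<noteq> 0" and [measurable]: "f \<in> borel_measurable borel"
  shows "(LINT x|lborel. f x) = \<bar>c\<bar> ^ DIM('a) *\<^sub>R (LINT x|lborel. f (t + c *\<^sub>R x))"
proof -
  have "(LINT x|lborel. f x) = (LINT x|density (distr lborel borel (\<lambda>x. t + c *\<^sub>R x)) (\<lambda>_. \<bar>c\<bar>^DIM('a)). f x)"
    using lborel_affine[OF assms(1), of t] by simp
  also have "\<dots> = (LINT x|distr lborel borel (\<lambda>x. t + c *\<^sub>R x). \<bar>c\<bar>^DIM('a) *\<^sub>R f x)"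
    by (subst integral_density) auto
  also have "\<dots> = \<bar>c\<bar> ^ DIM('a) *\<^sub>R (LINT x|lborel. f (t + c *\<^sub>R x))"
    by (subst integral_distr) auto
  finally show ?thesis .
qed

text \<open>A bounded shift along a coordinate changes \<open>majorant\<close> only by a factor;
  this lets one integrable function dominate all difference quotients of a Schwartz
  function.\<close>

lemma majorant_shift_le:
  assumes "j \<in> Basis" "\<bar>s\<bar> \<le> 1"
  shows "majorant (x + s *\<^sub>R j) \<le> 3 * majorant x"
proof -
  have *: "inverse (1 + (a + s)\<^sup>2) \<le> 3 * inverse (1 + a\<^sup>2)" for a
  proof -
    have "s\<^sup>2 \<le> 1" using assms(2) by (simp add: abs_square_le_1)
    \<comment> \<open>Completing the square: 3 (1 + (a + s)^2) - (1 + a^2) = 2 - 3 s^2 / 2 + (2 a +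
      3 s)^2 / 2, which is positive when s^2 is at most 1.\<close>
    moreover have "0 \<le> (2 * a + 3 * s)\<^sup>2" by simp
    ultimately have "1 + a\<^sup>2 \<le> 3 * (1 + (a + s)\<^sup>2)" by (simp add: power2_eq_square algebra_simps)
    moreover have "0 < 1 + a\<^sup>2" "0 < 1 + (a + s)\<^sup>2" by (auto simp: add_pos_nonneg)
    ultimately show ?thesis by (simp add: field_simps)
  qed
  have "majorant (x + s *\<^sub>R j) = inverse (1 + (x \<bullet> j + s)\<^sup>2) * (\<Prod>b\<in>Basis - {j}. inverse (1 + (x \<bullet> b)\<^sup>2))"
    unfolding majorant_def prod.remove[OF finite_Basis assms(1)]
    using assms(1) by (auto simp: inner_add_left inner_Basis intro!: prod.cong split: if_splits)
  also have "\<dots> \<le> (3 * inverse (1 + (x \<bullet> j)\<^sup>2)) * (\<Prod>b\<in>Basis - {j}. inverse (1 + (x \<bullet> b)\<^sup>2))"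
    by (intro mult_right_mono * prod_nonneg) (simp add: add_nonneg_nonneg)
  also have "\<dots> = 3 * majorant x"
    unfolding majorant_def prod.remove[OF finite_Basis assms(1)] by simp
  finally show ?thesis .
qed

text \<open>Difference quotients have integral zero by translation invariance. They converge to the
  partial derivative and are dominated by a multiple of \<open>majorant\<close> through the mean
  value inequality. This is integration by parts without boundary terms.\<close>

lemma integral_partial_deriv_schwartz:
  fixes \<psi> :: "real^'n::finite \<Rightarrow> complex"
  assumes \<psi>: "\<psi> \<in> schwartz_space"
  shows "(LINT x|lborel. partial_deriv j \<psi> x) = 0"
proof -
  note sm = schwartz_smooth[OF \<psi>]
  let ?e = "axis j 1 :: real^'n"
  have e: "?e \<in> Basis" by (simp add: axis_in_Basis_iff)
  define t where "t n = 1 / (real n + 1)" for n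
  have t: "0 < t n" "t n \<le> 1" for n by (auto simp: t_def)
  have t0: "t \<longlonglongrightarrow> 0" unfolding t_def by real_asymp
  define Q where "Q n x = inverse (t n) *\<^sub>R (\<psi> (x + t n *\<^sub>R ?e) - \<psi> x)" for n x
  have dline: "((\<lambda>s. \<psi> (x + s *\<^sub>R ?e)) has_vector_derivative partial_deriv j \<psi> (x + s *\<^sub>R ?e)) (at s)" for x s
  proof -
    have "((\<lambda>s. \<psi> (x + s *\<^sub>R ?e)) has_derivative
       (\<lambda>h. \<Sum>i\<in>UNIV. ((h *\<^sub>R ?e) $ i) *\<^sub>R partial_deriv i \<psi> (x + s *\<^sub>R ?e))) (at s)"
      by (rule has_derivative_compose[OF _ smooth_on_has_derivative[OF sm]])
         (auto intro!: derivative_eq_intros)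
    moreover have "(\<Sum>i\<in>UNIV. ((h *\<^sub>R ?e) $ i) *\<^sub>R partial_deriv i \<psi> (x + s *\<^sub>R ?e)) = h *\<^sub>R partial_deriv j \<psi> (x + s *\<^sub>R ?e)" for h
      by (simp add: axis_def if_distrib[of "\<lambda>c. (h * c) *\<^sub>R _"] cong: if_cong)
    ultimately show ?thesis by (simp add: has_vector_derivative_def)
  qed
  have int_shift: "integrable lborel (\<lambda>x. \<psi> (x + a)) \<and> (LINT x|lborel. \<psi> (x + a)) = (LINT x|lborel. \<psi> x)" for a
  proof -
    have m: "(\<lambda>x. x + a) \<in> borel_measurable borel" by measurable
    have d: "distr lborel borel (\<lambda>x. x + a) = lborel"
      using lborel_distr_plus[of a] by (simp add: add.commute[of a] cong: distr_cong)
    have "integrable (distr lborel borel (\<lambda>x. x + a)) \<psi>" unfolding d by (rule schwartz_integrable[OF \<psi>])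
    then show ?thesis
      using integrable_distr_eq[of "\<lambda>x. x + a" lborel borel \<psi>] integral_distr[of "\<lambda>x. x + a" lborel borel \<psi>]
        schwartz_measurable[OF \<psi>] m unfolding d by simp
  qed
  have intQ: "(LINT x|lborel. Q n x) = 0" for n
    unfolding Q_def using int_shift[of "t n *\<^sub>R ?e"] schwartz_integrable[OF \<psi>]
    by (simp add: Bochner_Integration.integral_diff)
  have lim: "(\<lambda>n. Q n x) \<longlonglongrightarrow> partial_deriv j \<psi> x" for x
  proof -
    have "((\<lambda>h. inverse h *\<^sub>R (\<psi> (x + h *\<^sub>R ?e) - \<psi> x)) \<longlongrightarrow> partial_deriv j \<psi> x) (at 0)"
    proof -
      have "((\<lambda>h. norm (\<psi> (x + h *\<^sub>R ?e) - \<psi> x - h *\<^sub>R partial_deriv j \<psi> x) / norm h) \<longlongrightarrow> 0) (at 0)"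
        using dline[of x 0] unfolding has_vector_derivative_def has_derivative_at by simp
      moreover have "\<forall>\<^sub>F h in at 0. norm (\<psi> (x + h *\<^sub>R ?e) - \<psi> x - h *\<^sub>R partial_deriv j \<psi> x) / norm h
          = norm (inverse h *\<^sub>R (\<psi> (x + h *\<^sub>R ?e) - \<psi> x) - partial_deriv j \<psi> x)"
        unfolding eventually_at_filter
      proof (intro always_eventually allI impI)
        fix h :: real assume "h \<noteq> 0"
        then have "inverse h *\<^sub>R (\<psi> (x + h *\<^sub>R ?e) - \<psi> x) - partial_deriv j \<psi> x
            = inverse h *\<^sub>R (\<psi> (x + h *\<^sub>R ?e) - \<psi> x - h *\<^sub>R partial_deriv j \<psi> x)"
          by (simp add: scaleR_diff_right)
        then show "norm (\<psi> (x + h *\<^sub>R ?e) - \<psi> x - h *\<^sub>R partial_deriv j \<psi> x) / norm h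
          = norm (inverse h *\<^sub>R (\<psi> (x + h *\<^sub>R ?e) - \<psi> x) - partial_deriv j \<psi> x)"
          by (simp add: divide_inverse mult.commute)
      qed
      ultimately have "((\<lambda>h. norm (inverse h *\<^sub>R (\<psi> (x + h *\<^sub>R ?e) - \<psi> x) - partial_deriv j \<psi> x)) \<longlongrightarrow> 0) (at 0)"
        by (rule Lim_transform_eventually)
      from LIM_zero_cancel[OF tendsto_norm_zero_cancel[OF this]] show ?thesis .
    qed
    then show ?thesis unfolding Q_def
      by (rule filterlim_compose) (use t t0 in \<open>auto simp: filterlim_at less_imp_neq[symmetric]\<close>)
  qed
  have bound: "norm (Q n x) \<le> 3 * schwartz_sup (partial_deriv j \<psi>) * majorant x" for n x
  proof -
    let ?B = "3 * schwartz_sup (partial_deriv j \<psi>) * majorant x"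
    have "norm (\<psi> (x + t n *\<^sub>R ?e) - \<psi> (x + 0 *\<^sub>R ?e)) \<le> ?B * norm (t n - 0)"
    proof (rule differentiable_bound[where S="{0..1}"])
      fix s :: real assume s: "s \<in> {0..1}"
      show "((\<lambda>s. \<psi> (x + s *\<^sub>R ?e)) has_derivative (\<lambda>h. h *\<^sub>R partial_deriv j \<psi> (x + s *\<^sub>R ?e))) (at s within {0..1})"
        using dline[of x s] unfolding has_vector_derivative_def by (rule has_derivative_at_withinI)
      have sup0: "0 \<le> schwartz_sup (partial_deriv j \<psi>)"
        using order_trans[OF norm_ge_zero schwartz_le_majorant[OF schwartz_partial_deriv[OF \<psi>], of j 0]]
          majorant_pos[of "0::real^'n"] by (simp add: zero_le_mult_iff)
      have "norm (partial_deriv j \<psi> (x + s *\<^sub>R ?e)) \<le> schwartz_sup (partial_deriv j \<psi>) * majorant (x + s *\<^sub>R ?e)"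
        by (rule schwartz_le_majorant[OF schwartz_partial_deriv[OF \<psi>]])
      also have "\<dots> \<le> schwartz_sup (partial_deriv j \<psi>) * (3 * majorant x)"
        by (rule mult_left_mono[OF majorant_shift_le[OF e] sup0]) (use s in auto)
      finally have "norm (partial_deriv j \<psi> (x + s *\<^sub>R ?e)) \<le> ?B" by simp
      then show "onorm (\<lambda>h. h *\<^sub>R partial_deriv j \<psi> (x + s *\<^sub>R ?e)) \<le> ?B"
        by (intro onorm_le) (simp add: mult.commute mult_left_mono)
    qed (use t[of n] in auto)
    then have "norm (\<psi> (x + t n *\<^sub>R ?e) - \<psi> x) \<le> ?B * t n" using t[of n] by simp
    moreover have "norm (Q n x) = norm (\<psi> (x + t n *\<^sub>R ?e) - \<psi> x) / t n"
      using t(1)[of n] unfolding Q_def norm_scaleR by (simp add: divide_inverse mult.commute)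
    ultimately show ?thesis using t(1)[of n] by (simp add: pos_divide_le_eq)
  qed
  have "(\<lambda>n. LINT x|lborel. Q n x) \<longlonglongrightarrow> (LINT x|lborel. partial_deriv j \<psi> x)"
  proof (rule integral_dominated_convergence)
    show "integrable lborel (\<lambda>x::real^'n. 3 * schwartz_sup (partial_deriv j \<psi>) * majorant x)"
      by (simp add: integrable_majorant)
    have "continuous_on UNIV (Q n)" for n unfolding Q_def
      by (intro continuous_intros continuous_on_compose2[OF schwartz_continuous[OF \<psi>, of UNIV]] schwartz_continuous[OF \<psi>]) auto
    then show "Q n \<in> borel_measurable lborel" for n by (simp add: borel_measurable_continuous_onI)
    show "partial_deriv j \<psi> \<in> borel_measurable lborel"
      using schwartz_measurable[OF schwartz_partial_deriv[OF \<psi>]] by simp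
  qed (use lim bound in auto)
  then show ?thesis unfolding intQ by (simp add: LIMSEQ_const_iff)
qed

lemma plane_wave_has_derivative:
  "(plane_wave x has_derivative (\<lambda>h. plane_wave x y * - (\<i> * complex_of_real (x \<bullet> h)))) (at y)"
proof -
  have "((\<lambda>y. - (\<i> * complex_of_real (x \<bullet> y))) has_derivative (\<lambda>h. - (\<i> * complex_of_real (x \<bullet> h)))) (at y)"
    by (auto intro!: derivative_eq_intros)
  from has_derivative_compose[OF this DERIV_exp[unfolded has_field_derivative_def]]
  show ?thesis by (simp add: plane_wave_def[abs_def])
qed

lemma partial_derivs_plane_wave:
  "partial_derivs is (plane_wave x) = (\<lambda>y. frequency_monomial is x * plane_wave x y)"
proof (induction "is")
  case (Cons j "is")
  have "partial_deriv j (\<lambda>y. frequency_monomial is x * plane_wave x y) y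
      = frequency_monomial (j # is) x * plane_wave x y" for y
  proof -
    have "((\<lambda>y. frequency_monomial is x * plane_wave x y) has_derivative
       (\<lambda>h. frequency_monomial is x * (plane_wave x y * - (\<i> * complex_of_real (x \<bullet> h))))) (at y)"
      by (rule has_derivative_mult_right[OF plane_wave_has_derivative])
    then show ?thesis by (simp add: partial_deriv_eqI inner_axis mult_ac)
  qed
  then show ?case unfolding partial_derivs_Cons Cons by blast
qed simp

lemma smooth_on_plane_wave: "smooth_on UNIV (plane_wave x)"
proof -
  have "((\<lambda>y. frequency_monomial is x * plane_wave x y) has_derivative
       (\<lambda>h. frequency_monomial is x * (plane_wave x y * - (\<i> * complex_of_real (x \<bullet> h))))) (at y)" for "is" y
    by (rule has_derivative_mult_right[OF plane_wave_has_derivative])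
  then show ?thesis unfolding smooth_on_def partial_derivs_plane_wave differentiable_def by blast
qed

lemma slowly_increasing_plane_wave: "slowly_increasing n UNIV w (plane_wave x)"
  unfolding slowly_increasing_def partial_derivs_plane_wave
  by (simp add: norm_mult polybounded_const smooth_on_plane_wave)

text \<open>\<open>integral_partial_deriv_schwartz\<close> is applied to the product of \<phi> with
  the plane wave, which is again a Schwartz function.\<close>

lemma fourier_partial_deriv:
  fixes \<phi> :: "real^'n::finite \<Rightarrow> complex"
  assumes \<phi>: "\<phi> \<in> schwartz_space"
  shows "fourier (partial_deriv j \<phi>) \<xi> = \<i> * complex_of_real (\<xi> $ j) * fourier \<phi> \<xi>"
proof -
  let ?\<psi> = "\<lambda>x. plane_wave \<xi> x * \<phi> x"
  have "schwartz_operator (\<lambda>\<phi> x. plane_wave \<xi> x * \<phi> x)"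
    by (rule schwartz_operator_mult[of "plane_wave \<xi>"]) (rule slowly_increasing_plane_wave)
  from schwartz_operator_mem[OF this \<phi>] have \<psi>: "?\<psi> \<in> schwartz_space" .
  have 1: "partial_deriv j ?\<psi> x = partial_deriv j (plane_wave \<xi>) x * \<phi> x + plane_wave \<xi> x * partial_deriv j \<phi> x" for x
    using partial_derivs_mult[OF smooth_on_plane_wave schwartz_smooth[OF \<phi>], of x "[j]" \<xi>]
    unfolding leibniz_splits.simps partial_derivs_Cons partial_derivs_Nil by simp
  have 2: "partial_deriv j (plane_wave \<xi>) x = - (\<i> * complex_of_real (\<xi> $ j)) * plane_wave \<xi> x" for x
    using fun_cong[OF partial_derivs_plane_wave[of "[j]" \<xi>], of x]
    unfolding partial_derivs_Cons partial_derivs_Nil frequency_monomial_simps by simp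
  have 3: "partial_deriv j ?\<psi> x = plane_wave x \<xi> * partial_deriv j \<phi> x
      - \<i> * complex_of_real (\<xi> $ j) * (plane_wave x \<xi> * \<phi> x)" for x
  proof -
    have "plane_wave x \<xi> = plane_wave \<xi> x" by (rule plane_wave_sym)
    then show ?thesis unfolding 1 2 by (simp add: algebra_simps)
  qed
  have "(LINT x|lborel. partial_deriv j ?\<psi> x) = 0"
    by (rule integral_partial_deriv_schwartz[OF \<psi>])
  then have "(LINT x|lborel. plane_wave x \<xi> * partial_deriv j \<phi> x
      - \<i> * complex_of_real (\<xi> $ j) * (plane_wave x \<xi> * \<phi> x)) = 0"
    unfolding 3 .
  moreover have "integrable lborel (\<lambda>x. \<i> * complex_of_real (\<xi> $ j) * (plane_wave x \<xi> * \<phi> x))"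
    by (rule integrable_mult_right[OF schwartz_integrable_plane_wave[OF \<phi>]])
  note diff = Bochner_Integration.integral_diff[OF
      schwartz_integrable_plane_wave[OF schwartz_partial_deriv[OF \<phi>]] this]
  ultimately show ?thesis unfolding diff integral_mult_right_zero fourier_eq by simp
qed

text \<open>One factor |\<xi>| is bounded by the sum of the |\<xi> $ j|, and each coordinate is
  traded for a derivative of \<phi>. The bound \<open>q\<close> is fixed before \<phi> and \<xi>,
  which makes it a continuity estimate.\<close>

lemma fourier_decay:
  "\<exists>q. schwartz_dominated q \<and>
     (\<forall>\<phi>\<in>schwartz_space. \<forall>\<xi>::real^'n::finite. norm \<xi> ^ k * norm (fourier \<phi> \<xi>) \<le> q \<phi>)"
proof (induction k)
  case 0
  show ?case by (rule exI[of _ schwartz_L1]) (simp add: schwartz_dominated_L1 norm_fourier_le)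
next
  case (Suc k)
  then obtain q :: "(real^'n \<Rightarrow> complex) \<Rightarrow> real" where q: "schwartz_dominated q"
    "\<And>\<phi> \<xi>. \<phi> \<in> schwartz_space \<Longrightarrow> norm \<xi> ^ k * norm (fourier \<phi> \<xi>) \<le> q \<phi>" by blast
  have "norm \<xi> ^ Suc k * norm (fourier \<phi> \<xi>) \<le> (\<Sum>j\<in>UNIV. q (partial_deriv j \<phi>))"
    if \<phi>: "\<phi> \<in> schwartz_space" for \<phi> and \<xi> :: "real^'n"
  proof -
    have "norm \<xi> ^ Suc k * norm (fourier \<phi> \<xi>) \<le> (\<Sum>j\<in>UNIV. \<bar>\<xi> $ j\<bar>) * (norm \<xi> ^ k * norm (fourier \<phi> \<xi>))"
      using mult_right_mono[OF norm_le_l1_cart[of \<xi>], of "norm \<xi> ^ k * norm (fourier \<phi> \<xi>)"] by (simp add: mult.assoc)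
    also have "\<dots> = (\<Sum>j\<in>UNIV. norm \<xi> ^ k * norm (fourier (partial_deriv j \<phi>) \<xi>))"
      by (simp add: fourier_partial_deriv[OF \<phi>] norm_mult sum_distrib_right sum_distrib_left mult_ac)
    also have "\<dots> \<le> (\<Sum>j\<in>UNIV. q (partial_deriv j \<phi>))"
      by (intro sum_mono q(2) schwartz_partial_deriv \<phi>)
    finally show ?thesis .
  qed
  moreover have "schwartz_dominated (\<lambda>\<phi>. \<Sum>j\<in>UNIV. q (partial_deriv j \<phi>))"
  proof (rule schwartz_dominated_sum)
    show "schwartz_dominated (\<lambda>\<phi>. q (partial_deriv j \<phi>))" for j
      using schwartz_operator_dominated[OF schwartz_operator_partial_deriv q(1)] .
  qed
  ultimately show ?case by blast
qed

lemma schwartz_operator_fourier: "schwartz_operator (fourier :: (real^'n::finite \<Rightarrow> complex) \<Rightarrow> _)"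
proof (rule schwartz_operatorI[OF smooth_on_fourier])
  fix k and "is" :: "'n list"
  obtain q :: "(real^'n \<Rightarrow> complex) \<Rightarrow> real" where q: "schwartz_dominated q"
    "\<And>\<phi> \<xi>. \<phi> \<in> schwartz_space \<Longrightarrow> norm \<xi> ^ k * norm (fourier \<phi> \<xi>) \<le> q \<phi>"
    using fourier_decay by blast
  show "\<exists>q. schwartz_dominated q \<and>
      (\<forall>\<phi>\<in>schwartz_space. \<forall>x. norm x ^ k * norm (partial_derivs is (fourier \<phi>) x) \<le> q \<phi>)"
  proof (intro exI conjI ballI allI)
    show "schwartz_dominated (\<lambda>\<phi>. q (\<lambda>x. frequency_monomial is x * \<phi> x))"
      by (rule schwartz_operator_dominated[OF schwartz_operator_frequency_monomial q(1)])
  qed (simp add: partial_derivs_fourier q(2) schwartz_frequency_monomial)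
qed

lemma fourier_schwartz: "\<phi> \<in> schwartz_space \<Longrightarrow> fourier \<phi> \<in> schwartz_space"
  by (rule schwartz_operator_mem[OF schwartz_operator_fourier])

lemma fourier_add:
  "\<phi> \<in> schwartz_space \<Longrightarrow> \<psi> \<in> schwartz_space \<Longrightarrow>
    fourier (\<lambda>x. \<phi> x + \<psi> x) = (\<lambda>\<xi>. fourier \<phi> \<xi> + fourier \<psi> \<xi>)"
  by (rule ext) (simp add: fourier_eq distrib_left schwartz_integrable_plane_wave)

lemma fourier_cmult: "fourier (\<lambda>x. c * \<phi> x) = (\<lambda>\<xi>. c * fourier \<phi> \<xi>)"
  by (rule ext) (simp add: fourier_eq mult.left_commute)

lemma fourier_reflect:
  assumes "\<phi> \<in> schwartz_space"
  shows "fourier (\<lambda>x. \<phi> (- x)) = (\<lambda>\<xi>. fourier \<phi> (- \<xi>))"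
proof
  fix \<xi> :: "real^'a"
  have "(\<lambda>x. plane_wave x (- \<xi>)) \<in> borel_measurable borel"
    by (rule borel_measurable_continuous_onI[OF continuous_on_plane_wave[OF continuous_on_id
          continuous_on_const]])
  with schwartz_measurable[OF assms] have "(\<lambda>x. plane_wave x (- \<xi>) * \<phi> x) \<in> borel_measurable borel"
    by (intro borel_measurable_times)
  then have e: "fourier \<phi> (- \<xi>) = \<bar>- 1\<bar> ^ DIM(real^'a) *\<^sub>R
      (LINT x|lborel. plane_wave (0 + (- 1) *\<^sub>R x) (- \<xi>) * \<phi> (0 + (- 1) *\<^sub>R x))"
    unfolding fourier_eq by (rule integral_affine[rotated]) simp
  have "plane_wave (0 + (- 1) *\<^sub>R x) (- \<xi>) * \<phi> (0 + (- 1) *\<^sub>R x) = plane_wave x \<xi> * \<phi> (- x)" for x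
    by (simp add: plane_wave_def)
  then have "fourier \<phi> (- \<xi>) = (LINT x|lborel. plane_wave x \<xi> * \<phi> (- x))"
    unfolding e by (simp only: abs_minus_cancel abs_one power_one scaleR_one)
  then show "fourier (\<lambda>x. \<phi> (- x)) \<xi> = fourier \<phi> (- \<xi>)"
    unfolding fourier_eq[of "\<lambda>x. \<phi> (- x)"] by (rule sym)
qed

section \<open>Inversion by Gaussian regularisation\<close>

section \<open>Fourier inversion\<close>

lemma fourier_multiplication_formula:
  fixes \<phi> g :: "real^'n::finite \<Rightarrow> complex"
  assumes "integrable lborel \<phi>" "integrable lborel g"
  shows "(LINT \<xi>|lborel. fourier \<phi> \<xi> * g \<xi>) = (LINT y|lborel. \<phi> y * fourier g y)"
proof -
  have [measurable]: "\<phi> \<in> borel_measurable borel" "g \<in> borel_measurable borel"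
    using borel_measurable_integrable[OF assms(1)] borel_measurable_integrable[OF assms(2)] by simp_all
  let ?H = "\<lambda>\<xi> y. plane_wave y \<xi> * (\<phi> y * g \<xi>)"
  have "integrable (lborel \<Otimes>\<^sub>M lborel) (\<lambda>(\<xi>, y). ?H \<xi> y)"
  proof (rule lborel_pair.Fubini_integrable)
    show "(\<lambda>(\<xi>, y). ?H \<xi> y) \<in> borel_measurable (lborel \<Otimes>\<^sub>M lborel)"
      unfolding plane_wave_def by measurable
    have "(LINT y|lborel. norm (?H \<xi> y)) = (LINT y|lborel. norm (\<phi> y)) * norm (g \<xi>)" for \<xi>
      by (simp add: norm_mult)
    then show "integrable lborel (\<lambda>\<xi>. LINT y|lborel. norm (case (\<xi>, y) of (\<xi>, y) \<Rightarrow> ?H \<xi> y))"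
      using assms by simp
    have "?H \<xi> \<in> borel_measurable lborel" for \<xi>
      unfolding plane_wave_def by measurable
    then have "integrable lborel (?H \<xi>)" for \<xi>
      by (rule Bochner_Integration.integrable_bound[of _ "\<lambda>y. norm (\<phi> y) * norm (g \<xi>)", rotated])
        (use assms in \<open>auto simp: norm_mult\<close>)
    then show "AE \<xi> in lborel. integrable lborel (\<lambda>y. case (\<xi>, y) of (\<xi>, y) \<Rightarrow> ?H \<xi> y)" by simp
  qed
  from lborel_pair.Fubini_integral[OF this]
  have "(LINT y|lborel. LINT \<xi>|lborel. ?H \<xi> y) = (LINT \<xi>|lborel. LINT y|lborel. ?H \<xi> y)" by simp
  moreover have "(LINT y|lborel. ?H \<xi> y) = fourier \<phi> \<xi> * g \<xi>" for \<xi>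
    unfolding fourier_eq by (simp flip: mult.assoc)
  moreover have "(LINT \<xi>|lborel. ?H \<xi> y) = \<phi> y * fourier g y" for y
    unfolding fourier_eq by (simp add: plane_wave_sym[of y] mult.left_commute)
  ultimately show ?thesis by simp
qed

definition gaussian :: "real^'n::finite \<Rightarrow> complex" where
  "gaussian x = (\<Prod>b\<in>Basis. complex_of_real (exp (- (x \<bullet> b)\<^sup>2 / 2)))"

lemma
  shows integrable_gaussian_1d: "integrable lborel (\<lambda>t::real. exp (- t\<^sup>2 / 2))"
    and integral_gaussian_1d: "(LINT t::real|lborel. exp (- t\<^sup>2 / 2)) = sqrt (2 * pi)"
    and fourier_gaussian_1d: "(LINT t|lborel. complex_of_real (exp (- t\<^sup>2 / 2)) * exp (- (\<i> * complex_of_real (t * z))))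
      = complex_of_real (sqrt (2 * pi) * exp (- z\<^sup>2 / 2))"
proof -
  have d: "std_normal_density t * sqrt (2 * pi) = exp (- t\<^sup>2 / 2)" for t
    by (simp add: std_normal_density_def)
  have "integrable lborel (\<lambda>t. std_normal_density t * sqrt (2 * pi))"
    using integrable_normal_density[of 1 0] by simp
  then show "integrable lborel (\<lambda>t::real. exp (- t\<^sup>2 / 2))" unfolding d .
  have "(LINT t|lborel. std_normal_density t * sqrt (2 * pi)) = sqrt (2 * pi)"
    using integral_normal_density[of 1 0] by simp
  then show "(LINT t::real|lborel. exp (- t\<^sup>2 / 2)) = sqrt (2 * pi)" unfolding d .
  \<comment> \<open>The transform is the characteristic function of the standard normal law; the
    argument \<open>- z\<close> accounts for the sign in the exponent.\<close>
  have "char std_normal_distribution (- z) = (LINT t|lborel. std_normal_density t *\<^sub>R iexp (- z * t))"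
    unfolding char_def by (subst integral_density) auto
  then have "complex_of_real (exp (- z\<^sup>2 / 2)) = (LINT t|lborel. std_normal_density t *\<^sub>R iexp (- z * t))"
    by (simp add: char_std_normal_distribution)
  moreover have "complex_of_real (exp (- t\<^sup>2 / 2)) * exp (- (\<i> * complex_of_real (t * z)))
      = complex_of_real (sqrt (2 * pi)) * (std_normal_density t *\<^sub>R iexp (- z * t))" for t
    unfolding d[symmetric] of_real_mult scaleR_conv_of_real by (simp add: mult_ac)
  ultimately show "(LINT t|lborel. complex_of_real (exp (- t\<^sup>2 / 2)) * exp (- (\<i> * complex_of_real (t * z))))
      = complex_of_real (sqrt (2 * pi) * exp (- z\<^sup>2 / 2))"
    by (simp only: integral_mult_right_zero of_real_mult)
qed

lemma integrable_gaussian: "integrable lborel gaussian"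
  unfolding gaussian_def[abs_def]
  by (rule integrable_prod_Basis) (rule integrable_of_real[OF integrable_gaussian_1d])

lemma integral_gaussian:
  "(LINT x|lborel. gaussian (x::real^'n::finite)) = complex_of_real (sqrt (2 * pi) ^ CARD('n))"
proof -
  have "(LINT t|lborel. complex_of_real (exp (- t\<^sup>2 / 2))) = complex_of_real (sqrt (2 * pi))"
    using integral_gaussian_1d by simp
  then show ?thesis
    unfolding gaussian_def integral_prod_Basis[OF integrable_of_real[OF integrable_gaussian_1d]]
    by (simp only: prod_constant DIM_cart DIM_real mult_1_right of_real_power)
qed

lemma fourier_gaussian:
  "fourier gaussian (\<zeta>::real^'n::finite) = complex_of_real (sqrt (2 * pi) ^ CARD('n)) * gaussian \<zeta>"
proof -
  let ?h = "\<lambda>b t. complex_of_real (exp (- t\<^sup>2 / 2)) * exp (- (\<i> * complex_of_real (t * (\<zeta> \<bullet> b))))"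
  have "plane_wave x \<zeta> * gaussian x = (\<Prod>b\<in>Basis. ?h b (x \<bullet> b))" for x
  proof -
    have "- (\<i> * complex_of_real (x \<bullet> \<zeta>)) = (\<Sum>b\<in>Basis. - (\<i> * complex_of_real ((x \<bullet> b) * (\<zeta> \<bullet> b))))"
      unfolding euclidean_inner[of x \<zeta>] of_real_sum sum_distrib_left sum_negf ..
    then have "plane_wave x \<zeta> = (\<Prod>b\<in>Basis. exp (- (\<i> * complex_of_real ((x \<bullet> b) * (\<zeta> \<bullet> b)))))"
      unfolding plane_wave_def by (simp only: exp_sum[OF finite_Basis])
    then show ?thesis unfolding gaussian_def prod.distrib by (simp only: mult.commute)
  qed
  then have "fourier gaussian \<zeta> = (LINT x|lborel. (\<Prod>b\<in>Basis. ?h b (x \<bullet> b)))" by (simp add: fourier_eq)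
  also have "\<dots> = (\<Prod>b\<in>(Basis::(real^'n) set). LINT t|lborel. ?h b t)"
  proof (rule integral_prod_Basis)
    fix b :: "real^'n"
    show "integrable lborel (?h b)"
      by (rule Bochner_Integration.integrable_bound[OF integrable_gaussian_1d]) (auto simp: norm_mult)
  qed
  also have "\<dots> = complex_of_real (sqrt (2 * pi) ^ CARD('n)) * gaussian \<zeta>"
    unfolding fourier_gaussian_1d unfolding gaussian_def of_real_mult prod.distrib
    by (simp only: prod_constant DIM_cart DIM_real mult_1_right of_real_power)
  finally show ?thesis .
qed

lemma continuous_on_gaussian: "continuous_on A gaussian"
  unfolding gaussian_def
proof (rule continuous_on_prod, rule continuous_on_of_real, rule continuous_on_exp)
  fix b :: "real^'a"
  have "continuous_on A (\<lambda>x. (x \<bullet> b)\<^sup>2)"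
    by (rule continuous_on_power[OF continuous_on_inner[OF continuous_on_id continuous_on_const]])
  from continuous_on_divide[OF continuous_on_minus[OF this] continuous_on_const[of A 2]]
  show "continuous_on A (\<lambda>x. - (x \<bullet> b)\<^sup>2 / 2)" by simp
qed

lemma gaussian_bound: "norm (gaussian x) \<le> 1"
proof -
  have "norm (gaussian x) = (\<Prod>b\<in>Basis. exp (- (x \<bullet> b)\<^sup>2 / 2))"
    unfolding gaussian_def by (subst prod_norm[symmetric]) (simp only: norm_of_real abs_exp_cancel)
  also have "\<dots> \<le> 1" by (rule prod_le_1) simp
  finally show ?thesis .
qed

text \<open>The double integral behind the left-hand side is not absolutely convergent. A Gaussian
  factor in \<epsilon> \<xi> makes Fubini available through
  \<open>fourier_multiplication_formula\<close> and turns the integral into the average of \<phi>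
  against a Gaussian that concentrates at - x. As \<epsilon> tends to 0 both forms converge, and the
  total mass of the transformed Gaussian supplies the power of 2 pi.\<close>

theorem fourier_fourier:
  fixes \<phi> :: "real^'n::finite \<Rightarrow> complex"
  assumes \<phi>: "\<phi> \<in> schwartz_space"
  shows "fourier (fourier \<phi>) x = complex_of_real ((2 * pi) ^ CARD('n)) * \<phi> (- x)"
proof -
  define \<epsilon> where "\<epsilon> n = 1 / (real n + 1)" for n
  have \<epsilon>: "\<epsilon> n > 0" "\<epsilon> n \<le> 1" for n by (auto simp: \<epsilon>_def)
  have \<epsilon>0: "\<epsilon> \<longlonglongrightarrow> 0" unfolding \<epsilon>_def by real_asymp
  define G where "G n \<xi> = plane_wave x \<xi> * gaussian (\<epsilon> n *\<^sub>R \<xi>)" for n \<xi>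
  have g_meas [measurable]: "gaussian \<in> borel_measurable borel"
    by (rule borel_measurable_continuous_onI[OF continuous_on_gaussian])
  note [measurable] = schwartz_measurable[OF \<phi>]
  have intG: "integrable lborel (G n)" for n
  proof -
    have "integrable (density (distr lborel borel (\<lambda>x::real^'n. 0 + \<epsilon> n *\<^sub>R x)) (\<lambda>_. \<bar>\<epsilon> n\<bar>^DIM(real^'n))) gaussian"
      using integrable_gaussian lborel_affine[of "\<epsilon> n" "0::real^'n"] \<epsilon>[of n] by simp
    then have "integrable lborel (\<lambda>x::real^'n. \<bar>\<epsilon> n\<bar>^DIM(real^'n) *\<^sub>R gaussian (0 + \<epsilon> n *\<^sub>R x))"
      by (subst (asm) integrable_density) (auto simp: integrable_distr_eq)
    from integrable_scaleR_right[OF this, of "inverse (\<bar>\<epsilon> n\<bar> ^ DIM(real^'n))"]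
    have "integrable lborel (\<lambda>x::real^'n. gaussian (\<epsilon> n *\<^sub>R x))"
      using \<epsilon>[of n] by simp
    then show ?thesis unfolding G_def
      by (rule Bochner_Integration.integrable_bound) (auto simp: norm_mult plane_wave_def)
  qed
  \<comment> \<open>Modulation becomes translation and dilation becomes inverse dilation:
    \<open>fourier (G n)\<close> is a Gaussian profile of width \<open>\<epsilon> n\<close> centred
    at \<open>- x\<close>, here written in the rescaled variable \<open>z\<close>.\<close>
  have FG: "fourier (G n) (\<epsilon> n *\<^sub>R z - x) = inverse (\<epsilon> n ^ CARD('n)) *\<^sub>R fourier gaussian z" for n z
  proof -
    have "fourier gaussian z = \<bar>\<epsilon> n\<bar> ^ DIM(real^'n) *\<^sub>R (LINT \<xi>|lborel. plane_wave (0 + \<epsilon> n *\<^sub>R \<xi>) z * gaussian (0 + \<epsilon> n *\<^sub>R \<xi>))"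
      unfolding fourier_eq by (rule integral_affine) (use \<epsilon>[of n] in auto)
    also have "(LINT \<xi>|lborel. plane_wave (0 + \<epsilon> n *\<^sub>R \<xi>) z * gaussian (0 + \<epsilon> n *\<^sub>R \<xi>)) = fourier (G n) (\<epsilon> n *\<^sub>R z - x)"
      unfolding fourier_eq G_def mult.assoc[symmetric]
      by (simp add: plane_wave_def inner_diff_right inner_commute algebra_simps flip: exp_add)
    finally show ?thesis using \<epsilon>[of n] by simp
  qed
  have key: "(LINT \<xi>|lborel. fourier \<phi> \<xi> * G n \<xi>) = (LINT z::real^'n|lborel. \<phi> (\<epsilon> n *\<^sub>R z - x) * fourier gaussian z)" for n
  proof -
    have contFG: "continuous_on UNIV (\<lambda>z::real^'n. fourier gaussian z)"
      unfolding fourier_gaussian by (intro continuous_intros continuous_on_gaussian)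
    have "fourier (G n) y = inverse (\<epsilon> n ^ CARD('n)) *\<^sub>R fourier gaussian (inverse (\<epsilon> n) *\<^sub>R (y + x))" for y
      using FG[of n "inverse (\<epsilon> n) *\<^sub>R (y + x)"] \<epsilon>[of n] by simp
    moreover have "continuous_on UNIV (\<lambda>y. inverse (\<epsilon> n ^ CARD('n)) *\<^sub>R fourier gaussian (inverse (\<epsilon> n) *\<^sub>R (y + x)))"
      by (intro continuous_intros continuous_on_compose2[OF contFG]) auto
    ultimately have "continuous_on UNIV (fourier (G n))" by (simp add: ext)
    then have [measurable]: "fourier (G n) \<in> borel_measurable borel" by (rule borel_measurable_continuous_onI)
    have "(LINT \<xi>|lborel. fourier \<phi> \<xi> * G n \<xi>) = (LINT y|lborel. \<phi> y * fourier (G n) y)"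
      by (rule fourier_multiplication_formula[OF schwartz_integrable[OF \<phi>] intG])
    also have "\<dots> = \<bar>\<epsilon> n\<bar> ^ DIM(real^'n) *\<^sub>R (LINT z|lborel. \<phi> (- x + \<epsilon> n *\<^sub>R z) * fourier (G n) (- x + \<epsilon> n *\<^sub>R z))"
      by (rule integral_affine) (use \<epsilon>[of n] in auto)
    also have "\<dots> = (LINT z|lborel. \<phi> (\<epsilon> n *\<^sub>R z - x) * fourier gaussian z)"
      using \<epsilon>[of n] FG[of n] by simp
    finally show ?thesis .
  qed
  obtain B where B: "\<And>y. norm (\<phi> y) \<le> B"
      using schwartz_seminorm_upper[OF \<phi>, of _ 0 "[]"] by auto
  have "(\<lambda>n. LINT \<xi>|lborel. fourier \<phi> \<xi> * G n \<xi>) \<longlonglongrightarrow> (LINT \<xi>|lborel. fourier \<phi> \<xi> * (plane_wave x \<xi> * gaussian (0::real^'n)))"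
  proof (rule integral_dominated_convergence)
    note F = fourier_schwartz[OF \<phi>]
    have [measurable]: "fourier \<phi> \<in> borel_measurable borel" by (rule schwartz_measurable[OF F])
    show "integrable lborel (\<lambda>\<xi>. norm (fourier \<phi> \<xi>))" by (rule integrable_norm[OF schwartz_integrable[OF F]])
    show "(\<lambda>\<xi>. fourier \<phi> \<xi> * (plane_wave x \<xi> * gaussian (0::real^'n))) \<in> borel_measurable lborel"
      unfolding plane_wave_def by measurable
    show "(\<lambda>\<xi>. fourier \<phi> \<xi> * G n \<xi>) \<in> borel_measurable lborel" for n
      unfolding G_def plane_wave_def by measurable
    have "(\<lambda>n. fourier \<phi> \<xi> * G n \<xi>) \<longlonglongrightarrow> fourier \<phi> \<xi> * (plane_wave x \<xi> * gaussian (0::real^'n))" for \<xi>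
    proof -
      have "(\<lambda>n. \<epsilon> n *\<^sub>R \<xi>) \<longlonglongrightarrow> 0" using tendsto_scaleR[OF \<epsilon>0 tendsto_const[of \<xi>]] by simp
      from continuous_on_tendsto_compose[OF continuous_on_gaussian[of UNIV] this]
      show ?thesis unfolding G_def by (intro tendsto_intros) auto
    qed
    then show "AE \<xi> in lborel. (\<lambda>n. fourier \<phi> \<xi> * G n \<xi>) \<longlonglongrightarrow> fourier \<phi> \<xi> * (plane_wave x \<xi> * gaussian (0::real^'n))" by simp
    show "AE \<xi> in lborel. norm (fourier \<phi> \<xi> * G n \<xi>) \<le> norm (fourier \<phi> \<xi>)" for n
      unfolding G_def norm_mult by (auto intro!: mult_left_le gaussian_bound)
  qed
  moreover have "(LINT \<xi>|lborel. fourier \<phi> \<xi> * (plane_wave x \<xi> * gaussian (0::real^'n))) = fourier (fourier \<phi>) x"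
    unfolding fourier_eq[of "fourier \<phi>"] by (simp add: gaussian_def plane_wave_sym[of x] mult.commute)
  moreover have "(\<lambda>n. LINT \<xi>|lborel. fourier \<phi> \<xi> * G n \<xi>) \<longlonglongrightarrow> (LINT z::real^'n|lborel. \<phi> (- x) * fourier gaussian z)"
    unfolding key
  proof (rule integral_dominated_convergence)
    have iFg: "integrable lborel (fourier (gaussian :: real^'n \<Rightarrow> complex))"
      unfolding fourier_gaussian[abs_def] by (rule integrable_mult_right[OF integrable_gaussian])
    then have [measurable]: "fourier (gaussian :: real^'n \<Rightarrow> complex) \<in> borel_measurable borel" by simp
    show "integrable lborel (\<lambda>z::real^'n. B * norm (fourier gaussian z))"
      using integrable_norm[OF iFg] by simp
    show "(\<lambda>z::real^'n. \<phi> (- x) * fourier gaussian z) \<in> borel_measurable lborel" by measurable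
    show "(\<lambda>z. \<phi> (\<epsilon> n *\<^sub>R z - x) * fourier gaussian z) \<in> borel_measurable lborel" for n by measurable
    have "(\<lambda>n. \<phi> (\<epsilon> n *\<^sub>R z - x) * fourier gaussian z) \<longlonglongrightarrow> \<phi> (- x) * fourier gaussian z" for z :: "real^'n"
    proof -
      have "(\<lambda>n. \<epsilon> n *\<^sub>R z - x) \<longlonglongrightarrow> 0 *\<^sub>R z - x" by (intro tendsto_intros \<epsilon>0)
      then have "(\<lambda>n. \<epsilon> n *\<^sub>R z - x) \<longlonglongrightarrow> - x" by simp
      from continuous_on_tendsto_compose[OF schwartz_continuous[OF \<phi>, of UNIV] this]
      show ?thesis by (intro tendsto_intros) auto
    qed
    then show "AE z in lborel. (\<lambda>n. \<phi> (\<epsilon> n *\<^sub>R z - x) * fourier gaussian z) \<longlonglongrightarrow> \<phi> (- x) * fourier gaussian z" by simp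
    show "AE z in lborel. norm (\<phi> (\<epsilon> n *\<^sub>R z - x) * fourier gaussian z) \<le> B * norm (fourier gaussian z)" for n
      unfolding norm_mult by (auto intro!: mult_right_mono B)
  qed
  moreover have "(LINT z::real^'n|lborel. \<phi> (- x) * fourier gaussian z) = complex_of_real ((2 * pi) ^ CARD('n)) * \<phi> (- x)"
  proof -
    have "sqrt (2 * pi) * sqrt (2 * pi) = 2 * pi" by simp
    then have "(2 * pi) ^ CARD('n) = sqrt (2 * pi) ^ CARD('n) * sqrt (2 * pi) ^ CARD('n)"
      by (simp only: power_mult_distrib[symmetric])
    then show ?thesis
      unfolding fourier_gaussian integral_mult_right_zero integral_gaussian
      by (simp only: of_real_mult mult_ac)
  qed
  ultimately have "(\<lambda>n. LINT \<xi>|lborel. fourier \<phi> \<xi> * G n \<xi>) \<longlonglongrightarrow> fourier (fourier \<phi>) x"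
    "(\<lambda>n. LINT \<xi>|lborel. fourier \<phi> \<xi> * G n \<xi>) \<longlonglongrightarrow> complex_of_real ((2 * pi) ^ CARD('n)) * \<phi> (- x)"
    by (simp_all only:)
  then show ?thesis by (rule LIMSEQ_unique)
qed

lemma inverse_fourier_eq:
  "inverse_fourier \<phi> = (\<lambda>x. inverse (complex_of_real ((2 * pi) ^ CARD('n))) * fourier \<phi> (- x))"
  for \<phi> :: "real^'n::finite \<Rightarrow> complex"
proof
  fix x :: "real^'n"
  have "\<phi> \<xi> * exp (\<i> * complex_of_real (x \<bullet> \<xi>)) = \<phi> \<xi> * exp (- (\<i> * complex_of_real (\<xi> \<bullet> - x)))" for \<xi>
    unfolding inner_minus_right inner_commute[of \<xi> x] by simp
  then show "inverse_fourier \<phi> x = inverse (complex_of_real ((2 * pi) ^ CARD('n))) * fourier \<phi> (- x)"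
    unfolding inverse_fourier_def fourier_def by (simp only: divide_inverse mult.commute)
qed

lemma schwartz_operator_inverse_fourier:
  "schwartz_operator (inverse_fourier :: (real^'n::finite \<Rightarrow> complex) \<Rightarrow> _)"
proof -
  let ?c = "inverse (complex_of_real ((2 * pi) ^ CARD('n)))"
  have 1: "schwartz_operator (\<lambda>(\<phi>::real^'n \<Rightarrow> complex) x. fourier \<phi> (- x))"
    using schwartz_operator_compose[OF schwartz_operator_reflect schwartz_operator_fourier] .
  have "schwartz_operator (\<lambda>(\<phi>::real^'n \<Rightarrow> complex) x. ?c * fourier \<phi> (- x))"
    using schwartz_operator_compose[OF schwartz_operator_cmult[of ?c] 1] .
  then show ?thesis unfolding inverse_fourier_eq[abs_def] .
qed

lemma inverse_fourier_schwartz: "\<phi> \<in> schwartz_space \<Longrightarrow> inverse_fourier \<phi> \<in> schwartz_space"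
  by (rule schwartz_operator_mem[OF schwartz_operator_inverse_fourier])

lemma two_pi_power_cancel:
  "inverse (complex_of_real ((2 * pi) ^ n)) * (complex_of_real ((2 * pi) ^ n) * z) = z"
proof -
  have "complex_of_real ((2 * pi) ^ n) \<noteq> 0" by simp
  from left_inverse[OF this] show ?thesis unfolding mult.assoc[symmetric] by (rule ssubst) (rule mult_1_left)
qed

lemma inverse_fourier_fourier: "\<phi> \<in> schwartz_space \<Longrightarrow> inverse_fourier (fourier \<phi>) = \<phi>"
  unfolding inverse_fourier_eq by (rule ext) (simp only: fourier_fourier minus_minus two_pi_power_cancel)

lemma fourier_inverse_fourier:
  fixes \<phi> :: "real^'n::finite \<Rightarrow> complex"
  assumes "\<phi> \<in> schwartz_space"
  shows "fourier (inverse_fourier \<phi>) = \<phi>"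
  unfolding inverse_fourier_eq fourier_cmult fourier_reflect[OF fourier_schwartz[OF assms]]
  by (simp only: fourier_fourier[OF assms] minus_minus two_pi_power_cancel)

lemma inverse_fourier_add:
  "\<phi> \<in> schwartz_space \<Longrightarrow> \<psi> \<in> schwartz_space \<Longrightarrow>
    inverse_fourier (\<lambda>x. \<phi> x + \<psi> x) = (\<lambda>\<xi>. inverse_fourier \<phi> \<xi> + inverse_fourier \<psi> \<xi>)"
  by (simp add: inverse_fourier_eq fourier_add distrib_left)

lemma inverse_fourier_cmult: "inverse_fourier (\<lambda>x. c * \<phi> x) = (\<lambda>\<xi>. c * inverse_fourier \<phi> \<xi>)"
  by (simp add: inverse_fourier_eq fourier_cmult mult.left_commute)

section \<open>Smoothness, symbol estimates and strict monotonicity of Bernstein functions\<close>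

section \<open>Bernstein functions\<close>

text \<open>The exponential series gives x^n exp(-x) <= n!. The case n = k + 1 yields the constant
  bound and the case n = k, times x, the linear one; \<open>min 1 x\<close> is the function that a
  Levy measure integrates.\<close>

lemma power_exp_minus_le:
  assumes "0 \<le> x"
  shows "x ^ Suc k * exp (- x) \<le> fact (Suc k) * min 1 (x::real)"
proof -
  have le: "x ^ n \<le> fact n * exp x" for n
  proof -
    have "(\<Sum>m\<in>{n}. x ^ m /\<^sub>R fact m) \<le> (\<Sum>m. x ^ m /\<^sub>R fact m)"
      by (rule sum_le_suminf) (use assms summable_exp_generic[of x] in auto)
    then have "x ^ n / fact n \<le> exp x" by (simp add: exp_def divide_inverse mult.commute)
    then show ?thesis by (simp add: pos_divide_le_eq mult.commute)
  qed
  have "x ^ Suc k * exp (- x) \<le> (fact (Suc k) * exp x) * exp (- x)" by (rule mult_right_mono[OF le]) simp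
  then have 1: "x ^ Suc k * exp (- x) \<le> fact (Suc k)" by (simp add: mult.assoc flip: exp_add)
  have "x ^ k * exp (- x) \<le> (fact k * exp x) * exp (- x)" by (rule mult_right_mono[OF le]) simp
  then have "x ^ k * exp (- x) \<le> fact k" by (simp add: mult.assoc flip: exp_add)
  then have "x * (x ^ k * exp (- x)) \<le> x * fact k" using assms by (rule mult_left_mono)
  also have "\<dots> \<le> x * fact (Suc k)" using assms by (intro mult_left_mono fact_mono) auto
  finally have 2: "x ^ Suc k * exp (- x) \<le> fact (Suc k) * x" by (simp add: mult_ac)
  from 1 2 show ?thesis by (auto simp: min_def)
qed

lemma exp_second_order_bound: "\<bar>exp x - 1 - x\<bar> \<le> x\<^sup>2 * exp \<bar>x\<bar>" for x :: real
proof -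
  obtain t where t: "\<bar>t\<bar> \<le> \<bar>x\<bar>" "exp x = (\<Sum>m<2. x ^ m / fact m) + exp t / fact 2 * x ^ 2"
    using Maclaurin_exp_le by blast
  then have e: "exp x - 1 - x = exp t / 2 * x\<^sup>2" by (simp add: numeral_2_eq_2)
  have "\<bar>exp x - 1 - x\<bar> = exp t / 2 * x\<^sup>2" unfolding e by (rule abs_of_nonneg) simp
  also have "\<dots> \<le> exp \<bar>x\<bar> * x\<^sup>2"
  proof (rule mult_right_mono)
    have "exp t \<le> exp \<bar>x\<bar>" using t(1) by auto
    then show "exp t / 2 \<le> exp \<bar>x\<bar>" using exp_ge_zero[of t] by linarith
  qed simp
  finally show ?thesis by (simp add: mult.commute)
qed

text \<open>The derivative in \<open>s\<close> of the kernel of order k is minus the kernel of order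
  k + 1, for all k. Subtracting 1 at order 0 makes that kernel integrable, and it is minus the
  integrand of the Levy representation.\<close>

definition levy_kernel :: "nat \<Rightarrow> real \<Rightarrow> real \<Rightarrow> real" where
  "levy_kernel k s t = (if k = 0 then exp (- s * t) - 1 else t ^ k * exp (- s * t))"

locale levy_measure =
  fixes \<mu> :: "real measure"
  assumes sets_\<mu>: "sets \<mu> = sets (restrict_space borel {0<..})"
    and integrable_min: "integrable \<mu> (\<lambda>t. min 1 t)"
begin

lemma space_\<mu>: "space \<mu> = {0<..}"
  using sets_eq_imp_space_eq[OF sets_\<mu>] by (simp add: space_restrict_space)

lemma borel_measurable_\<mu>: "g \<in> borel_measurable borel \<Longrightarrow> g \<in> borel_measurable \<mu>"
  using measurable_restrict_space1 measurable_cong_sets[OF sets_\<mu> refl] by blast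

text \<open>\<open>power_exp_minus_le\<close> at x = s t; the inequality \<open>mm\<close> then
  separates the two variables.\<close>

lemma levy_kernel_bound:
  assumes "0 < s" "0 < t"
  shows "\<bar>levy_kernel k s t\<bar> \<le> fact k * (1 / s) ^ k * max 1 s * min 1 t"
proof -
  have mm: "min 1 (s * t) \<le> max 1 s * min 1 t"
  proof (cases "t \<le> 1")
    case True
    have "min 1 (s * t) \<le> s * t" by simp
    also have "\<dots> \<le> max 1 s * t" by (rule mult_right_mono) (use assms in auto)
    finally show ?thesis using True by simp
  qed auto
  show ?thesis
  proof (cases k)
    case 0
    have "1 - s * t \<le> exp (- s * t)" using exp_ge_add_one_self[of "- s * t"] by simp
    moreover have "exp (- s * t) \<le> 1" "0 < exp (- s * t)" using assms by auto
    ultimately have "\<bar>exp (- s * t) - 1\<bar> \<le> min 1 (s * t)" by linarith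
    from order_trans[OF this mm] show ?thesis by (simp add: levy_kernel_def 0)
  next
    case (Suc j)
    have "\<bar>levy_kernel k s t\<bar> = (1 / s) ^ k * ((s * t) ^ Suc j * exp (- (s * t)))"
      using assms by (simp add: levy_kernel_def Suc power_mult_distrib power_divide)
    also have "\<dots> \<le> (1 / s) ^ k * (fact k * (max 1 s * min 1 t))"
      unfolding Suc using assms
      by (intro mult_left_mono order_trans[OF power_exp_minus_le] mm) auto
    finally show ?thesis by (simp add: mult_ac)
  qed
qed

lemma levy_kernel_integrable:
  assumes "0 < s"
  shows "integrable \<mu> (levy_kernel k s)"
proof (rule Bochner_Integration.integrable_bound)
  show "integrable \<mu> (\<lambda>t. fact k * (1 / s) ^ k * max 1 s * min 1 t)"
    by (rule integrable_mult_right[OF integrable_min])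
  have "levy_kernel k s \<in> borel_measurable borel" unfolding levy_kernel_def by measurable
  then show "levy_kernel k s \<in> borel_measurable \<mu>" by (rule borel_measurable_\<mu>)
  show "AE t in \<mu>. norm (levy_kernel k s t) \<le> norm (fact k * (1 / s) ^ k * max 1 s * min 1 t)"
    using levy_kernel_bound[OF assms, of _ k] space_\<mu>
    by (intro AE_I2) (auto intro: order_trans[OF _ abs_ge_self])
qed

definition levy_integral :: "nat \<Rightarrow> real \<Rightarrow> real" where
  "levy_integral k s = (LINT t|\<mu>. levy_kernel k s t)"

lemma levy_integral_bound:
  assumes "0 < s"
  shows "\<bar>levy_integral k s\<bar> \<le> fact k * (LINT t|\<mu>. min 1 t) * ((1 / s) ^ k * max 1 s)"
proof -
  have "\<bar>levy_integral k s\<bar> \<le> (LINT t|\<mu>. \<bar>levy_kernel k s t\<bar>)"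
    unfolding levy_integral_def using integral_norm_bound[of \<mu> "levy_kernel k s"] by simp
  also have "\<dots> \<le> (LINT t|\<mu>. fact k * (1 / s) ^ k * max 1 s * min 1 t)"
    by (intro integral_mono integrable_abs levy_kernel_integrable assms
        integrable_mult_right[OF integrable_min]) (use levy_kernel_bound[OF assms] space_\<mu> in auto)
  finally show ?thesis by (simp add: mult_ac)
qed

text \<open>The Taylor remainder of the kernel is at most (h t)^2 exp(|h| t) times t^k exp(-s t).
  For |h| < s/2 this consumes only half of the exponential decay, and what remains is h^2 times the
  integrable kernel of order k + 2 at s/2.\<close>

lemma levy_integral_has_derivative:
  assumes s: "0 < s"
  shows "(levy_integral k has_vector_derivative - levy_integral (Suc k) s) (at s)"
  unfolding has_vector_derivative_def
proof (rule has_derivative_quadratic[where r="s / 2" and K="levy_integral (k + 2) (s / 2)"])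
  fix h :: real assume h: "norm h < s / 2"
  then have sh: "0 < s + h" and hs: "\<bar>h\<bar> \<le> s / 2" by auto
  let ?R = "\<lambda>t. levy_kernel k (s + h) t - levy_kernel k s t + h * levy_kernel (Suc k) s t"
  have iR: "integrable \<mu> ?R"
    by (intro Bochner_Integration.integrable_add Bochner_Integration.integrable_diff integrable_mult_right
        levy_kernel_integrable s sh)
  have "levy_integral k (s + h) - levy_integral k s - h *\<^sub>R - levy_integral (Suc k) s = (LINT t|\<mu>. ?R t)"
    unfolding levy_integral_def
    by (simp add: Bochner_Integration.integral_add Bochner_Integration.integral_diff
        Bochner_Integration.integrable_diff levy_kernel_integrable s sh)
  also have "\<bar>\<dots>\<bar> \<le> (LINT t|\<mu>. \<bar>?R t\<bar>)"
    by (rule integral_norm_bound[of \<mu> ?R, unfolded real_norm_def])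
  also have "\<dots> \<le> (LINT t|\<mu>. h\<^sup>2 * levy_kernel (k + 2) (s / 2) t)"
  proof (rule integral_mono)
    fix t assume "t \<in> space \<mu>"
    then have t: "0 < t" by (simp add: space_\<mu>)
    have "?R t = t ^ k * exp (- s * t) * (exp (- h * t) - 1 - (- h * t))"
      by (simp add: levy_kernel_def algebra_simps flip: exp_add)
    then have "\<bar>?R t\<bar> = t ^ k * exp (- s * t) * \<bar>exp (- h * t) - 1 - (- h * t)\<bar>"
      using t by (simp add: abs_mult)
    also have "\<dots> \<le> t ^ k * exp (- s * t) * ((- h * t)\<^sup>2 * exp \<bar>- h * t\<bar>)"
      by (intro mult_left_mono exp_second_order_bound) (use t in auto)
    also have "\<dots> \<le> t ^ k * exp (- s * t) * ((- h * t)\<^sup>2 * exp (s / 2 * t))"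
    proof (intro mult_left_mono)
      show "exp \<bar>- h * t\<bar> \<le> exp (s / 2 * t)" using hs t by (simp add: abs_mult)
    qed (use t in auto)
    also have "\<dots> = h\<^sup>2 * (t ^ (k + 2) * (exp (- s * t) * exp (s / 2 * t)))"
      by (simp add: power_mult_distrib power_add mult_ac power2_eq_square)
    also have "exp (- s * t) * exp (s / 2 * t) = exp (- (s / 2) * t)"
      by (simp add: field_simps flip: exp_add)
    finally show "\<bar>?R t\<bar> \<le> h\<^sup>2 * levy_kernel (k + 2) (s / 2) t" by (simp add: levy_kernel_def)
  qed (use iR s in \<open>auto intro!: levy_kernel_integrable integrable_mult_right\<close>)
  also have "\<dots> = levy_integral (k + 2) (s / 2) * (norm h)\<^sup>2"
    unfolding levy_integral_def by simp
  finally show "norm (levy_integral k (s + h) - levy_integral k s - h *\<^sub>R - levy_integral (Suc k) s)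
      \<le> levy_integral (k + 2) (s / 2) * (norm h)\<^sup>2" by simp
next
  show "bounded_linear (\<lambda>h. h *\<^sub>R - levy_integral (Suc k) s)" by (rule bounded_linear_scaleR_left)
qed (use s in simp)

lemma Ck_on_levy_integral: "Ck_on n {0<..} (levy_integral k)"
proof -
  define H where "H m s = (- 1) ^ m * levy_integral (k + m) s" for m s
  have "(H m has_vector_derivative H (Suc m) t) (at t)" if "t \<in> {0<..}" for m t
    unfolding H_def
    using has_vector_derivative_mult_right[OF levy_integral_has_derivative[of t "k + m"], of "(-1) ^ m"] that by simp
  from Ck_on_derivative_sequence[of "{0<..}" H, OF this] have "Ck_on n {0<..} (H 0)" .
  then show ?thesis by (simp add: H_def[abs_def])
qed

lemma levy_integral_nonneg: "0 < s \<Longrightarrow> 0 \<le> levy_integral (Suc k) s"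
  unfolding levy_integral_def
  by (rule Bochner_Integration.integral_nonneg) (simp add: space_\<mu> levy_kernel_def)

text \<open>The kernel of order 1 is strictly positive, so one vanishing integral already forces
  \<mu> to be the null measure.\<close>

lemma levy_integral_eq_0:
  assumes "0 < s" "levy_integral 1 s = 0" "0 < r"
  shows "levy_integral 0 r = 0"
proof -
  have "AE t in \<mu>. 0 \<le> levy_kernel 1 s t"
    by (rule AE_I2) (simp add: space_\<mu> levy_kernel_def)
  from integral_nonneg_eq_0_iff_AE[OF levy_kernel_integrable[OF assms(1), of 1] this] assms(2)
  have "AE t in \<mu>. levy_kernel 1 s t = 0" unfolding levy_integral_def by blast
  then have "AE t in \<mu>. False"
    by (rule AE_mp) (rule AE_I2, simp add: space_\<mu> levy_kernel_def)
  then have "AE t in \<mu>. levy_kernel 0 r t = 0" by (rule AE_mp) (rule AE_I2, simp)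
  then show ?thesis unfolding levy_integral_def by (rule integral_eq_zero_AE)
qed

lemma smooth_levy_radial:
  "smooth_on (- {0::real^'n::finite}) (\<lambda>x. complex_of_real (levy_integral k ((norm x)\<^sup>2)))"
  unfolding smooth_on_iff_Ck_on
  by (intro conjI allI Ck_on_of_real Ck_on_compose[OF Ck_on_levy_integral Ck_on_norm_sq]) auto

text \<open>Writing J_k for \<open>levy_integral k\<close>, the i-th derivative of J_k(|x|^2) is -2
  x_i J_(k+1)(|x|^2), hence an induction for all orders k at once. The bound s^(-k) max(1, s) at s =
  |x|^2 fits under the power 2k + 2 of the weight.\<close>

lemma slowly_increasing_levy_radial:
  "slowly_increasing n (- {0::real^'n::finite}) punctured_weight
     (\<lambda>x. complex_of_real (levy_integral k ((norm x)\<^sup>2)))"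
proof (induction n arbitrary: k)
  have pb: "polybounded (- {0::real^'n}) punctured_weight (\<lambda>x. norm (complex_of_real (levy_integral k ((norm x)\<^sup>2))))" for k
  proof (rule polyboundedI)
    let ?J = "fact k * (LINT t|\<mu>. min 1 t)"
    show J: "0 \<le> ?J"
      by (intro mult_nonneg_nonneg Bochner_Integration.integral_nonneg) (auto simp: space_\<mu>)
    fix x :: "real^'n" assume x: "x \<in> - {0}"
    have "norm (complex_of_real (levy_integral k ((norm x)\<^sup>2))) \<le> ?J * ((1 / (norm x)\<^sup>2) ^ k * max 1 ((norm x)\<^sup>2))"
      using levy_integral_bound[of "(norm x)\<^sup>2" k] x by simp
    also have "\<dots> \<le> ?J * (((punctured_weight x)\<^sup>2) ^ k * (punctured_weight x)\<^sup>2)"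
    proof (intro mult_left_mono mult_mono power_mono J)
      have "(1 / norm x)\<^sup>2 \<le> (punctured_weight x)\<^sup>2"
        by (rule power_mono) (auto simp: punctured_weight_def)
      then show "1 / (norm x)\<^sup>2 \<le> (punctured_weight x)\<^sup>2" by (simp add: power_divide)
      have "(norm x)\<^sup>2 \<le> (punctured_weight x)\<^sup>2" "1\<^sup>2 \<le> (punctured_weight x)\<^sup>2"
        by (rule power_mono; simp add: punctured_weight_def)+
      then show "max 1 ((norm x)\<^sup>2) \<le> (punctured_weight x)\<^sup>2" by simp
    qed auto
    also have "\<dots> = ?J * punctured_weight x ^ (2 * k + 2)"
      by (simp add: power_add power_mult power2_eq_square)
    finally show "norm (complex_of_real (levy_integral k ((norm x)\<^sup>2))) \<le> ?J * punctured_weight x ^ (2 * k + 2)" .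
  qed
  {
    case 0
    show ?case using smooth_levy_radial pb by (simp add: slowly_increasing_def)
  next
    case (Suc n)
    show ?case
    proof (rule slowly_increasing_Suc[OF smooth_levy_radial pb])
      fix i :: 'n
      let ?h = "\<lambda>x::real^'n. (- 2) * (complex_of_real (x $ i) * complex_of_real (levy_integral (Suc k) ((norm x)\<^sup>2)))"
      show "slowly_increasing n (- {0}) punctured_weight
          (partial_deriv i (\<lambda>x::real^'n. complex_of_real (levy_integral k ((norm x)\<^sup>2))))"
      proof (rule slowly_increasing_cong[of n _ _ ?h])
        have c: "slowly_increasing n (- {0::real^'n}) punctured_weight (\<lambda>x. complex_of_real (x $ i))"
          by (rule slowly_increasing_coord) (auto intro: punctured_weight_ge)
        show "slowly_increasing n (- {0}) punctured_weight ?h"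
          by (rule slowly_increasing_cmult[OF punctured_weight_ge_1
                slowly_increasing_mult[OF punctured_weight_ge_1 c Suc]])
        fix x :: "real^'n" assume x: "x \<in> - {0}"
        have n: "((\<lambda>x::real^'n. (norm x)\<^sup>2) has_derivative (\<lambda>v. 2 * (x \<bullet> v))) (at x)"
          unfolding power2_norm_eq_inner by (auto intro!: derivative_eq_intros simp: inner_commute)
        have "((\<lambda>x. levy_integral k ((norm x)\<^sup>2)) has_derivative (\<lambda>v. (2 * (x \<bullet> v)) *\<^sub>R - levy_integral (Suc k) ((norm x)\<^sup>2))) (at x)"
          by (rule has_derivative_compose[OF n]) (use levy_integral_has_derivative[of "(norm x)\<^sup>2" k] x in \<open>simp add: has_vector_derivative_def\<close>)
        then have "((\<lambda>x. complex_of_real (levy_integral k ((norm x)\<^sup>2))) has_derivative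
            (\<lambda>v. complex_of_real ((2 * (x \<bullet> v)) *\<^sub>R - levy_integral (Suc k) ((norm x)\<^sup>2)))) (at x)"
          by (rule bounded_linear.has_derivative[OF bounded_linear_of_real])
        then show "?h x = partial_deriv i (\<lambda>x. complex_of_real (levy_integral k ((norm x)\<^sup>2))) x"
          by (simp add: partial_deriv_eqI inner_axis)
      qed
    qed
  }
qed

end

lemma open_punctured: "open (- {0::'a::{t1_space, zero}})"
  by (rule open_Compl) (rule closed_singleton)

lemma slowly_increasing_sum:
  assumes "\<And>x. x \<in> W \<Longrightarrow> 1 \<le> w x" "open W" "\<And>i. i \<in> I \<Longrightarrow> slowly_increasing n W w (f i)"
  shows "slowly_increasing n W w (\<lambda>x. \<Sum>i\<in>I. f i x)"
  using assms(3)
proof (induction I rule: infinite_finite_induct)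
  case (insert i F)
  show ?case unfolding sum.insert[OF insert(1,2)]
    by (rule slowly_increasing_add[OF assms(1)]) (use insert in auto)
qed (simp_all add: slowly_increasing_const[OF assms(2)])

lemma slowly_increasing_norm_sq:
  "slowly_increasing n (- {0::real^'n::finite}) punctured_weight (\<lambda>x. complex_of_real ((norm x)\<^sup>2))"
proof -
  have c: "slowly_increasing n (- {0::real^'n}) punctured_weight (\<lambda>x. complex_of_real (x $ i))" for i
    by (rule slowly_increasing_coord) (auto intro: punctured_weight_ge)
  have "slowly_increasing n (- {0::real^'n}) punctured_weight
      (\<lambda>x. \<Sum>i\<in>UNIV. complex_of_real (x $ i) * complex_of_real (x $ i))"
    by (rule slowly_increasing_sum[OF punctured_weight_ge_1 open_punctured
          slowly_increasing_mult[OF punctured_weight_ge_1 c c]])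
  then show ?thesis
    by (rule slowly_increasing_cong) (simp add: power2_norm_eq_inner inner_vec_def)
qed

definition symbol :: "(real \<Rightarrow> real) \<Rightarrow> real^'n::finite \<Rightarrow> complex" where
  "symbol f x = complex_of_real (f ((norm x)\<^sup>2))"

lemma bernstein_symbol_slowly_increasing:
  assumes "bernstein_function f"
  shows "slowly_increasing n (- {0::real^'n::finite}) punctured_weight (symbol f)"
proof -
  obtain a b \<mu> where *: "has_levy_triple f a b \<mu>" using assms by (auto simp: bernstein_function_def)
  interpret levy_measure \<mu> using * by unfold_locales (auto simp: has_levy_triple_def)
  have f: "f s = a + b * s - levy_integral 0 s" if "0 < s" for s
  proof -
    have "levy_integral 0 s = (LINT t|\<mu>. - (1 - exp (- s * t)))"
      unfolding levy_integral_def levy_kernel_def by simp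
    then have "(LINT t|\<mu>. 1 - exp (- s * t)) = - levy_integral 0 s" by (simp only: integral_minus)
    with * that show ?thesis by (simp add: has_levy_triple_def)
  qed
  have "slowly_increasing n (- {0::real^'n}) punctured_weight
      (\<lambda>x. complex_of_real a + (complex_of_real b * complex_of_real ((norm x)\<^sup>2)
        + (- 1) * complex_of_real (levy_integral 0 ((norm x)\<^sup>2))))"
    by (rule slowly_increasing_add[OF punctured_weight_ge_1 slowly_increasing_const
          slowly_increasing_add[OF punctured_weight_ge_1
            slowly_increasing_cmult[OF punctured_weight_ge_1 slowly_increasing_norm_sq]
            slowly_increasing_cmult[OF punctured_weight_ge_1 slowly_increasing_levy_radial]]])
      (rule open_punctured)
  then show ?thesis
    by (rule slowly_increasing_cong) (simp add: symbol_def f)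
qed

text \<open>The derivative is b + int t exp(-s t) \<mu>(dt). If it vanished at a single s, then b =
  0 and \<mu> would be null, making f constant on the positive half-line.\<close>

lemma bernstein_increasing:
  assumes "bernstein_function f" "\<not> f constant_on {0<..}"
  shows "\<exists>f'. \<forall>s>0. (f has_real_derivative f' s) (at s) \<and> 0 < f' s"
proof -
  obtain a b \<mu> where *: "has_levy_triple f a b \<mu>" using assms by (auto simp: bernstein_function_def)
  interpret levy_measure \<mu> using * by unfold_locales (auto simp: has_levy_triple_def)
  have f: "f s = a + b * s - levy_integral 0 s" if "0 < s" for s
  proof -
    have "levy_integral 0 s = (LINT t|\<mu>. - (1 - exp (- s * t)))"
      unfolding levy_integral_def levy_kernel_def by simp
    then have "(LINT t|\<mu>. 1 - exp (- s * t)) = - levy_integral 0 s" by (simp only: integral_minus)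
    with * that show ?thesis by (simp add: has_levy_triple_def)
  qed
  have b: "0 \<le> b" using * by (simp add: has_levy_triple_def)
  have "(f has_real_derivative (b + levy_integral 1 s)) (at s) \<and> 0 < b + levy_integral 1 s" if s: "0 < s" for s
  proof
    have "(levy_integral 0 has_real_derivative - levy_integral 1 s) (at s)"
      using levy_integral_has_derivative[OF s, of 0] by (simp add: has_real_derivative_iff_has_vector_derivative)
    then have "((\<lambda>s. a + b * s - levy_integral 0 s) has_real_derivative (b + levy_integral 1 s)) (at s)"
      by (auto intro!: derivative_eq_intros)
    then show "(f has_real_derivative (b + levy_integral 1 s)) (at s)"
      by (rule has_field_derivative_transform_within_open[where S="{0<..}"]) (use s f in auto)
    have "b \<noteq> 0 \<or> levy_integral 1 s \<noteq> 0"
    proof (rule ccontr)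
      assume "\<not> (b \<noteq> 0 \<or> levy_integral 1 s \<noteq> 0)"
      then have "f r = a" if "0 < r" for r
        using f[OF that] levy_integral_eq_0[OF s _ that] by simp
      then show False using assms(2) by (auto simp: constant_on_def)
    qed
    then show "0 < b + levy_integral 1 s"
      using b levy_integral_nonneg[OF s, of 0] by auto
  qed
  then show ?thesis by (intro exI[of _ "\<lambda>s. b + levy_integral 1 s"]) simp
qed

section \<open>Hadamard's lemma for functions vanishing on the unit sphere\<close>

section \<open>Division by \<open>|x| - 1\<close>\<close>

text \<open>\<open>P (x, s)\<close> runs along the ray from x/|x| at s = 0 to x at s = 1, with
  velocity (|x| - 1) x/|x|. Integrating the derivative of g along it extracts the factor |x| - 1,
  and the remaining integral Q depends smoothly on x. On the sphere the path is constant, so Q is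
  the radial derivative of g, which later shows that the quotient of the symbol does not vanish
  there.\<close>

lemma hadamard_division:
  fixes g :: "real^'n::finite \<Rightarrow> complex"
  assumes g: "smooth_on (- {0}) g" and zero: "\<And>x. norm x = 1 \<Longrightarrow> g x = 0"
  shows "\<exists>Q. smooth_on (- {0}) Q \<and> (\<forall>x. x \<noteq> 0 \<longrightarrow> g x = complex_of_real (norm x - 1) * Q x) \<and>
     (\<forall>x. norm x = 1 \<longrightarrow> Q x = (\<Sum>i\<in>UNIV. (x $ i) *\<^sub>R partial_deriv i g x))"
proof -
  \<comment> \<open>\<open>r\<close> is the radius along the path; \<open>\<Omega>\<close> admits
    every parameter for which it stays positive, which is an open condition containing all of
    \<open>{0..1}\<close>.\<close>
  define r where "r p = 1 - snd p + snd p * norm (fst p)" for p :: "(real^'n) \<times> real"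
  define \<Omega> where "\<Omega> = {p :: (real^'n) \<times> real. fst p \<noteq> 0} \<inter> {p. 0 < r p}"
  define P where "P p = (r p * inverse (norm (fst p))) *\<^sub>R fst p" for p :: "(real^'n) \<times> real"
  define K where "K x s = (\<Sum>i\<in>UNIV. (inverse (norm x) * x $ i) *\<^sub>R partial_deriv i g (P (x, s)))" for x s
  define Q where "Q x = integral {0..1} (K x)" for x
  have r_pos: "0 < r (x, s)" if "x \<noteq> 0" "0 \<le> s" "s \<le> 1" for x s
  proof (cases "s = 1")
    case False
    then have "0 < 1 - s" "0 \<le> s * norm x" using that by auto
    then show ?thesis by (simp add: r_def)
  qed (use that in \<open>simp add: r_def\<close>)
  have "continuous_on UNIV r" unfolding r_def by (intro continuous_intros)
  then have "open {p. 0 < r p}" by (intro open_Collect_less continuous_on_const)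
  moreover have "open {p :: (real^'n) \<times> real. fst p \<noteq> 0}"
    by (intro open_Collect_neq continuous_intros)
  ultimately have op: "open \<Omega>" unfolding \<Omega>_def by (intro open_Int)
  have sub: "(- {0}) \<times> {0..1} \<subseteq> \<Omega>"
  proof
    fix p :: "(real^'n) \<times> real" assume "p \<in> (- {0}) \<times> {0..1}"
    then show "p \<in> \<Omega>" using r_pos[of "fst p" "snd p"] by (auto simp: \<Omega>_def)
  qed
  have P_nz: "P p \<noteq> 0" if "p \<in> \<Omega>" for p using that by (auto simp: P_def \<Omega>_def)
  have ck_norm: "Ck_on k \<Omega> (\<lambda>p. norm (fst p))" for k
    by (rule Ck_on_compose[OF Ck_on_norm Ck_on_bounded_linear[OF bounded_linear_fst]]) (auto simp: \<Omega>_def)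
  have ck_inv: "Ck_on k \<Omega> (\<lambda>p. inverse (norm (fst p)))" for k
    by (rule Ck_on_compose[OF Ck_on_inverse ck_norm]) (auto simp: \<Omega>_def)
  have ck_snd: "Ck_on k \<Omega> snd" for k by (rule Ck_on_bounded_linear[OF bounded_linear_snd])
  have ck_r: "Ck_on k \<Omega> (\<lambda>p. 1 + (- 1 * snd p + snd p * norm (fst p)))" for k
    by (rule Ck_on_add[OF Ck_on_const Ck_on_add[OF Ck_on_mult[OF Ck_on_const ck_snd] Ck_on_mult[OF ck_snd ck_norm]]])
  have ck_r: "Ck_on k \<Omega> r" for k
    by (rule Ck_on_cong[OF op _ ck_r]) (simp add: r_def)
  have ck_P: "Ck_on k \<Omega> P" for k
    unfolding P_def
    by (rule Ck_on_scaleR[OF Ck_on_mult[OF ck_r ck_inv] Ck_on_bounded_linear[OF bounded_linear_fst]])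
  have ck_coord: "Ck_on k \<Omega> (\<lambda>p. fst p $ i)" for k i
    by (rule Ck_on_bounded_linear[OF bounded_linear_compose[OF bounded_linear_vec_nth bounded_linear_fst]])
  have ck_K: "Ck_on k \<Omega> (\<lambda>p. K (fst p) (snd p))" for k
    unfolding K_def prod.collapse
  proof (rule Ck_on_sum)
    fix i
    have "Ck_on k \<Omega> (\<lambda>p. partial_deriv i g (P p))"
      by (rule Ck_on_compose[OF smooth_on_imp_Ck_on[OF smooth_on_partial_deriv[OF g]] ck_P]) (use P_nz in auto)
    then show "Ck_on k \<Omega> (\<lambda>p. (inverse (norm (fst p)) * fst p $ i) *\<^sub>R partial_deriv i g (P p))"
      by (rule Ck_on_scaleR[OF Ck_on_mult[OF ck_inv ck_coord]])
  qed
  have sQ: "smooth_on (- {0}) Q"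
    unfolding smooth_on_iff_Ck_on Q_def
    using Ck_on_parametric_integral[OF open_punctured ck_K op sub] open_punctured by blast
  have K_int: "K x integrable_on {0..1}" if "x \<noteq> 0" for x
  proof -
    have "continuous_on {0..1} (\<lambda>s. (x, s))" by (intro continuous_intros)
    moreover have "(\<lambda>s. (x, s)) ` {0..1} \<subseteq> \<Omega>" using sub that by auto
    ultimately have "continuous_on {0..1} (\<lambda>s. K (fst (x, s)) (snd (x, s)))"
      by (rule continuous_on_compose2[OF Ck_on_continuous[OF ck_K]])
    then show ?thesis by (intro integrable_continuous_real) simp
  qed
  have div: "g x = complex_of_real (norm x - 1) * Q x" if x: "x \<noteq> 0" for x
  proof -
    have "((\<lambda>s. complex_of_real (norm x - 1) * K x s) has_integral g (P (x, 1)) - g (P (x, 0))) {0..1}"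
    proof (rule fundamental_theorem_of_calculus)
      fix s :: real assume s: "s \<in> {0..1}"
      have "((\<lambda>s. P (x, s)) has_derivative (\<lambda>h. (h * (norm x - 1) * inverse (norm x)) *\<^sub>R x)) (at s)"
        unfolding P_def r_def by (auto intro!: derivative_eq_intros simp: algebra_simps)
      from has_derivative_compose[OF this smooth_on_has_derivative[OF g]]
      have "((\<lambda>s. g (P (x, s))) has_derivative (\<lambda>h. \<Sum>i\<in>UNIV. (((h * (norm x - 1) * inverse (norm x)) *\<^sub>R x) $ i) *\<^sub>R
          partial_deriv i g (P (x, s)))) (at s)"
        using P_nz[OF subsetD[OF sub, of "(x, s)"]] x s by simp
      moreover have "(\<lambda>h. \<Sum>i\<in>UNIV. (((h * (norm x - 1) * inverse (norm x)) *\<^sub>R x) $ i) *\<^sub>R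
          partial_deriv i g (P (x, s))) = (\<lambda>h. h *\<^sub>R (complex_of_real (norm x - 1) * K x s))"
        unfolding vector_scaleR_component real_scaleR_def K_def
        by (rule ext) (simp add: scaleR_conv_of_real sum_distrib_left mult_ac)
      ultimately show "((\<lambda>s. g (P (x, s))) has_vector_derivative complex_of_real (norm x - 1) * K x s) (at s within {0..1})"
        unfolding has_vector_derivative_def by (simp only: has_derivative_at_withinI)
    qed simp
    moreover have "P (x, 1) = x" using x by (simp add: P_def r_def)
    moreover have "g (P (x, 0)) = 0" by (rule zero) (use x in \<open>simp add: P_def r_def\<close>)
    ultimately have "((\<lambda>s. complex_of_real (norm x - 1) * K x s) has_integral g x) {0..1}" by simp
    moreover have "((\<lambda>s. complex_of_real (norm x - 1) * K x s) has_integral complex_of_real (norm x - 1) * Q x) {0..1}"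
      unfolding Q_def by (rule has_integral_mult_right[OF integrable_integral[OF K_int[OF x]]])
    ultimately show ?thesis by (rule has_integral_unique)
  qed
  have "Q x = (\<Sum>i\<in>UNIV. (x $ i) *\<^sub>R partial_deriv i g x)" if "norm x = 1" for x
  proof -
    have "K x = (\<lambda>s. \<Sum>i\<in>UNIV. (x $ i) *\<^sub>R partial_deriv i g x)"
      by (rule ext) (simp add: K_def P_def r_def that)
    then show ?thesis by (simp add: Q_def)
  qed
  with sQ div show ?thesis by blast
qed

section \<open>Restriction of ambient smooth functions to the sphere\<close>

section \<open>Smooth functions and distributions on the sphere\<close>

lemma Ck_on_normalize: "Ck_on k (- {0}) (\<lambda>y::'a::euclidean_space. y /\<^sub>R norm y)"
  by (rule Ck_on_scaleR[OF Ck_on_compose[OF Ck_on_inverse Ck_on_norm] Ck_on_id]) auto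

lemma smooth_on_normalize:
  assumes "smooth_on UNIV \<theta>"
  shows "smooth_on (- {0}) (\<lambda>y. \<theta> (y /\<^sub>R norm y))"
  unfolding smooth_on_iff_Ck_on
proof (intro conjI allI)
  fix k
  show "Ck_on k (- {0}) (\<lambda>y. \<theta> (y /\<^sub>R norm y))"
    by (rule Ck_on_compose[OF smooth_on_imp_Ck_on[OF assms] Ck_on_normalize]) simp
qed (rule open_punctured)

lemma smooth_on_normalize_coord: "smooth_on (- {0}) (\<lambda>y. complex_of_real ((y /\<^sub>R norm y) $ k))"
  by (rule smooth_on_normalize[OF smooth_on_coord]) simp

lemma partial_deriv_normalize:
  fixes g :: "real^'n::finite \<Rightarrow> complex"
  assumes "smooth_on UNIV g" "y \<noteq> 0"
  shows "partial_deriv i (\<lambda>y. g (y /\<^sub>R norm y)) y =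
    (\<Sum>k\<in>UNIV. partial_deriv i (\<lambda>y. complex_of_real ((y /\<^sub>R norm y) $ k)) y * partial_deriv k g (y /\<^sub>R norm y))"
proof -
  have "\<exists>D. ((\<lambda>y::real^'n. y /\<^sub>R norm y) has_derivative D) (at y)"
    using Ck_on_normalize[of "Suc 0", where ?'a="real^'n"] assms(2) unfolding Ck_on.simps by auto
  then obtain D where D: "((\<lambda>y::real^'n. y /\<^sub>R norm y) has_derivative D) (at y)" by blast
  have "((\<lambda>y. g (y /\<^sub>R norm y)) has_derivative (\<lambda>v. \<Sum>k\<in>UNIV. (D v $ k) *\<^sub>R partial_deriv k g (y /\<^sub>R norm y))) (at y)"
    by (rule has_derivative_compose[OF D smooth_on_has_derivative[OF assms(1)]]) simp
  note 1 = partial_deriv_eqI[OF this]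
  have "((\<lambda>y. complex_of_real ((y /\<^sub>R norm y) $ k)) has_derivative (\<lambda>v. complex_of_real (D v $ k))) (at y)" for k
    by (rule bounded_linear.has_derivative[OF bounded_linear_compose[OF bounded_linear_of_real bounded_linear_vec_nth] D])
  note 2 = partial_deriv_eqI[OF this]
  show ?thesis unfolding 1 2 by (simp add: scaleR_conv_of_real)
qed

lemma partial_deriv_mult:
  assumes "f differentiable (at x)" "g differentiable (at x)"
  shows "partial_deriv i (\<lambda>x. f x * g x) x = partial_deriv i f x * g x + f x * partial_deriv i g x"
proof -
  have "(f has_derivative frechet_derivative f (at x)) (at x)" "(g has_derivative frechet_derivative g (at x)) (at x)"
    using assms frechet_derivative_works by blast+
  from has_derivative_mult[OF this] show ?thesis
    by (simp add: partial_deriv_eqI) (simp add: partial_deriv_def)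
qed

text \<open>The differential operators that arise when the derivatives of a function are evaluated along the
  retraction onto the sphere; this is the shape of every derivative of a homogeneous extension.\<close>

inductive sphere_operator :: "((real^'n::finite \<Rightarrow> complex) \<Rightarrow> real^'n \<Rightarrow> complex) \<Rightarrow> bool" where
  sphere_operator_zero: "sphere_operator (\<lambda>\<theta> y. 0)"
| sphere_operator_add: "sphere_operator L \<Longrightarrow> sphere_operator M \<Longrightarrow> sphere_operator (\<lambda>\<theta> y. L \<theta> y + M \<theta> y)"
| sphere_operator_atom: "smooth_on (- {0}) a \<Longrightarrow>
    sphere_operator (\<lambda>\<theta> y. a y * partial_derivs js \<theta> (y /\<^sub>R norm y))"

lemma sphere_operator_sum:
  "(\<And>i. i \<in> I \<Longrightarrow> sphere_operator (L i)) \<Longrightarrow> sphere_operator (\<lambda>\<theta> y. \<Sum>i\<in>I. L i \<theta> y)"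
proof (induction I rule: infinite_finite_induct)
  case (insert i F)
  show ?case unfolding sum.insert[OF insert(1,2)]
    by (rule sphere_operator_add) (use insert in auto)
qed (simp_all add: sphere_operator_zero)

lemma sphere_operator_partial_deriv:
  fixes L :: "(real^'n::finite \<Rightarrow> complex) \<Rightarrow> real^'n \<Rightarrow> complex"
  assumes "sphere_operator L"
  shows "\<exists>M. sphere_operator M \<and> (\<forall>\<theta> y. smooth_on UNIV \<theta> \<longrightarrow> y \<noteq> 0 \<longrightarrow>
     L \<theta> differentiable (at y) \<and> partial_deriv i (L \<theta>) y = M \<theta> y)"
  using assms
proof induction
  case sphere_operator_zero
  have "partial_deriv i (\<lambda>y. 0) = (\<lambda>y::real^'n. 0)"
    using partial_derivs_const[of "[i]" 0] by simp
  then show ?case by (intro exI[of _ "\<lambda>\<theta> y. 0"]) (simp add: sphere_operator.intros)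
next
  case (sphere_operator_add L M)
  then obtain L' M' where *: "sphere_operator L'" "sphere_operator M'"
    "\<And>\<theta> y. smooth_on UNIV \<theta> \<Longrightarrow> y \<noteq> 0 \<Longrightarrow> L \<theta> differentiable (at y) \<and> partial_deriv i (L \<theta>) y = L' \<theta> y"
    "\<And>\<theta> y. smooth_on UNIV \<theta> \<Longrightarrow> y \<noteq> 0 \<Longrightarrow> M \<theta> differentiable (at y) \<and> partial_deriv i (M \<theta>) y = M' \<theta> y"
    by blast
  show ?case
  proof (intro exI conjI allI impI)
    show "sphere_operator (\<lambda>\<theta> y. L' \<theta> y + M' \<theta> y)" by (rule sphere_operator.sphere_operator_add[OF *(1,2)])
    fix \<theta> :: "real^'n \<Rightarrow> complex" and y :: "real^'n" assume a: "smooth_on UNIV \<theta>" "y \<noteq> 0"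
    show "(\<lambda>y. L \<theta> y + M \<theta> y) differentiable (at y)"
      using *(3,4)[OF a] by (intro differentiable_add) auto
    show "partial_deriv i (\<lambda>y. L \<theta> y + M \<theta> y) y = L' \<theta> y + M' \<theta> y"
      using *(3,4)[OF a] by (simp add: partial_deriv_add)
  qed
next
  case (sphere_operator_atom a js)
  let ?n = "\<lambda>k y::real^'n. complex_of_real ((y /\<^sub>R norm y) $ k)"
  let ?M = "\<lambda>\<theta> y. partial_deriv i a y * partial_derivs js \<theta> (y /\<^sub>R norm y)
    + (\<Sum>k\<in>UNIV. (a y * partial_deriv i (?n k) y) * partial_derivs (k # js) \<theta> (y /\<^sub>R norm y))"
  show ?case
  proof (intro exI conjI allI impI)
    show "sphere_operator ?M"
      by (intro sphere_operator.sphere_operator_add sphere_operator_sum sphere_operator.sphere_operator_atom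
          smooth_on_mult smooth_on_partial_deriv smooth_on_normalize_coord sphere_operator_atom)
    fix \<theta> :: "real^'n \<Rightarrow> complex" and y :: "real^'n" assume a: "smooth_on UNIV \<theta>" "y \<noteq> 0"
    note s = smooth_on_partial_derivs[OF a(1), of js]
    have da: "a differentiable (at y)" using sphere_operator_atom a(2) smooth_on_differentiable by blast
    have dt: "(\<lambda>y. partial_derivs js \<theta> (y /\<^sub>R norm y)) differentiable (at y)"
      using smooth_on_normalize[OF s] a(2) smooth_on_differentiable by blast
    show "(\<lambda>y. a y * partial_derivs js \<theta> (y /\<^sub>R norm y)) differentiable (at y)"
      using da dt by (rule differentiable_mult)
    show "partial_deriv i (\<lambda>y. a y * partial_derivs js \<theta> (y /\<^sub>R norm y)) y = ?M \<theta> y"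
      unfolding partial_deriv_mult[OF da dt] partial_deriv_normalize[OF s a(2)]
      by (simp add: sum_distrib_left mult.assoc)
  qed
qed

text \<open>By the chain rule, a derivative of \<theta>(y/|y|) combines derivatives of \<theta> at
  y/|y| with coefficients smooth off the origin. \<open>L\<close> is chosen before \<theta>, so
  bounding its coefficients on the sphere gives an estimate uniform in \<theta>.\<close>

lemma partial_derivs_normalize:
  fixes "is" :: "'n::finite list"
  shows "\<exists>L. sphere_operator L \<and> (\<forall>\<theta> y. smooth_on UNIV \<theta> \<longrightarrow> y \<noteq> 0 \<longrightarrow>
    partial_derivs is (\<lambda>y. \<theta> (y /\<^sub>R norm y)) y = L \<theta> y)"
proof (induction "is")
  case Nil
  have "sphere_operator (\<lambda>\<theta> y::real^'n. 1 * partial_derivs [] \<theta> (y /\<^sub>R norm y))"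
    by (rule sphere_operator_atom[OF smooth_on_const[OF open_punctured]])
  then show ?case by (intro exI conjI) auto
next
  case (Cons i "is")
  then obtain L :: "(real^'n \<Rightarrow> complex) \<Rightarrow> real^'n \<Rightarrow> complex" where L: "sphere_operator L"
    "\<And>\<theta> y. smooth_on UNIV \<theta> \<Longrightarrow> y \<noteq> 0 \<Longrightarrow> partial_derivs is (\<lambda>y. \<theta> (y /\<^sub>R norm y)) y = L \<theta> y" by blast
  obtain M where M: "sphere_operator M"
    "\<And>\<theta> y. smooth_on UNIV \<theta> \<Longrightarrow> y \<noteq> 0 \<Longrightarrow> partial_deriv i (L \<theta>) y = M \<theta> y"
    using sphere_operator_partial_deriv[OF L(1)] by blast
  have "partial_derivs (i # is) (\<lambda>y. \<theta> (y /\<^sub>R norm y)) y = M \<theta> y"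
    if "smooth_on UNIV \<theta>" "y \<noteq> 0" for \<theta> and y :: "real^'n"
  proof -
    have "partial_derivs [i] (partial_derivs is (\<lambda>y. \<theta> (y /\<^sub>R norm y))) y = partial_derivs [i] (L \<theta>) y"
      by (rule partial_derivs_cong_open[OF open_punctured]) (use L(2) that in auto)
    then show ?thesis using M(2)[OF that] by simp
  qed
  with M(1) show ?case by blast
qed

text \<open>Differentiates the ambient function itself, normal directions included, whereas
  \<open>sphere_seminorm\<close> differentiates the homogeneous extension. For plane waves and
  Fourier transforms these derivatives are explicit.\<close>

definition sphere_sup :: "'n::finite list \<Rightarrow> (real^'n \<Rightarrow> complex) \<Rightarrow> real" where
  "sphere_sup js \<theta> = (SUP y\<in>sphere 0 1. norm (partial_derivs js \<theta> y))"

lemma sphere_nonempty: "sphere (0::real^'n::finite) 1 \<noteq> {}"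
  by simp

lemma sphere_sup_upper:
  assumes "smooth_on UNIV \<theta>" "norm y = 1"
  shows "norm (partial_derivs js \<theta> y) \<le> sphere_sup js \<theta>"
  unfolding sphere_sup_def
proof (rule cSUP_upper)
  obtain C where "\<forall>x\<in>sphere 0 1. norm (partial_derivs js \<theta> x) \<le> C"
    using smooth_bounded_on_compact[OF assms(1), of "sphere 0 1" js] by auto
  then show "bdd_above ((\<lambda>y. norm (partial_derivs js \<theta> y)) ` sphere 0 1)" by (intro bdd_aboveI2[of _ _ C]) blast
qed (use assms in simp)

lemma sphere_sup_least:
  "(\<And>y. norm y = 1 \<Longrightarrow> norm (partial_derivs js \<theta> y) \<le> C) \<Longrightarrow> sphere_sup js \<theta> \<le> C"
  unfolding sphere_sup_def by (rule cSUP_least[OF sphere_nonempty]) simp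

lemma sphere_sup_nonneg: "smooth_on UNIV \<theta> \<Longrightarrow> 0 \<le> sphere_sup js \<theta>" for \<theta> :: "real^'n::finite \<Rightarrow> complex"
proof -
  assume s: "smooth_on UNIV \<theta>"
  obtain y :: "real^'n" where "y \<in> sphere 0 1" using sphere_nonempty by blast
  then show ?thesis using order_trans[OF norm_ge_zero sphere_sup_upper[OF s, of y js]] by simp
qed

abbreviation smooth_dominated :: "((real^'n::finite \<Rightarrow> complex) \<Rightarrow> real) \<Rightarrow> bool" where
  "smooth_dominated \<equiv> dominated {\<theta>. smooth_on UNIV \<theta>} (range sphere_sup)"

lemma sphere_sup_nonneg': "\<forall>p\<in>range sphere_sup. \<forall>\<theta>\<in>{\<theta>. smooth_on UNIV \<theta>}. 0 \<le> p \<theta>"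
  using sphere_sup_nonneg by auto

lemma sphere_operator_bound:
  fixes L :: "(real^'n::finite \<Rightarrow> complex) \<Rightarrow> real^'n \<Rightarrow> complex"
  assumes "sphere_operator L"
  shows "\<exists>q. smooth_dominated q \<and> (\<forall>\<theta> y. smooth_on UNIV \<theta> \<longrightarrow> norm y = 1 \<longrightarrow> norm (L \<theta> y) \<le> q \<theta>)"
  using assms
proof induction
  case sphere_operator_zero
  show ?case by (intro exI[of _ "\<lambda>_. 0"]) (simp add: dominated_zero)
next
  case (sphere_operator_add L M)
  then obtain q r where *: "smooth_dominated q" "smooth_dominated r"
    "\<And>\<theta> y. smooth_on UNIV \<theta> \<Longrightarrow> norm y = 1 \<Longrightarrow> norm (L \<theta> y) \<le> q \<theta>"
    "\<And>\<theta> y. smooth_on UNIV \<theta> \<Longrightarrow> norm y = 1 \<Longrightarrow> norm (M \<theta> y) \<le> r \<theta>" by blast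
  have "smooth_dominated (\<lambda>\<theta>. q \<theta> + r \<theta>)" by (rule dominated_add[OF sphere_sup_nonneg' *(1,2)])
  moreover have "norm (L \<theta> y + M \<theta> y) \<le> q \<theta> + r \<theta>" if "smooth_on UNIV \<theta>" "norm y = 1" for \<theta> y
    using norm_triangle_ineq[of "L \<theta> y" "M \<theta> y"] *(3,4)[OF that] by linarith
  ultimately show ?case by blast
next
  case (sphere_operator_atom a js)
  have "sphere (0::real^'n) 1 \<subseteq> - {0}" by auto
  from smooth_bounded_on_compact[OF sphere_operator_atom compact_sphere this, of "[]"]
  obtain C where C: "0 \<le> C" "\<And>y. norm y = 1 \<Longrightarrow> norm (a y) \<le> C" by auto
  have "smooth_dominated (\<lambda>\<theta>. C * sphere_sup js \<theta>)"
    by (rule dominated_cmult[OF dominated_member C(1)]) simp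
  moreover have "norm (a y * partial_derivs js \<theta> (y /\<^sub>R norm y)) \<le> C * sphere_sup js \<theta>"
    if "smooth_on UNIV \<theta>" "norm y = 1" for \<theta> y
    unfolding norm_mult using that C by (intro mult_mono sphere_sup_upper) auto
  ultimately show ?case by blast
qed

lemma homogeneous_extension_restrict:
  "y \<noteq> 0 \<Longrightarrow> homogeneous_extension (restrict \<theta> (sphere 0 1)) y = \<theta> (y /\<^sub>R norm y)"
  by (simp add: homogeneous_extension_def)

lemma restrict_sphere_mem:
  assumes "smooth_on UNIV \<theta>"
  shows "restrict \<theta> (sphere 0 1) \<in> sphere_functions"
  using smooth_on_cong[OF smooth_on_normalize[OF assms], of "homogeneous_extension (restrict \<theta> (sphere 0 1))"]
  by (simp add: sphere_functions_def homogeneous_extension_restrict)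

lemma sphere_functions_smooth: "\<psi> \<in> sphere_functions \<Longrightarrow> smooth_on (- {0}) (homogeneous_extension \<psi>)"
  by (simp add: sphere_functions_def)

lemma sphere_seminorm_upper:
  assumes "\<psi> \<in> sphere_functions" "norm y = 1"
  shows "norm (partial_derivs is (homogeneous_extension \<psi>) y) \<le> sphere_seminorm is \<psi>"
  unfolding sphere_seminorm_def
proof (rule cSUP_upper)
  have "sphere (0::real^'a) 1 \<subseteq> - {0}" by auto
  from smooth_bounded_on_compact[OF sphere_functions_smooth[OF assms(1)] compact_sphere this, of "is"]
  obtain C where "\<forall>x\<in>sphere 0 1. norm (partial_derivs is (homogeneous_extension \<psi>) x) \<le> C" by auto
  then show "bdd_above ((\<lambda>y. norm (partial_derivs is (homogeneous_extension \<psi>) y)) ` sphere 0 1)"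
    by (intro bdd_aboveI2[of _ _ C]) blast
qed (use assms in simp)

lemma sphere_seminorm_least:
  "(\<And>y. norm y = 1 \<Longrightarrow> norm (partial_derivs is (homogeneous_extension \<psi>) y) \<le> C) \<Longrightarrow> sphere_seminorm is \<psi> \<le> C"
  unfolding sphere_seminorm_def by (rule cSUP_least[OF sphere_nonempty]) simp

lemma homogeneous_extension_add:
  "y \<noteq> 0 \<Longrightarrow> homogeneous_extension (\<lambda>x\<in>sphere 0 1. \<phi> x + \<psi> x) y
    = homogeneous_extension \<phi> y + homogeneous_extension \<psi> y"
  by (simp add: homogeneous_extension_def)

lemma homogeneous_extension_cmult:
  "y \<noteq> 0 \<Longrightarrow> homogeneous_extension (\<lambda>x\<in>sphere 0 1. c * \<psi> x) y = c * homogeneous_extension \<psi> y"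
  by (simp add: homogeneous_extension_def)

lemma sphere_functions_add:
  assumes "\<phi> \<in> sphere_functions" "\<psi> \<in> sphere_functions"
  shows "(\<lambda>x\<in>sphere 0 1. \<phi> x + \<psi> x) \<in> sphere_functions"
    and "sphere_seminorm is (\<lambda>x\<in>sphere 0 1. \<phi> x + \<psi> x) \<le> sphere_seminorm is \<phi> + sphere_seminorm is \<psi>"
proof -
  note s = sphere_functions_smooth[OF assms(1)] sphere_functions_smooth[OF assms(2)]
  show "(\<lambda>x\<in>sphere 0 1. \<phi> x + \<psi> x) \<in> sphere_functions"
    using smooth_on_cong[OF smooth_on_add[OF s], of "homogeneous_extension (\<lambda>x\<in>sphere 0 1. \<phi> x + \<psi> x)"]
    by (simp add: sphere_functions_def homogeneous_extension_add)
  show "sphere_seminorm is (\<lambda>x\<in>sphere 0 1. \<phi> x + \<psi> x) \<le> sphere_seminorm is \<phi> + sphere_seminorm is \<psi>"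
  proof (rule sphere_seminorm_least)
    fix y :: "real^'a" assume y: "norm y = 1"
    then have y0: "y \<in> - {0}" by auto
    have "partial_derivs is (homogeneous_extension (\<lambda>x\<in>sphere 0 1. \<phi> x + \<psi> x)) y
      = partial_derivs is (\<lambda>y. homogeneous_extension \<phi> y + homogeneous_extension \<psi> y) y"
      by (rule partial_derivs_cong_open[OF open_punctured _ y0]) (simp add: homogeneous_extension_add)
    also have "\<dots> = partial_derivs is (homogeneous_extension \<phi>) y + partial_derivs is (homogeneous_extension \<psi>) y"
      by (rule partial_derivs_add[OF s y0])
    finally show "norm (partial_derivs is (homogeneous_extension (\<lambda>x\<in>sphere 0 1. \<phi> x + \<psi> x)) y)
        \<le> sphere_seminorm is \<phi> + sphere_seminorm is \<psi>"
      using sphere_seminorm_upper[OF assms(1) y, of "is"] sphere_seminorm_upper[OF assms(2) y, of "is"]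
      by (metis add_mono norm_triangle_ineq order_trans)
  qed
qed

lemma sphere_functions_cmult:
  assumes "\<psi> \<in> sphere_functions"
  shows "(\<lambda>x\<in>sphere 0 1. c * \<psi> x) \<in> sphere_functions"
    and "sphere_seminorm is (\<lambda>x\<in>sphere 0 1. c * \<psi> x) = norm c * sphere_seminorm is \<psi>"
proof -
  note s = sphere_functions_smooth[OF assms]
  show "(\<lambda>x\<in>sphere 0 1. c * \<psi> x) \<in> sphere_functions"
    using smooth_on_cong[OF smooth_on_cmult[OF s], of c "homogeneous_extension (\<lambda>x\<in>sphere 0 1. c * \<psi> x)"]
    by (simp add: sphere_functions_def homogeneous_extension_cmult)
  have eq: "norm (partial_derivs is (homogeneous_extension (\<lambda>x\<in>sphere 0 1. c * \<psi> x)) y)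
      = norm c * norm (partial_derivs is (homogeneous_extension \<psi>) y)" if y: "norm y = 1" for y :: "real^'a"
  proof -
    have y0: "y \<in> - {0}" using y by auto
    have "partial_derivs is (homogeneous_extension (\<lambda>x\<in>sphere 0 1. c * \<psi> x)) y
      = partial_derivs is (\<lambda>y. c * homogeneous_extension \<psi> y) y"
      by (rule partial_derivs_cong_open[OF open_punctured _ y0]) (simp add: homogeneous_extension_cmult)
    then show ?thesis by (simp add: partial_derivs_cmult[OF s y0] norm_mult)
  qed
  show "sphere_seminorm is (\<lambda>x\<in>sphere 0 1. c * \<psi> x) = norm c * sphere_seminorm is \<psi>"
  proof (rule antisym)
    show "sphere_seminorm is (\<lambda>x\<in>sphere 0 1. c * \<psi> x) \<le> norm c * sphere_seminorm is \<psi>"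
      by (rule sphere_seminorm_least) (simp add: eq mult_left_mono sphere_seminorm_upper[OF assms])
    show "norm c * sphere_seminorm is \<psi> \<le> sphere_seminorm is (\<lambda>x\<in>sphere 0 1. c * \<psi> x)"
    proof (cases "c = 0")
      case True
      obtain y :: "real^'a" where "y \<in> sphere 0 1" using sphere_nonempty by blast
      then show ?thesis
        using order_trans[OF norm_ge_zero sphere_seminorm_upper[OF \<open>(\<lambda>x\<in>sphere 0 1. c * \<psi> x) \<in> sphere_functions\<close>, of y "is"]]
        by (simp add: True)
    next
      case False
      have "sphere_seminorm is \<psi> \<le> sphere_seminorm is (\<lambda>x\<in>sphere 0 1. c * \<psi> x) / norm c"
      proof (rule sphere_seminorm_least)
        fix y :: "real^'a" assume y: "norm y = 1"
        show "norm (partial_derivs is (homogeneous_extension \<psi>) y) \<le> sphere_seminorm is (\<lambda>x\<in>sphere 0 1. c * \<psi> x) / norm c"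
          using sphere_seminorm_upper[OF \<open>(\<lambda>x\<in>sphere 0 1. c * \<psi> x) \<in> sphere_functions\<close> y, of "is"] False
          unfolding eq[OF y] by (simp add: pos_le_divide_eq mult.commute)
      qed
      then show ?thesis using False by (simp add: pos_le_divide_eq mult.commute)
    qed
  qed
qed

interpretation sphere: seminorm_space "sphere 0 1" sphere_functions "range sphere_seminorm"
proof
  show "(sphere_functions :: (real^'a \<Rightarrow> complex) set) \<noteq> {}"
    using restrict_sphere_mem[OF smooth_on_const[OF open_UNIV]] by blast
qed (auto simp: sphere_functions_add sphere_functions_cmult, auto simp: sphere_functions_def)

lemma sphere_distributions_iff:
  "T \<in> sphere_distributions \<longleftrightarrow>
     T \<in> extensional sphere_functions \<and>
     (\<forall>\<phi>\<in>sphere_functions. \<forall>\<psi>\<in>sphere_functions. T (\<lambda>x\<in>sphere 0 1. \<phi> x + \<psi> x) = T \<phi> + T \<psi>) \<and>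
     (\<forall>c. \<forall>\<phi>\<in>sphere_functions. T (\<lambda>x\<in>sphere 0 1. c * \<phi> x) = c * T \<phi>) \<and>
     dominated sphere_functions (range sphere_seminorm) (\<lambda>\<phi>. norm (T \<phi>))"
  unfolding sphere_distributions_def sphere.topological_dual_iff ..

lemma sphere_seminorm_restrict_dominated:
  fixes "is" :: "'n::finite list"
  shows "smooth_dominated (\<lambda>\<theta>. sphere_seminorm is (restrict \<theta> (sphere 0 1)))"
proof -
  obtain L where L: "sphere_operator L"
    "\<And>\<theta> y. smooth_on UNIV \<theta> \<Longrightarrow> y \<noteq> 0 \<Longrightarrow> partial_derivs is (\<lambda>y. \<theta> (y /\<^sub>R norm y)) y = L \<theta> y"
    using partial_derivs_normalize by blast
  obtain q where q: "smooth_dominated q"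
    "\<And>\<theta> y. smooth_on UNIV \<theta> \<Longrightarrow> norm y = 1 \<Longrightarrow> norm (L \<theta> y) \<le> q \<theta>"
    using sphere_operator_bound[OF L(1)] by blast
  show ?thesis
  proof (rule dominated_mono[OF q(1)])
    fix \<theta> :: "real^'n \<Rightarrow> complex" assume "\<theta> \<in> {\<theta>. smooth_on UNIV \<theta>}"
    then have \<theta>: "smooth_on UNIV \<theta>" by simp
    show "sphere_seminorm is (restrict \<theta> (sphere 0 1)) \<le> q \<theta>"
    proof (rule sphere_seminorm_least)
      fix y :: "real^'n" assume y: "norm y = 1"
      then have y0: "y \<in> - {0}" by auto
      have "partial_derivs is (homogeneous_extension (restrict \<theta> (sphere 0 1))) y
          = partial_derivs is (\<lambda>y. \<theta> (y /\<^sub>R norm y)) y"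
        by (rule partial_derivs_cong_open[OF open_punctured _ y0]) (simp add: homogeneous_extension_restrict)
      also have "\<dots> = L \<theta> y" using L(2)[OF \<theta>] y0 by simp
      finally show "norm (partial_derivs is (homogeneous_extension (restrict \<theta> (sphere 0 1))) y) \<le> q \<theta>"
        using q(2)[OF \<theta> y] by simp
    qed
  qed
qed

text \<open>The form in which continuity of \<open>T\<close> is used below: on restrictions,
  \<open>T\<close> is controlled by finitely many ambient derivatives on the sphere.\<close>

lemma sphere_distribution_smooth_dominated:
  assumes "T \<in> sphere_distributions"
  shows "smooth_dominated (\<lambda>\<theta>. norm (T (restrict \<theta> (sphere 0 1))))"
  by (rule dominated_compose[where A="\<lambda>\<theta>. restrict \<theta> (sphere 0 1)" and q="\<lambda>\<phi>. norm (T \<phi>)"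
        and V'=sphere_functions and P'="range sphere_seminorm", OF sphere_sup_nonneg'])
    (use assms restrict_sphere_mem sphere_seminorm_restrict_dominated in
      \<open>auto simp: sphere_distributions_iff\<close>)

section \<open>Moving a sphere distribution under the Fourier integral\<close>

section \<open>The Fourier transform of a distribution on the sphere\<close>

lemma norm_plane_wave_diff: "norm (plane_wave x y - plane_wave z y) \<le> norm (x - z) * norm y"
proof -
  have "plane_wave x y - plane_wave z y = plane_wave z y * (plane_wave (x - z) y - 1)"
    by (simp add: plane_wave_def inner_diff_left right_diff_distrib flip: exp_add)
  then have "norm (plane_wave x y - plane_wave z y) = norm (plane_wave (x - z) y - 1)"
    by (simp add: norm_mult)
  also have "\<dots> \<le> \<bar>- ((x - z) \<bullet> y)\<bar>"
    using iexp_approx1[of "- ((x - z) \<bullet> y)" 0] by (simp add: plane_wave_def)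
  also have "\<dots> \<le> norm (x - z) * norm y" using Cauchy_Schwarz_ineq2[of "x - z" y] by simp
  finally show ?thesis .
qed

lemma norm_frequency_monomial_le: "norm (frequency_monomial js x) \<le> (1 + norm x) ^ length js"
proof (induction js)
  case (Cons j js)
  have "\<bar>x $ j\<bar> \<le> 1 + norm x" using component_le_norm_cart[of x j] by linarith
  with Cons have "\<bar>x $ j\<bar> * norm (frequency_monomial js x) \<le> (1 + norm x) * (1 + norm x) ^ length js"
    by (intro mult_mono) auto
  then show ?case by (simp add: norm_mult)
qed simp

lemma continuous_on_frequency_monomial: "continuous_on A (frequency_monomial js)"
  using smooth_on_continuous[OF slowly_increasing_smooth[OF slowly_increasing_frequency_monomial]]
    continuous_on_subset by blast

text \<open>A modulus of continuity for the map from x to the plane wave e_x: it bounds the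
  difference of the derivatives \<open>js\<close> of e_x and e_z on the whole unit sphere.\<close>

definition wave_modulus :: "'n::finite list \<Rightarrow> real^'n \<Rightarrow> real^'n \<Rightarrow> real" where
  "wave_modulus js x z = norm (frequency_monomial js x - frequency_monomial js z)
     + norm (frequency_monomial js z) * norm (x - z)"

lemma norm_frequency_wave_diff:
  assumes "norm y = 1"
  shows "norm (frequency_monomial js x * plane_wave x y - frequency_monomial js z * plane_wave z y)
    \<le> wave_modulus js x z"
proof -
  have "frequency_monomial js x * plane_wave x y - frequency_monomial js z * plane_wave z y
      = (frequency_monomial js x - frequency_monomial js z) * plane_wave x y
        + frequency_monomial js z * (plane_wave x y - plane_wave z y)" by (simp add: algebra_simps)
  also have "norm \<dots> \<le> norm ((frequency_monomial js x - frequency_monomial js z) * plane_wave x y)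
        + norm (frequency_monomial js z * (plane_wave x y - plane_wave z y))" by (rule norm_triangle_ineq)
  also have "\<dots> \<le> wave_modulus js x z"
    unfolding wave_modulus_def norm_mult plane_wave_norm mult_1_right
    using norm_plane_wave_diff[of x y z] assms by (intro add_left_mono mult_left_mono) auto
  finally show ?thesis .
qed

lemma wave_modulus_tendsto:
  assumes "(f \<longlongrightarrow> x) F"
  shows "((\<lambda>i. wave_modulus js x (f i)) \<longlongrightarrow> 0) F"
proof -
  have m: "((\<lambda>i. frequency_monomial js (f i)) \<longlongrightarrow> frequency_monomial js x) F"
    by (rule continuous_on_tendsto_compose[OF continuous_on_frequency_monomial[of UNIV] assms]) auto
  have "((\<lambda>i. norm (frequency_monomial js x - frequency_monomial js (f i))
     + norm (frequency_monomial js (f i)) * norm (x - f i)) \<longlongrightarrow>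
      norm (frequency_monomial js x - frequency_monomial js x) + norm (frequency_monomial js x) * norm (x - x)) F"
    by (rule tendsto_add[OF tendsto_norm[OF tendsto_diff[OF tendsto_const m]]
          tendsto_mult[OF tendsto_norm[OF m] tendsto_norm[OF tendsto_diff[OF tendsto_const assms]]]])
  then show ?thesis by (simp add: wave_modulus_def)
qed

text \<open>Supplies the dominating function. The factor 2 is the one by which the approximating
  simple functions may exceed the identity in norm.\<close>

lemma wave_modulus_le:
  assumes "norm z \<le> 2 * norm x"
  shows "wave_modulus js x z \<le> 3 * (3 * (1 + norm x)) ^ Suc (length js)"
proof -
  let ?l = "length js" and ?R = "3 * (1 + norm x)"
  have "1 + norm z \<le> 1 + 2 * norm x" using assms by simp
  also have "\<dots> \<le> ?R" by simp
  finally have R: "1 + norm x \<le> ?R" "1 + norm z \<le> ?R" "1 \<le> ?R" by simp_all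
  have mx: "norm (frequency_monomial js x) \<le> ?R ^ ?l"
    by (rule order_trans[OF norm_frequency_monomial_le power_mono[OF R(1)]]) simp
  have mz: "norm (frequency_monomial js z) \<le> ?R ^ ?l"
    by (rule order_trans[OF norm_frequency_monomial_le power_mono[OF R(2)]]) simp
  have le: "?R ^ ?l \<le> ?R ^ Suc ?l" using R(3) by (intro power_increasing) auto
  have "norm (x - z) \<le> norm x + norm z" by (rule norm_triangle_ineq4)
  also have "\<dots> \<le> 3 * norm x" using assms by simp
  also have "\<dots> \<le> ?R" by simp
  finally have "norm (x - z) \<le> ?R" .
  then have "norm (frequency_monomial js z) * norm (x - z) \<le> ?R ^ ?l * ?R"
    using mz by (intro mult_mono) auto
  moreover have "norm (frequency_monomial js x - frequency_monomial js z) \<le> ?R ^ ?l + ?R ^ ?l"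
    using norm_triangle_ineq4[of "frequency_monomial js x" "frequency_monomial js z"] mx mz by linarith
  ultimately have "wave_modulus js x z \<le> (?R ^ ?l + ?R ^ ?l) + ?R ^ ?l * ?R"
    unfolding wave_modulus_def by (rule add_mono[rotated])
  also have "?R ^ ?l * ?R = ?R ^ Suc ?l" by simp
  finally show ?thesis using le by linarith
qed

text \<open>For simple \<open>G\<close> the integral is a finite sum over the values of
  \<open>G\<close>, on which \<open>T\<close> acts by linearity alone.\<close>

lemma simple_function_integral_sum:
  fixes \<phi> h :: "'a::euclidean_space \<Rightarrow> complex"
  assumes \<phi>: "integrable lborel \<phi>" and G: "simple_function lborel (G :: 'a \<Rightarrow> 'a)"
  shows "integrable lborel (\<lambda>x. h (G x) * \<phi> x)"
    and "(LINT x|lborel. h (G x) * \<phi> x)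
      = (\<Sum>z\<in>range G. (LINT x|lborel. indicator (G -` {z}) x *\<^sub>R \<phi> x) * h z)"
proof -
  have fin: "finite (range G)" using simple_functionD(1)[OF G] by simp
  have i: "integrable lborel (\<lambda>x. indicator (G -` {z}) x *\<^sub>R \<phi> x)" for z
    by (rule integrable_mult_indicator[OF _ \<phi>]) (use simple_functionD(2)[OF G, of "{z}"] in simp)
  have e: "h (G x) * \<phi> x = (\<Sum>z\<in>range G. (indicator (G -` {z}) x *\<^sub>R \<phi> x) * h z)" for x
  proof -
    have "(\<Sum>z\<in>range G. (indicator (G -` {z}) x *\<^sub>R \<phi> x) * h z) = (\<Sum>z\<in>range G. if z = G x then \<phi> x * h z else 0)"
      by (intro sum.cong) (auto simp: indicator_def)
    then show ?thesis using fin by (simp add: mult.commute)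
  qed
  show "integrable lborel (\<lambda>x. h (G x) * \<phi> x)"
    unfolding e by (intro Bochner_Integration.integrable_sum integrable_mult_left i)
  show "(LINT x|lborel. h (G x) * \<phi> x)
      = (\<Sum>z\<in>range G. (LINT x|lborel. indicator (G -` {z}) x *\<^sub>R \<phi> x) * h z)"
    unfolding e Bochner_Integration.integral_sum[OF integrable_mult_left[OF i]] integral_mult_left_zero ..
qed

text \<open>Exchanging \<open>T\<close> with the integral that defines the Fourier transform: both sides are limits of
  Riemann-type sums, obtained by replacing \<open>x\<close> in the plane wave by a simple function \<open>G\<^sub>i x \<longlonglongrightarrow> x\<close>,
  for which the exchange is linearity.\<close>

theorem sphere_distribution_fourier:
  fixes \<phi> :: "real^'n::finite \<Rightarrow> complex"
  assumes T: "T \<in> sphere_distributions" and \<phi>: "\<phi> \<in> schwartz_space"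
  shows "integrable lborel (\<lambda>x. T (restrict (plane_wave x) (sphere 0 1)) * \<phi> x)"
    and "T (restrict (fourier \<phi>) (sphere 0 1)) = (LINT x|lborel. T (restrict (plane_wave x) (sphere 0 1)) * \<phi> x)"
proof -
  define L where "L \<theta> = T (restrict \<theta> (sphere 0 1))" for \<theta>
  have L_add: "L (\<lambda>y. f y + g y) = L f + L g" if "smooth_on UNIV f" "smooth_on UNIV g" for f g
  proof -
    have "restrict (\<lambda>y. f y + g y) (sphere 0 1) = (\<lambda>y\<in>sphere 0 1. restrict f (sphere 0 1) y + restrict g (sphere 0 1) y)"
      by (rule restrict_ext) simp
    then show ?thesis using T restrict_sphere_mem[OF that(1)] restrict_sphere_mem[OF that(2)]
      by (simp only: L_def sphere_distributions_iff)
  qed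
  have L_cmult: "L (\<lambda>y. c * f y) = c * L f" if "smooth_on UNIV f" for c f
  proof -
    have "restrict (\<lambda>y. c * f y) (sphere 0 1) = (\<lambda>y\<in>sphere 0 1. c * restrict f (sphere 0 1) y)"
      by (rule restrict_ext) simp
    then show ?thesis using T restrict_sphere_mem[OF that] by (simp only: L_def sphere_distributions_iff)
  qed
  have L_diff: "L (\<lambda>y. f y - g y) = L f - L g" if "smooth_on UNIV f" "smooth_on UNIV g" for f g
    using L_add[OF that(1) smooth_on_cmult[OF that(2), of "-1"]] L_cmult[OF that(2), of "-1"] by simp
  have L_sum: "L (\<lambda>y. \<Sum>z\<in>Z. c z * f z y) = (\<Sum>z\<in>Z. c z * L (f z))"
    if "finite Z" "\<And>z. smooth_on UNIV (f z)" for Z :: "(real^'n) set" and c f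
    using that(1)
  proof induction
    case empty
    show ?case using L_cmult[OF smooth_on_const[OF open_UNIV], of 0 0] by simp
  next
    case (insert z Z)
    have s: "smooth_on UNIV (\<lambda>y. c w * f w y)" for w by (rule smooth_on_cmult[OF that(2)])
    have "L (\<lambda>y. c z * f z y + (\<Sum>w\<in>Z. c w * f w y)) = L (\<lambda>y. c z * f z y) + L (\<lambda>y. \<Sum>w\<in>Z. c w * f w y)"
      by (rule L_add[OF s smooth_on_sum[OF open_UNIV s]])
    then show ?case unfolding sum.insert[OF insert(1,2)] L_cmult[OF that(2)] insert(3) .
  qed
  obtain F C where F: "finite F" "0 \<le> C"
    and FC: "\<And>\<theta>. smooth_on UNIV \<theta> \<Longrightarrow> norm (L \<theta>) \<le> C * (\<Sum>p\<in>F. p \<theta>)"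
    and Fr: "F \<subseteq> range sphere_sup"
    using sphere_distribution_smooth_dominated[OF T] unfolding dominated_def L_def by auto
  obtain J where J: "finite J" "F = sphere_sup ` J" using finite_subset_image[OF F(1) Fr] by blast
  \<comment> \<open>Continuity of \<open>T\<close> made concrete: pointwise bounds on the sphere for
    the finitely many derivatives in \<open>J\<close> bound \<open>L\<close>.\<close>
  have LJ: "norm (L \<theta>) \<le> C * (\<Sum>js\<in>J. B js)"
    if \<theta>: "smooth_on UNIV \<theta>" and B: "\<And>js y. norm y = 1 \<Longrightarrow> norm (partial_derivs js \<theta> y) \<le> B js" for \<theta> B
  proof -
    have "(\<Sum>p\<in>F. p \<theta>) \<le> (\<Sum>js\<in>J. sphere_sup js \<theta>)"
      unfolding J(2) using sum_image_le[OF J(1), of "\<lambda>p. p \<theta>" sphere_sup] sphere_sup_nonneg[OF \<theta>] by (simp add: o_def)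
    also have "\<dots> \<le> (\<Sum>js\<in>J. B js)" by (intro sum_mono sphere_sup_least B)
    finally show ?thesis using FC[OF \<theta>] F(2) by (meson mult_left_mono order_trans)
  qed
  define E where "E x = L (plane_wave x)" for x
  define N where "N = (\<Sum>js\<in>J. length js)"
  define B where "B = C * card J"
  have B: "0 \<le> B" using F(2) by (simp add: B_def)
  have E_bound: "norm (E x) \<le> B * (1 + norm x) ^ N" for x
  proof -
    have "norm (E x) \<le> C * (\<Sum>js\<in>J. (1 + norm x) ^ length js)"
      unfolding E_def by (rule LJ[OF smooth_on_plane_wave])
        (simp add: partial_derivs_plane_wave norm_mult norm_frequency_monomial_le)
    also have "\<dots> \<le> C * (\<Sum>js\<in>J. (1 + norm x) ^ N)"
    proof (intro mult_left_mono sum_mono power_increasing F(2))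
      show "length js \<le> N" if "js \<in> J" for js
        unfolding N_def using member_le_sum[OF that, of length] J(1) by simp
    qed simp
    finally show ?thesis by (simp add: B_def)
  qed
  have E_diff: "norm (E x - E z) \<le> C * (\<Sum>js\<in>J. wave_modulus js x z)" for x z
  proof -
    have "E x - E z = L (\<lambda>y. plane_wave x y - plane_wave z y)"
      unfolding E_def by (rule L_diff[OF smooth_on_plane_wave smooth_on_plane_wave, symmetric])
    also have "norm \<dots> \<le> C * (\<Sum>js\<in>J. wave_modulus js x z)"
      by (rule LJ[OF smooth_on_diff[OF smooth_on_plane_wave smooth_on_plane_wave]])
        (simp add: partial_derivs_diff[OF smooth_on_plane_wave smooth_on_plane_wave] partial_derivs_plane_wave norm_frequency_wave_diff)
    finally show ?thesis .
  qed
  have E_tendsto: "((\<lambda>i. E (f i)) \<longlongrightarrow> E x) K" if "(f \<longlongrightarrow> x) K" for f :: "'i \<Rightarrow> real^'n" and x K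
  proof -
    have "((\<lambda>i. C * (\<Sum>js\<in>J. wave_modulus js x (f i))) \<longlongrightarrow> C * (\<Sum>js\<in>J. 0)) K"
      by (rule tendsto_mult[OF tendsto_const tendsto_sum[OF wave_modulus_tendsto[OF that]]])
    then have "((\<lambda>i. C * (\<Sum>js\<in>J. wave_modulus js x (f i))) \<longlongrightarrow> 0) K" by simp
    then have "((\<lambda>i. E x - E (f i)) \<longlongrightarrow> 0) K"
      by (rule Lim_null_comparison[rotated]) (simp add: E_diff)
    from tendsto_diff[OF tendsto_const[of "E x"] this] show ?thesis by simp
  qed
  have E_cont: "continuous_on UNIV E"
    unfolding continuous_on_def using E_tendsto[OF tendsto_ident_at] by blast
  have E_meas: "E \<in> borel_measurable borel" by (rule borel_measurable_continuous_onI[OF E_cont])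
  have int: "integrable lborel (\<lambda>x. E x * \<phi> x)"
    by (rule schwartz_integrable_bounded_mult[OF \<phi> E_meas E_bound])
  then show "integrable lborel (\<lambda>x. T (restrict (plane_wave x) (sphere 0 1)) * \<phi> x)"
    by (simp add: E_def L_def)
  \<comment> \<open>Simple functions that converge to the identity of the space; they discretise the
    integration variable.\<close>
  obtain G where G: "\<And>i. simple_function lborel (G i)" "\<And>x. (\<lambda>i. G i x) \<longlonglongrightarrow> x"
    "\<And>i x. norm (G i x) \<le> 2 * norm (x::real^'n)"
  proof -
    have "(\<lambda>x::real^'n. x) \<in> borel_measurable lborel" by simp
    from borel_measurable_implies_sequence_metric[OF this, of 0]
    show ?thesis using that by (auto simp: dist_norm)
  qed
  have G_meas: "G i \<in> borel_measurable lborel" for i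
    by (rule borel_measurable_simple_function[OF G(1)])
  note \<phi>i = schwartz_integrable[OF \<phi>]
  define c where "c i z = (LINT x|lborel. indicator (G i -` {z}) x *\<^sub>R \<phi> x)" for i z
  \<comment> \<open>The Riemann-type sum for \<open>fourier \<phi>\<close>: a finite combination of
    plane waves, weighted by the integrals of \<open>\<phi>\<close> over the level sets of
    \<open>G i\<close>.\<close>
  define \<Theta> where "\<Theta> i y = (\<Sum>z\<in>range (G i). c i z * plane_wave z y)" for i y
  have fin: "finite (range (G i))" for i using simple_functionD(1)[OF G(1)[of i]] by simp
  have sm: "smooth_on UNIV (\<Theta> i)" for i
    unfolding \<Theta>_def by (intro smooth_on_sum open_UNIV smooth_on_cmult smooth_on_plane_wave)
  have L\<Theta>: "L (\<Theta> i) = (LINT x|lborel. E (G i x) * \<phi> x)" for i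
  proof -
    have "L (\<Theta> i) = (\<Sum>z\<in>range (G i). c i z * E z)"
      unfolding \<Theta>_def L_sum[OF fin smooth_on_plane_wave] E_def ..
    then show ?thesis unfolding simple_function_integral_sum(2)[OF \<phi>i G(1), of E i] c_def .
  qed
  have d\<Theta>: "partial_derivs js (\<Theta> i) y = (LINT x|lborel. (frequency_monomial js (G i x) * plane_wave (G i x) y) * \<phi> x)" for js i y
  proof -
    have "partial_derivs js (\<Theta> i) y = (\<Sum>z\<in>range (G i). c i z * (frequency_monomial js z * plane_wave z y))"
      unfolding \<Theta>_def
      by (subst partial_derivs_sum[where W=UNIV])
         (auto intro: smooth_on_cmult smooth_on_plane_wave
           simp: partial_derivs_cmult[OF smooth_on_plane_wave] partial_derivs_plane_wave)
    then show ?thesis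
      unfolding c_def using simple_function_integral_sum(2)[OF \<phi>i G(1), of "\<lambda>z. frequency_monomial js z * plane_wave z y" i] by simp
  qed
  \<comment> \<open>Bounds the derivative \<open>js\<close> of
    \<open>fourier \<phi> - \<Theta> i\<close> on the sphere; \<open>M\<close> dominates the
    integrands, so it tends to 0 as \<open>G i x\<close> tends to \<open>x\<close>.\<close>
  define \<delta> where "\<delta> i js = (LINT x|lborel. wave_modulus js x (G i x) * norm (\<phi> x))" for i js
  define M where "M js x = (3 * 3 ^ Suc (length js)) * (1 + norm x) ^ Suc (length js)" for js :: "'n list" and x :: "real^'n"
  have wM: "wave_modulus js x (G i x) \<le> M js x" for js i x
    unfolding M_def using wave_modulus_le[OF G(3)[of i x], of js] by (simp only: power_mult_distrib mult.assoc)
  have w0: "0 \<le> wave_modulus js x z" for js and x z :: "real^'n" by (simp add: wave_modulus_def)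
  have M_int: "integrable lborel (\<lambda>x. M js x * norm (\<phi> x))" for js
  proof -
    have absM: "\<bar>M js x\<bar> = M js x" for x by (rule abs_of_nonneg) (simp add: M_def)
    have "integrable lborel (\<lambda>x. complex_of_real (M js x) * \<phi> x)"
    proof (rule schwartz_integrable_bounded_mult[OF \<phi>])
      show "(\<lambda>x. complex_of_real (M js x)) \<in> borel_measurable borel" unfolding M_def by measurable
      show "norm (complex_of_real (M js x)) \<le> (3 * 3 ^ Suc (length js)) * (1 + norm x) ^ Suc (length js)" for x
        unfolding norm_of_real absM unfolding M_def ..
    qed
    from integrable_norm[OF this] show ?thesis unfolding norm_mult norm_of_real absM .
  qed
  have \<phi>m: "\<phi> \<in> borel_measurable lborel" using schwartz_measurable[OF \<phi>] by simp
  have mm: "frequency_monomial js \<in> borel_measurable borel" for js :: "'n list"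
    by (rule borel_measurable_continuous_onI[OF continuous_on_frequency_monomial])
  have wm: "(\<lambda>x. wave_modulus js x (G i x) * norm (\<phi> x)) \<in> borel_measurable lborel" for js i
    unfolding wave_modulus_def
    using mm[of js] G_meas[of i] \<phi>m measurable_compose[OF G_meas[of i] mm[of js]] by (intro borel_measurable_times
        borel_measurable_add borel_measurable_norm borel_measurable_diff) auto
  have w_int: "integrable lborel (\<lambda>x. wave_modulus js x (G i x) * norm (\<phi> x))" for js i
    by (rule Bochner_Integration.integrable_bound[OF M_int[of js] wm])
      (rule AE_I2, use w0 wM in \<open>auto simp: abs_mult M_def intro!: mult_right_mono\<close>)
  have \<delta>: "(\<lambda>i. \<delta> i js) \<longlonglongrightarrow> 0" for js
  proof -
    have "(\<lambda>i. \<delta> i js) \<longlonglongrightarrow> (LINT x::real^'n|lborel. (0::real))"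
      unfolding \<delta>_def
    proof (rule integral_dominated_convergence[where w="\<lambda>x. M js x * norm (\<phi> x)"])
      show "AE x in lborel. (\<lambda>i. wave_modulus js x (G i x) * norm (\<phi> x)) \<longlonglongrightarrow> 0"
        by (rule AE_I2) (rule tendsto_mult_left_zero[OF wave_modulus_tendsto[OF G(2)]])
      show "AE x in lborel. norm (wave_modulus js x (G i x) * norm (\<phi> x)) \<le> M js x * norm (\<phi> x)" for i
        by (rule AE_I2) (use w0 wM in \<open>auto simp: abs_mult intro!: mult_right_mono\<close>)
    qed (use wm M_int in auto)
    then show ?thesis by simp
  qed
  have dist: "norm (L (fourier \<phi>) - L (\<Theta> i)) \<le> C * (\<Sum>js\<in>J. \<delta> i js)" for i
  proof -
    have "norm (partial_derivs js (\<lambda>y. fourier \<phi> y - \<Theta> i y) y) \<le> \<delta> i js" if y: "norm y = 1" for js y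
    proof -
      have i1: "integrable lborel (\<lambda>x. (frequency_monomial js x * plane_wave x y) * \<phi> x)"
        using schwartz_integrable_plane_wave[OF schwartz_frequency_monomial[OF \<phi>], of y js] by (simp add: mult_ac)
      have i2: "integrable lborel (\<lambda>x. (frequency_monomial js (G i x) * plane_wave (G i x) y) * \<phi> x)"
        by (rule simple_function_integral_sum(1)[OF \<phi>i G(1), of "\<lambda>z. frequency_monomial js z * plane_wave z y"])
      have "partial_derivs js (\<lambda>y. fourier \<phi> y - \<Theta> i y) y = partial_derivs js (fourier \<phi>) y - partial_derivs js (\<Theta> i) y"
        by (rule partial_derivs_diff[OF smooth_on_fourier[OF \<phi>] sm]) simp
      also have "partial_derivs js (fourier \<phi>) y = (LINT x|lborel. (frequency_monomial js x * plane_wave x y) * \<phi> x)"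
        unfolding partial_derivs_fourier[OF \<phi>] fourier_eq by (simp add: mult_ac)
      also have "\<dots> - partial_derivs js (\<Theta> i) y = (LINT x|lborel. (frequency_monomial js x * plane_wave x y) * \<phi> x
          - (frequency_monomial js (G i x) * plane_wave (G i x) y) * \<phi> x)"
        unfolding d\<Theta> by (rule Bochner_Integration.integral_diff[OF i1 i2, symmetric])
      also have "norm \<dots> \<le> \<delta> i js"
        unfolding \<delta>_def
      proof (rule order_trans[OF integral_norm_bound integral_mono[OF integrable_norm[OF Bochner_Integration.integrable_diff[OF i1 i2]] w_int]])
        fix x
        show "norm ((frequency_monomial js x * plane_wave x y) * \<phi> x
          - (frequency_monomial js (G i x) * plane_wave (G i x) y) * \<phi> x) \<le> wave_modulus js x (G i x) * norm (\<phi> x)"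
          unfolding left_diff_distrib[symmetric] norm_mult[of _ "\<phi> x"]
          by (rule mult_right_mono[OF norm_frequency_wave_diff[OF y]]) simp
      qed
      finally show ?thesis .
    qed
    from LJ[OF smooth_on_diff[OF smooth_on_fourier[OF \<phi>] sm] this]
    show ?thesis unfolding L_diff[OF smooth_on_fourier[OF \<phi>] sm] .
  qed
  have "(\<lambda>i. C * (\<Sum>js\<in>J. \<delta> i js)) \<longlonglongrightarrow> C * (\<Sum>js\<in>J. 0)"
    by (rule tendsto_mult[OF tendsto_const tendsto_sum[OF \<delta>]])
  then have "(\<lambda>i. C * (\<Sum>js\<in>J. \<delta> i js)) \<longlonglongrightarrow> 0" by simp
  then have "(\<lambda>i. L (fourier \<phi>) - L (\<Theta> i)) \<longlonglongrightarrow> 0"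
    by (rule Lim_null_comparison[rotated]) (simp add: dist)
  from tendsto_diff[OF tendsto_const[of "L (fourier \<phi>)"] this]
  have "(\<lambda>i. L (\<Theta> i)) \<longlonglongrightarrow> L (fourier \<phi>)" by simp
  \<comment> \<open>The second limit of the same sums: \<open>E\<close> is continuous with
    polynomial growth, so dominated convergence applies to the values
    \<open>E (G i x)\<close>.\<close>
  moreover have "(\<lambda>i. L (\<Theta> i)) \<longlonglongrightarrow> (LINT x|lborel. E x * \<phi> x)"
    unfolding L\<Theta>
  proof (rule integral_dominated_convergence)
    show "(\<lambda>x. E x * \<phi> x) \<in> borel_measurable lborel" using E_meas \<phi>m by (intro borel_measurable_times) auto
    show "(\<lambda>x. E (G i x) * \<phi> x) \<in> borel_measurable lborel" for i
      using measurable_compose[OF G_meas[of i] E_meas] \<phi>m by (intro borel_measurable_times) auto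
    have absB: "\<bar>(B * 2 ^ N) * (1 + norm x) ^ N\<bar> = (B * 2 ^ N) * (1 + norm x) ^ N" for x :: "real^'n"
      by (rule abs_of_nonneg) (simp add: B)
    have "integrable lborel (\<lambda>x. complex_of_real ((B * 2 ^ N) * (1 + norm x) ^ N) * \<phi> x)"
    proof (rule schwartz_integrable_bounded_mult[OF \<phi>])
      show "norm (complex_of_real ((B * 2 ^ N) * (1 + norm x) ^ N)) \<le> (B * 2 ^ N) * (1 + norm x) ^ N" for x :: "real^'n"
        unfolding norm_of_real absB ..
    qed measurable
    from integrable_norm[OF this]
    show "integrable lborel (\<lambda>x. (B * 2 ^ N) * (1 + norm x) ^ N * norm (\<phi> x))"
      unfolding norm_mult norm_of_real absB .
    show "AE x in lborel. (\<lambda>i. E (G i x) * \<phi> x) \<longlonglongrightarrow> E x * \<phi> x"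
      by (rule AE_I2) (rule tendsto_mult[OF E_tendsto[OF G(2)] tendsto_const])
    show "AE x in lborel. norm (E (G i x) * \<phi> x) \<le> (B * 2 ^ N) * (1 + norm x) ^ N * norm (\<phi> x)" for i
    proof (rule AE_I2)
      fix x
      have "(1 + norm (G i x)) ^ N \<le> (2 * (1 + norm x)) ^ N"
        using G(3)[of i x] by (intro power_mono) auto
      then have "norm (E (G i x)) \<le> B * (2 * (1 + norm x)) ^ N"
        using E_bound[of "G i x"] B by (meson mult_left_mono order_trans)
      then have "norm (E (G i x)) \<le> (B * 2 ^ N) * (1 + norm x) ^ N" by (simp only: power_mult_distrib mult.assoc)
      then show "norm (E (G i x) * \<phi> x) \<le> (B * 2 ^ N) * (1 + norm x) ^ N * norm (\<phi> x)"
        unfolding norm_mult by (rule mult_right_mono) simp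
    qed
  qed
  ultimately have "L (fourier \<phi>) = (LINT x|lborel. E x * \<phi> x)" by (rule LIMSEQ_unique)
  then show "T (restrict (fourier \<phi>) (sphere 0 1)) = (LINT x|lborel. T (restrict (plane_wave x) (sphere 0 1)) * \<phi> x)"
    by (simp add: E_def L_def)
qed

section \<open>Cutoffs around the origin and around the unit sphere\<close>

section \<open>Cutoffs\<close>

lemma smooth_on_cutoff:
  fixes q :: "real^'n::finite \<Rightarrow> real"
  assumes "\<And>k. Ck_on k UNIV q"
  shows "smooth_on UNIV (\<lambda>x. complex_of_real (cutoff (q x)))"
  unfolding smooth_on_iff_Ck_on
  by (intro conjI allI Ck_on_of_real Ck_on_compose[OF Ck_on_cutoff assms]) auto

lemma ball_cutoff:
  assumes "0 < r"
  shows "\<exists>\<chi>0 :: real^'n::finite \<Rightarrow> complex. smooth_on UNIV \<chi>0 \<and>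
    (\<forall>x. norm x \<le> r / 2 \<longrightarrow> \<chi>0 x = 1) \<and> (\<forall>x. r \<le> norm x \<longrightarrow> \<chi>0 x = 0)"
proof (intro exI conjI allI impI)
  \<comment> \<open>The argument is at most 1 where |x| <= r/2 and at least 4 where |x| >= r, so it
    lies on the two constant sides of \<open>cutoff\<close>. The squared norm keeps it smooth at the
    origin.\<close>
  let ?q = "\<lambda>x::real^'n. (4 / r\<^sup>2) * (norm x)\<^sup>2"
  show "smooth_on UNIV (\<lambda>x. complex_of_real (cutoff (?q x)))"
    by (rule smooth_on_cutoff[OF Ck_on_mult[OF Ck_on_const Ck_on_norm_sq]])
  have r2: "0 < r\<^sup>2" using assms by simp
  fix x :: "real^'n"
  show "complex_of_real (cutoff (?q x)) = 1" if "norm x \<le> r / 2"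
  proof -
    have "(norm x)\<^sup>2 \<le> (r / 2)\<^sup>2" by (rule power_mono[OF that]) simp
    then have "4 * (norm x)\<^sup>2 \<le> 1 * r\<^sup>2" by (simp only: power_divide) simp
    then have "?q x \<le> 1" using r2 by (simp only: times_divide_eq_left pos_divide_le_eq)
    then show ?thesis by (simp add: cutoff_eq_1)
  qed
  show "complex_of_real (cutoff (?q x)) = 0" if "r \<le> norm x"
  proof -
    have "r\<^sup>2 \<le> (norm x)\<^sup>2" by (rule power_mono[OF that]) (use assms in simp)
    moreover have "0 \<le> (norm x)\<^sup>2" by simp
    ultimately have "2 * r\<^sup>2 \<le> 4 * (norm x)\<^sup>2" by linarith
    then have "2 \<le> ?q x" using r2 by (simp only: times_divide_eq_left pos_le_divide_eq)
    then show ?thesis by (simp add: cutoff_eq_0)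
  qed
qed

text \<open>The argument vanishes on the sphere and reaches 2 as soon as |x|^2 differs from 1 by
  1/2, which covers |x| <= 1/2 and |x| >= 2. Being a polynomial in x, it is smooth
  everywhere.\<close>

definition shell_cutoff :: "real^'n::finite \<Rightarrow> complex" where
  "shell_cutoff x = complex_of_real (cutoff (8 * ((norm x)\<^sup>2 - 1)\<^sup>2))"

lemma smooth_on_shell_cutoff: "smooth_on UNIV shell_cutoff"
proof -
  have "Ck_on k UNIV (\<lambda>x::real^'n. 8 * (((norm x)\<^sup>2 + (- 1)) * ((norm x)\<^sup>2 + (- 1))))" for k
    by (rule Ck_on_mult[OF Ck_on_const Ck_on_mult[OF Ck_on_add[OF Ck_on_norm_sq Ck_on_const]
          Ck_on_add[OF Ck_on_norm_sq Ck_on_const]]])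
  from smooth_on_cutoff[OF this] show ?thesis
    by (simp add: shell_cutoff_def[abs_def] power2_eq_square)
qed

lemma shell_cutoff_sphere: "norm x = 1 \<Longrightarrow> shell_cutoff x = 1"
  by (simp add: shell_cutoff_def cutoff_eq_1)

lemma shell_cutoff_eq_0:
  assumes "norm x \<le> 1 / 2 \<or> 2 \<le> norm x"
  shows "shell_cutoff x = 0"
proof -
  have "1 / 2 \<le> \<bar>(norm x)\<^sup>2 - 1\<bar>"
  proof (cases "2 \<le> norm x")
    case True
    then have "2\<^sup>2 \<le> (norm x)\<^sup>2" by (intro power_mono) auto
    then show ?thesis by simp
  next
    case False
    then have "(norm x)\<^sup>2 \<le> (1 / 2)\<^sup>2" using assms by (intro power_mono) auto
    also have "(1 / 2)\<^sup>2 = (1 / 4 :: real)" by (simp add: power2_eq_square)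
    finally show ?thesis by simp
  qed
  then have "(1 / 2)\<^sup>2 \<le> \<bar>(norm x)\<^sup>2 - 1\<bar>\<^sup>2" by (intro power_mono) auto
  then have "1 / 4 \<le> ((norm x)\<^sup>2 - 1)\<^sup>2" unfolding power2_abs by (simp add: power2_eq_square)
  then show ?thesis by (simp add: shell_cutoff_def cutoff_eq_0)
qed

section \<open>Reduction of the solution space to tempered distributions\<close>

section \<open>The space \<open>\<Z>\<close> and the canonical extension\<close>

lemma partial_derivs_near_zero:
  assumes "0 < r" "\<And>x. norm x < r \<Longrightarrow> \<psi> x = 0" "norm x < r"
  shows "partial_derivs is \<psi> x = 0"
proof -
  have "partial_derivs is \<psi> x = partial_derivs is (\<lambda>x. 0) x"
    by (rule partial_derivs_cong_open[OF open_ball[of 0 r]]) (use assms in simp_all)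
  then show ?thesis by (simp add: partial_derivs_const)
qed

lemma vanishing_near_zero_flat:
  assumes "\<psi> \<in> schwartz_space" "0 < r" "\<And>x. norm x < r \<Longrightarrow> \<psi> x = 0"
  shows "\<psi> \<in> flat_space"
proof -
  have "partial_derivs is \<psi> 0 = 0" for "is"
    by (rule partial_derivs_near_zero[OF assms(2,3)]) (use assms(2) in simp_all)
  with assms(1) show ?thesis by (simp add: flat_space_def)
qed

lemma flat_space_add:
  assumes "\<phi> \<in> flat_space" "\<psi> \<in> flat_space"
  shows "(\<lambda>x. \<phi> x + \<psi> x) \<in> flat_space"
proof -
  note s = schwartz_smooth[OF flat_schwartz[OF assms(1)]] schwartz_smooth[OF flat_schwartz[OF assms(2)]]
  show ?thesis
    using assms schwartz_add(1)[OF flat_schwartz[OF assms(1)] flat_schwartz[OF assms(2)]]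
    unfolding flat_space_def by (simp add: partial_derivs_add[OF s])
qed

lemma flat_space_cmult:
  assumes "\<phi> \<in> flat_space"
  shows "(\<lambda>x. c * \<phi> x) \<in> flat_space"
  using assms schwartz_cmult_mem[OF flat_schwartz[OF assms]]
  unfolding flat_space_def by (simp add: partial_derivs_cmult[OF schwartz_smooth[OF flat_schwartz[OF assms]]])

lemma Z_space_iff: "\<phi> \<in> Z_space \<longleftrightarrow> \<phi> \<in> schwartz_space \<and> fourier \<phi> \<in> flat_space"
  by (auto simp: Z_space_def flat_space_def fourier_schwartz)

lemma Z_space_schwartz: "\<phi> \<in> Z_space \<Longrightarrow> \<phi> \<in> schwartz_space"
  by (simp add: Z_space_iff)

lemma Z_space_add: "\<phi> \<in> Z_space \<Longrightarrow> \<psi> \<in> Z_space \<Longrightarrow> (\<lambda>x. \<phi> x + \<psi> x) \<in> Z_space"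
  by (simp add: Z_space_iff schwartz_add fourier_add flat_space_add)

lemma Z_space_cmult: "\<phi> \<in> Z_space \<Longrightarrow> (\<lambda>x. c * \<phi> x) \<in> Z_space"
  by (simp add: Z_space_iff schwartz_cmult_mem fourier_cmult flat_space_cmult)

lemma inverse_fourier_Z_space: "\<theta> \<in> flat_space \<Longrightarrow> inverse_fourier \<theta> \<in> Z_space"
  by (simp add: Z_space_iff inverse_fourier_schwartz fourier_inverse_fourier flat_schwartz)

lemma bernstein_laplacian_eq:
  "bernstein_laplacian f \<phi> = inverse_fourier (\<lambda>\<xi>. symbol f \<xi> * fourier \<phi> \<xi>)"
  by (simp add: bernstein_laplacian_def symbol_def)

lemma bernstein_laplacian_Z_space:
  assumes "bernstein_function f" "\<phi> \<in> Z_space"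
  shows "bernstein_laplacian f \<phi> \<in> Z_space"
    and "fourier (bernstein_laplacian f \<phi>) = (\<lambda>\<xi>. symbol f \<xi> * fourier \<phi> \<xi>)"
proof -
  have "(\<lambda>\<xi>. symbol f \<xi> * fourier \<phi> \<xi>) \<in> flat_space"
    by (rule flat_mult[OF bernstein_symbol_slowly_increasing[OF assms(1)]])
      (use assms(2) in \<open>simp add: Z_space_iff\<close>)
  then show "bernstein_laplacian f \<phi> \<in> Z_space"
    and "fourier (bernstein_laplacian f \<phi>) = (\<lambda>\<xi>. symbol f \<xi> * fourier \<phi> \<xi>)"
    unfolding bernstein_laplacian_eq
    by (simp_all add: inverse_fourier_Z_space fourier_inverse_fourier flat_schwartz)
qed

text \<open>The form in which the support condition is used: some ball around the origin is such
  that the transform of \<open>U\<close> annihilates every smooth function vanishing outside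
  it.\<close>

lemma zero_notin_support_iff:
  fixes U :: "(real^'n::finite \<Rightarrow> complex) \<Rightarrow> complex"
  shows "0 \<notin> distribution_support (fourier_distribution U) \<longleftrightarrow>
    (\<exists>r>0. \<forall>\<phi>. smooth_on UNIV \<phi> \<longrightarrow> (\<forall>x. r \<le> norm x \<longrightarrow> \<phi> x = 0) \<longrightarrow> U (fourier \<phi>) = 0)"
    (is "_ \<longleftrightarrow> ?R")
proof
  assume "0 \<notin> distribution_support (fourier_distribution U)"
  then obtain W where W: "open W" "0 \<in> W" "\<And>\<phi>. \<phi> \<in> test_functions W \<Longrightarrow> fourier_distribution U \<phi> = 0"
    unfolding distribution_support_def by blast
  obtain r where r: "r > 0" "cball 0 r \<subseteq> W" using W(1,2) open_contains_cball by blast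
  have "U (fourier \<phi>) = 0" if \<phi>: "smooth_on UNIV \<phi>" "\<And>x. r \<le> norm x \<Longrightarrow> \<phi> x = 0" for \<phi>
  proof -
    have S: "\<phi> \<in> schwartz_space" by (rule bounded_support_schwartz[OF \<phi>(1), of r]) (use \<phi>(2) in simp)
    have "{x. \<phi> x \<noteq> 0} \<subseteq> cball 0 r" using \<phi>(2) by force
    then have cl: "closure {x. \<phi> x \<noteq> 0} \<subseteq> cball 0 r" by (rule closure_minimal) simp
    then have "compact (closure {x. \<phi> x \<noteq> 0})"
      using bounded_subset[OF bounded_cball] by (auto simp: compact_eq_bounded_closed)
    then have "\<phi> \<in> test_functions W" using cl r(2) \<phi>(1) by (auto simp: test_functions_def)
    from W(3)[OF this] S show ?thesis by (simp add: fourier_distribution_def)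
  qed
  with r(1) show ?R by blast
next
  assume ?R
  then obtain r where r: "r > 0"
    "\<forall>\<phi>. smooth_on UNIV \<phi> \<longrightarrow> (\<forall>x. r \<le> norm x \<longrightarrow> \<phi> x = 0) \<longrightarrow> U (fourier \<phi>) = 0" by blast
  have "fourier_distribution U \<phi> = 0" if "\<phi> \<in> test_functions (ball 0 r)" for \<phi>
  proof -
    have sm: "smooth_on UNIV \<phi>" using that by (simp add: test_functions_def)
    have "closure {x. \<phi> x \<noteq> 0} \<subseteq> ball 0 r" using that by (simp add: test_functions_def)
    with closure_subset[of "{x. \<phi> x \<noteq> 0}"] have sub: "{x. \<phi> x \<noteq> 0} \<subseteq> ball 0 r"
      by (rule subset_trans)
    have z: "\<phi> x = 0" if "r \<le> norm x" for x
    proof (rule ccontr)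
      assume "\<phi> x \<noteq> 0"
      with sub have "x \<in> ball 0 r" by blast
      with that show False by simp
    qed
    have "\<phi> \<in> schwartz_space" by (rule bounded_support_schwartz[OF sm, of r]) (use z in simp)
    moreover have "U (fourier \<phi>) = 0" using r(2) sm z by simp
    ultimately show ?thesis by (simp add: fourier_distribution_def)
  qed
  then have "ball 0 r \<in> {W. open W \<and> (\<forall>\<phi>\<in>test_functions W. fourier_distribution U \<phi> = 0)}" by simp
  moreover have "0 \<in> ball (0::real^'n) r" using r(1) by simp
  ultimately have "0 \<in> \<Union>{W. open W \<and> (\<forall>\<phi>\<in>test_functions W. fourier_distribution U \<phi> = 0)}"
    by (rule UnionI)
  then show "0 \<notin> distribution_support (fourier_distribution U)"
    unfolding distribution_support_def by simp
qed

lemma tempered_add: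
  "U \<in> tempered_distributions \<Longrightarrow> \<phi> \<in> schwartz_space \<Longrightarrow> \<psi> \<in> schwartz_space \<Longrightarrow>
    U (\<lambda>x. \<phi> x + \<psi> x) = U \<phi> + U \<psi>"
  by (simp add: tempered_distributions_iff)

lemma tempered_cmult:
  "U \<in> tempered_distributions \<Longrightarrow> \<phi> \<in> schwartz_space \<Longrightarrow> U (\<lambda>x. c * \<phi> x) = c * U \<phi>"
  by (simp add: tempered_distributions_iff)

lemma schwartz_mult_bounded_support:
  assumes "smooth_on UNIV g" "\<And>x. R < norm x \<Longrightarrow> g x = 0" "\<phi> \<in> schwartz_space"
  shows "(\<lambda>x. g x * \<phi> x) \<in> schwartz_space"
  by (rule bounded_support_schwartz[OF smooth_on_mult[OF assms(1) schwartz_smooth[OF assms(3)]], of R])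
    (simp add: assms(2))

text \<open>A cutoff argument takes the place of the structure of distributions supported at a
  point. Write \<phi> = F \<psi> and cut \<psi> near the origin: both extensions annihilate the
  transform of the inner part by the support condition, and the transform of the outer part lies in
  \<open>Z_space\<close>, where they agree.\<close>

lemma extension_off_zero_unique:
  fixes U V :: "(real^'n::finite \<Rightarrow> complex) \<Rightarrow> complex"
  assumes U: "extension_off_zero u U" and V: "extension_off_zero u V"
  shows "U = V"
proof -
  have t: "U \<in> tempered_distributions" "V \<in> tempered_distributions"
    and Z: "\<And>\<phi>. \<phi> \<in> Z_space \<Longrightarrow> U \<phi> = V \<phi>"
  proof -
    show "U \<in> tempered_distributions" "V \<in> tempered_distributions"
      using U V by (simp_all add: extension_off_zero_def)
    fix \<phi> :: "real^'n \<Rightarrow> complex" assume "\<phi> \<in> Z_space"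
    moreover have "restrict U Z_space = restrict V Z_space" using U V by (simp add: extension_off_zero_def)
    ultimately show "U \<phi> = V \<phi>" by (metis restrict_apply')
  qed
  obtain r where r: "r > 0"
    "\<forall>\<phi>. smooth_on UNIV \<phi> \<longrightarrow> (\<forall>x. r \<le> norm x \<longrightarrow> \<phi> x = 0) \<longrightarrow> U (fourier \<phi>) = 0"
    using U unfolding extension_off_zero_def zero_notin_support_iff by blast
  obtain s where s: "s > 0"
    "\<forall>\<phi>. smooth_on UNIV \<phi> \<longrightarrow> (\<forall>x. s \<le> norm x \<longrightarrow> \<phi> x = 0) \<longrightarrow> V (fourier \<phi>) = 0"
    using V unfolding extension_off_zero_def zero_notin_support_iff by blast
  define m where "m = min r s"
  have m: "m > 0" using r(1) s(1) by (simp add: m_def)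
  obtain \<chi>0 :: "real^'n \<Rightarrow> complex" where \<chi>0: "smooth_on UNIV \<chi>0"
    "\<And>x. norm x \<le> m / 2 \<Longrightarrow> \<chi>0 x = 1" "\<And>x. m \<le> norm x \<Longrightarrow> \<chi>0 x = 0" using ball_cutoff[OF m] by blast
  have "U \<phi> = V \<phi>" if \<phi>: "\<phi> \<in> schwartz_space" for \<phi>
  proof -
    define \<psi> where "\<psi> = inverse_fourier \<phi>"
    have \<psi>: "\<psi> \<in> schwartz_space" "fourier \<psi> = \<phi>"
      using \<phi> by (simp_all add: \<psi>_def inverse_fourier_schwartz fourier_inverse_fourier)
    \<comment> \<open>\<open>\<alpha>\<close> lives inside the ball on which both transforms vanish.
      \<open>\<beta>\<close> vanishes near the origin, and so does the double transform of
      \<open>\<beta>\<close>, a reflected multiple of it; this puts \<open>fourier \<beta>\<close>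
      in \<open>Z_space\<close>.\<close>
    define \<alpha> where "\<alpha> x = \<chi>0 x * \<psi> x" for x
    define \<beta> where "\<beta> x = \<psi> x - \<alpha> x" for x
    have \<alpha>: "\<alpha> \<in> schwartz_space" "smooth_on UNIV \<alpha>" "\<And>x. m \<le> norm x \<Longrightarrow> \<alpha> x = 0"
      unfolding \<alpha>_def using \<chi>0 \<psi>(1)
      by (auto intro!: schwartz_mult_bounded_support[of \<chi>0 m] smooth_on_mult schwartz_smooth)
    have \<beta>: "\<beta> \<in> schwartz_space" unfolding \<beta>_def by (rule schwartz_diff[OF \<psi>(1) \<alpha>(1)])
    have "fourier \<beta> \<in> Z_space"
      unfolding Z_space_iff
    proof (intro conjI fourier_schwartz \<beta> vanishing_near_zero_flat[of _ "m / 2"])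
      show "fourier (fourier \<beta>) x = 0" if "norm x < m / 2" for x
        unfolding fourier_fourier[OF \<beta>] using that \<chi>0(2)[of "- x"] by (simp add: \<beta>_def \<alpha>_def)
    qed (use m in simp)
    then have b: "U (fourier \<beta>) = V (fourier \<beta>)" by (rule Z)
    have a: "U (fourier \<alpha>) = 0" "V (fourier \<alpha>) = 0"
      using r(2) s(2) \<alpha>(2,3) by (simp_all add: m_def)
    have "\<phi> = (\<lambda>x. fourier \<alpha> x + fourier \<beta> x)"
      unfolding \<psi>(2)[symmetric] fourier_add[OF \<alpha>(1) \<beta>, symmetric] by (simp add: \<beta>_def)
    then show ?thesis
      using a b t by (simp add: tempered_add fourier_schwartz \<alpha>(1) \<beta>)
  qed
  moreover have "U \<in> extensional schwartz_space" "V \<in> extensional schwartz_space"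
    using t by (simp_all add: tempered_distributions_iff)
  ultimately show ?thesis by (intro extensionalityI[of U schwartz_space V]) auto
qed

lemma canonical_extension_eqI: "extension_off_zero u U \<Longrightarrow> canonical_extension u = U"
  unfolding canonical_extension_def using extension_off_zero_unique by (metis the_equality)

lemma tempered_restrict_Z_dual:
  assumes "U \<in> tempered_distributions"
  shows "restrict U Z_space \<in> Z_dual"
  unfolding Z_dual_def topological_dual_def
proof (intro CollectI conjI ballI allI)
  show "restrict U Z_space \<in> extensional Z_space" by simp
  have "continuous_map schwartz_topology euclidean U"
    using assms unfolding tempered_distributions_def topological_dual_def by blast
  then have "continuous_map (subtopology schwartz_topology Z_space) euclidean U"
    by (rule continuous_map_from_subtopology)
  then show "continuous_map (subtopology schwartz_topology Z_space) euclidean (restrict U Z_space)"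
    by (rule continuous_map_eq) simp
qed (use assms in \<open>auto simp: restrict_UNIV Z_space_add Z_space_cmult tempered_add tempered_cmult Z_space_schwartz\<close>)

text \<open>By uniqueness of the extension, the identified solutions are exactly the tempered
  distributions that satisfy the support condition and the equation on \<open>Z_space\<close>;
  functionals on \<open>Z_space\<close> are left behind here.\<close>

lemma canonical_solution_iff:
  assumes f: "bernstein_function f"
  shows "u \<in> canonical_extension ` solution_space f \<longleftrightarrow>
    u \<in> tempered_distributions \<and> 0 \<notin> distribution_support (fourier_distribution u) \<and>
    (\<forall>\<phi>\<in>Z_space. u (bernstein_laplacian f \<phi>) = u (\<lambda>x. complex_of_real (f 1) * \<phi> x))" (is "?L \<longleftrightarrow> ?R")
proof
  assume ?L
  then obtain v where v: "v \<in> solution_space f" "u = canonical_extension v" by blast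
  then obtain U where U: "extension_off_zero v U" unfolding solution_space_def by blast
  have uU: "u = U" using v(2) canonical_extension_eqI[OF U] by simp
  have "v \<phi> = U \<phi>" if "\<phi> \<in> Z_space" for \<phi>
    using U that unfolding extension_off_zero_def by auto
  moreover have "\<forall>\<phi>\<in>Z_space. v (bernstein_laplacian f \<phi>) = v (\<lambda>x. complex_of_real (f 1) * \<phi> x)"
    using v(1) by (simp add: solution_space_def)
  ultimately have "\<forall>\<phi>\<in>Z_space. U (bernstein_laplacian f \<phi>) = U (\<lambda>x. complex_of_real (f 1) * \<phi> x)"
    using bernstein_laplacian_Z_space(1)[OF f] Z_space_cmult by metis
  then show ?R using U uU unfolding extension_off_zero_def by blast
next
  assume R: ?R
  let ?v = "restrict u Z_space"
  have e: "extension_off_zero ?v u" using R by (simp add: extension_off_zero_def)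
  have "?v \<in> solution_space f"
    unfolding solution_space_def
  proof (intro CollectI conjI ballI exI[of _ u] e)
    show "?v \<in> Z_dual" using R tempered_restrict_Z_dual by blast
    show "?v (bernstein_laplacian f \<phi>) = ?v (\<lambda>x. complex_of_real (f 1) * \<phi> x)" if "\<phi> \<in> Z_space" for \<phi>
    proof -
      have "?v (bernstein_laplacian f \<phi>) = u (bernstein_laplacian f \<phi>)"
        by (rule restrict_apply'[OF bernstein_laplacian_Z_space(1)[OF f that]])
      moreover have "?v (\<lambda>x. complex_of_real (f 1) * \<phi> x) = u (\<lambda>x. complex_of_real (f 1) * \<phi> x)"
        by (rule restrict_apply'[OF Z_space_cmult[OF that]])
      ultimately show ?thesis using R that by simp
    qed
  qed
  then show ?L using canonical_extension_eqI[OF e] by force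
qed

section \<open>Every sphere distribution defines a solution\<close>

section \<open>Sphere distributions give solutions\<close>

text \<open>The tempered distribution whose Fourier transform is, up to a constant and a reflection,
  \<open>T\<close> placed on the sphere.\<close>

definition sphere_solution :: "((real^'n::finite \<Rightarrow> complex) \<Rightarrow> complex) \<Rightarrow> (real^'n \<Rightarrow> complex) \<Rightarrow> complex" where
  "sphere_solution T = (\<lambda>\<phi>\<in>schwartz_space. T (restrict (fourier \<phi>) (sphere 0 1)))"

text \<open>The exchange theorem \<open>sphere_distribution_fourier\<close> makes the function of
  the claim and \<open>sphere_solution T\<close> the same distribution, so both directions can work
  with the latter.\<close>

lemma distribution_given_by_iff:
  assumes "T \<in> sphere_distributions"
  shows "distribution_given_by u (\<lambda>x. T (restrict (plane_wave x) (sphere 0 1))) \<longleftrightarrow> u = sphere_solution T"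
proof -
  have "(\<lambda>\<phi>\<in>schwartz_space. LINT x|lborel. T (restrict (plane_wave x) (sphere 0 1)) * \<phi> x) = sphere_solution T"
    unfolding sphere_solution_def
    by (rule restrict_ext) (simp add: sphere_distribution_fourier(2)[OF assms])
  then show ?thesis
    unfolding distribution_given_by_def using sphere_distribution_fourier(1)[OF assms] by auto
qed

text \<open>The ambient derivatives that control \<open>T\<close> are bounded by Schwartz seminorms
  of \<open>fourier \<phi>\<close>, and the Fourier transform is continuous.\<close>

lemma sphere_solution_tempered:
  fixes T :: "(real^'n::finite \<Rightarrow> complex) \<Rightarrow> complex"
  assumes T: "T \<in> sphere_distributions"
  shows "sphere_solution T \<in> tempered_distributions"
  unfolding tempered_distributions_iff
proof (intro conjI ballI allI)
  show "sphere_solution T \<in> extensional schwartz_space" by (simp add: sphere_solution_def)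
  note mem = restrict_sphere_mem[OF smooth_on_fourier]
  fix \<phi> \<psi> :: "real^'n \<Rightarrow> complex" and c
  assume \<phi>: "\<phi> \<in> schwartz_space"
  have "restrict (\<lambda>y. c * fourier \<phi> y) (sphere 0 1) = (\<lambda>y\<in>sphere 0 1. c * restrict (fourier \<phi>) (sphere 0 1) y)"
    by (rule restrict_ext) simp
  then show "sphere_solution T (\<lambda>x. c * \<phi> x) = c * sphere_solution T \<phi>"
    using T mem[OF \<phi>] \<phi> by (simp add: sphere_solution_def schwartz_cmult_mem fourier_cmult sphere_distributions_iff)
  assume \<psi>: "\<psi> \<in> schwartz_space"
  have "restrict (\<lambda>y. fourier \<phi> y + fourier \<psi> y) (sphere 0 1)
      = (\<lambda>y\<in>sphere 0 1. restrict (fourier \<phi>) (sphere 0 1) y + restrict (fourier \<psi>) (sphere 0 1) y)"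
    by (rule restrict_ext) simp
  then show "sphere_solution T (\<lambda>x. \<phi> x + \<psi> x) = sphere_solution T \<phi> + sphere_solution T \<psi>"
    using T mem[OF \<phi>] mem[OF \<psi>] \<phi> \<psi>
    by (simp add: sphere_solution_def schwartz_add fourier_add sphere_distributions_iff)
next
  have "schwartz_dominated (\<lambda>\<phi>. norm (T (restrict (fourier \<phi>) (sphere 0 1))))"
  proof (rule dominated_compose[where A=fourier and q="\<lambda>\<theta>. norm (T (restrict \<theta> (sphere 0 1)))",
        OF schwartz_nonneg _ _ sphere_distribution_smooth_dominated[OF T]])
    show "fourier \<phi> \<in> {\<theta>. smooth_on UNIV \<theta>}" if "\<phi> \<in> schwartz_space" for \<phi> :: "real^'n \<Rightarrow> complex"
      using smooth_on_fourier[OF that] by simp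
    fix p :: "(real^'n \<Rightarrow> complex) \<Rightarrow> real" assume "p \<in> range sphere_sup"
    then obtain js where p: "p = sphere_sup js" by blast
    show "schwartz_dominated (\<lambda>\<phi>. p (fourier \<phi>))"
    proof (rule dominated_mono)
      show "schwartz_dominated (\<lambda>\<phi>::real^'n \<Rightarrow> complex. schwartz_seminorm 0 js (fourier \<phi>))"
        by (rule schwartz_operator_dominated[OF schwartz_operator_fourier schwartz_dominated_seminorm])
      show "p (fourier \<phi>) \<le> schwartz_seminorm 0 js (fourier \<phi>)" if "\<phi> \<in> schwartz_space" for \<phi> :: "real^'n \<Rightarrow> complex"
        unfolding p
        by (rule sphere_sup_least) (use schwartz_seminorm_upper[OF fourier_schwartz[OF that], of _ 0 js] in simp)
    qed
  qed
  then show "schwartz_dominated (\<lambda>\<phi>. norm (sphere_solution T \<phi>))"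
    by (rule dominated_mono) (simp add: sphere_solution_def)
qed

text \<open>For a test function vanishing outside the open unit ball, the double transform is a
  reflected multiple of it and hence zero on the sphere; so the support condition holds with radius
  1. The equation holds because \<open>T\<close> sees only the sphere, where the symbol equals
  f(1).\<close>

lemma sphere_solution_solves:
  fixes T :: "(real^'n::finite \<Rightarrow> complex) \<Rightarrow> complex"
  assumes f: "bernstein_function f" and T: "T \<in> sphere_distributions"
  shows "sphere_solution T \<in> canonical_extension ` solution_space f"
  unfolding canonical_solution_iff[OF f]
proof (intro conjI ballI sphere_solution_tempered[OF T])
  show "0 \<notin> distribution_support (fourier_distribution (sphere_solution T))"
    unfolding zero_notin_support_iff
  proof (intro exI[of _ 1] conjI allI impI)
    fix \<phi> :: "real^'n \<Rightarrow> complex" assume \<phi>: "smooth_on UNIV \<phi>" "\<forall>x. 1 \<le> norm x \<longrightarrow> \<phi> x = 0"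
    have S: "\<phi> \<in> schwartz_space" by (rule bounded_support_schwartz[OF \<phi>(1), of 1]) (use \<phi>(2) in simp)
    have "restrict (fourier (fourier \<phi>)) (sphere 0 1) = (\<lambda>y\<in>sphere 0 1. 0 * restrict (fourier \<phi>) (sphere 0 1) y)"
      by (rule restrict_ext) (simp add: fourier_fourier[OF S] \<phi>(2))
    moreover have "T (\<lambda>y\<in>sphere 0 1. 0 * restrict (fourier \<phi>) (sphere 0 1) y) = 0 * T (restrict (fourier \<phi>) (sphere 0 1))"
      using T restrict_sphere_mem[OF smooth_on_fourier[OF S]] unfolding sphere_distributions_iff by blast
    ultimately show "sphere_solution T (fourier \<phi>) = 0"
      by (simp add: sphere_solution_def fourier_schwartz S)
  qed simp
  fix \<phi> :: "real^'n \<Rightarrow> complex" assume \<phi>: "\<phi> \<in> Z_space"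
  have "restrict (fourier (bernstein_laplacian f \<phi>)) (sphere 0 1)
      = restrict (fourier (\<lambda>x. complex_of_real (f 1) * \<phi> x)) (sphere 0 1)"
    unfolding bernstein_laplacian_Z_space(2)[OF f \<phi>] fourier_cmult
    by (rule restrict_ext) (simp add: symbol_def)
  then show "sphere_solution T (bernstein_laplacian f \<phi>) = sphere_solution T (\<lambda>x. complex_of_real (f 1) * \<phi> x)"
    using Z_space_schwartz[OF bernstein_laplacian_Z_space(1)[OF f \<phi>]] Z_space_schwartz[OF Z_space_cmult[OF \<phi>]]
    by (simp add: sphere_solution_def)
qed

section \<open>Dividing Schwartz functions by the symbol minus f(1)\<close>

section \<open>Division by the symbol\<close>

lemma slowly_increasing_subset:
  assumes "slowly_increasing n W w g" "open V" "V \<subseteq> W"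
  shows "slowly_increasing n V w g"
proof -
  have *: "polybounded V w F" if "polybounded W w F" for F
    using that assms(3) unfolding polybounded_def by (meson subsetD)
  show ?thesis
    using assms(1) * smooth_on_subset[OF slowly_increasing_smooth[OF assms(1)] assms(2,3)]
    by (simp add: slowly_increasing_def)
qed

lemma bernstein_strict_mono:
  assumes "bernstein_function f" "\<not> f constant_on {0<..}" "0 < s" "s < t"
  shows "f s < f t"
proof -
  obtain f' where f': "\<forall>s>0. (f has_real_derivative f' s) (at s) \<and> 0 < f' s"
    using bernstein_increasing[OF assms(1,2)] by blast
  show ?thesis
    by (rule DERIV_pos_imp_increasing[OF assms(4)]) (use f' assms(3) in \<open>meson less_le_trans\<close>)
qed

text \<open>The zero of the symbol minus c = f(1) on the sphere is simple: its derivative in the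
  outward normal direction is 2 f'(1).\<close>

lemma radial_derivative_symbol:
  fixes x :: "real^'n::finite"
  assumes D: "(f has_real_derivative D) (at 1)" and x: "norm x = 1"
    and h: "smooth_on (- {0}) (\<lambda>x::real^'n. symbol f x - c)"
  shows "(\<Sum>i\<in>UNIV. (x $ i) *\<^sub>R partial_deriv i (\<lambda>x. symbol f x - c) x) = complex_of_real (2 * D)"
proof -
  have xx: "x \<bullet> x = 1" using x by (simp add: dot_square_norm)
  have "((\<lambda>x. x \<bullet> x) has_derivative (\<lambda>v. x \<bullet> v + v \<bullet> x)) (at x)"
    by (rule has_derivative_inner[OF has_derivative_ident has_derivative_ident])
  moreover have "(f has_derivative (*) D) (at (x \<bullet> x))" using D by (simp add: xx has_field_derivative_def)
  ultimately have "((\<lambda>x. f (x \<bullet> x)) has_derivative (\<lambda>v. D * (x \<bullet> v + v \<bullet> x))) (at x)"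
    by (rule has_derivative_compose)
  then have "((\<lambda>x. complex_of_real (f (x \<bullet> x))) has_derivative (\<lambda>v. complex_of_real (D * (x \<bullet> v + v \<bullet> x)))) (at x)"
    by (rule bounded_linear.has_derivative[OF bounded_linear_of_real])
  from has_derivative_diff[OF this has_derivative_const[of c]]
  have 1: "((\<lambda>x. symbol f x - c) has_derivative (\<lambda>v. complex_of_real (D * (x \<bullet> v + v \<bullet> x)) - 0)) (at x)"
    by (simp add: symbol_def dot_square_norm)
  have "x \<in> - {0}" using x by auto
  from has_derivative_unique[OF smooth_on_has_derivative[OF h this] 1]
  have "(\<Sum>i\<in>UNIV. (x $ i) *\<^sub>R partial_deriv i (\<lambda>x. symbol f x - c) x) = complex_of_real (D * (x \<bullet> x + x \<bullet> x)) - 0"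
    by (rule fun_cong)
  then show ?thesis by (simp add: xx)
qed

text \<open>Both \<rho> and h = symbol - f(1) vanish on the sphere, so |x| - 1 can be divided out of
  each. The quotient Qh of h has no zero off the origin: away from the sphere by strict monotonicity
  of f, and on it because it equals 2 f'(1). So \<theta> = Q/Qh is smooth off the origin, vanishes
  near the origin together with \<rho>, and far out equals \<rho>/h with h bounded away from zero,
  which gives Schwartz decay.\<close>

lemma symbol_division:
  fixes \<rho> :: "real^'n::finite \<Rightarrow> complex"
  assumes f: "bernstein_function f" and nc: "\<not> f constant_on {0<..}"
    and \<rho>: "\<rho> \<in> schwartz_space" and r: "0 < r" "r \<le> 1"
    and near: "\<And>x. norm x < r \<Longrightarrow> \<rho> x = 0" and sphere: "\<And>x. norm x = 1 \<Longrightarrow> \<rho> x = 0"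
  shows "\<exists>\<theta>\<in>flat_space. \<rho> = (\<lambda>x. (symbol f x - complex_of_real (f 1)) * \<theta> x)"
proof -
  define h where "h x = symbol f x - complex_of_real (f 1)" for x :: "real^'n"
  obtain f' where f': "\<forall>s>0. (f has_real_derivative f' s) (at s) \<and> 0 < f' s"
    using bernstein_increasing[OF f nc] by blast
  have si: "slowly_increasing n (- {0}) punctured_weight h" for n
    by (rule slowly_increasing_cong[OF slowly_increasing_add[OF punctured_weight_ge_1
          bernstein_symbol_slowly_increasing[OF f] slowly_increasing_const[OF open_punctured, of n _ "- complex_of_real (f 1)"]]])
      (simp add: h_def)
  have hs: "smooth_on (- {0}) h" by (rule slowly_increasing_smooth[OF si])
  have h0: "h x = 0" if "norm x = 1" for x using that by (simp add: h_def symbol_def)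
  obtain Qh where Qh: "smooth_on (- {0}) Qh" "\<And>x. x \<noteq> 0 \<Longrightarrow> h x = complex_of_real (norm x - 1) * Qh x"
    "\<And>x. norm x = 1 \<Longrightarrow> Qh x = (\<Sum>i\<in>UNIV. (x $ i) *\<^sub>R partial_deriv i h x)"
    using hadamard_division[OF hs h0] by blast
  have \<rho>s: "smooth_on (- {0}) \<rho>"
    by (rule smooth_on_subset[OF schwartz_smooth[OF \<rho>] open_punctured]) simp
  obtain Q where Q: "smooth_on (- {0}) Q" "\<And>x. x \<noteq> 0 \<Longrightarrow> \<rho> x = complex_of_real (norm x - 1) * Q x"
    using hadamard_division[OF \<rho>s sphere] by blast
  have h_nz: "h x \<noteq> 0" if x: "x \<noteq> 0" "norm x \<noteq> 1" for x
  proof -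
    have pos: "0 < (norm x)\<^sup>2" using x(1) by simp
    have "norm x \<noteq> - 1" using norm_ge_zero[of x] by linarith
    then have "(norm x)\<^sup>2 \<noteq> 1" using x(2) by (simp add: power2_eq_1_iff)
    then consider "(norm x)\<^sup>2 < 1" | "1 < (norm x)\<^sup>2" by linarith
    then have "f ((norm x)\<^sup>2) \<noteq> f 1"
      using bernstein_strict_mono[OF f nc pos, of 1] bernstein_strict_mono[OF f nc, of 1 "(norm x)\<^sup>2"]
      by cases auto
    then show ?thesis by (simp add: h_def symbol_def)
  qed
  have Qh_nz: "Qh x \<noteq> 0" if x: "x \<noteq> 0" for x
  proof (cases "norm x = 1")
    case True
    have D: "(f has_real_derivative f' 1) (at 1)" "0 < f' 1" using f' by simp_all
    have "Qh x = complex_of_real (2 * f' 1)"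
      unfolding Qh(3)[OF True] h_def[abs_def]
      by (rule radial_derivative_symbol[OF D(1) True]) (use hs in \<open>simp add: h_def[abs_def]\<close>)
    with D(2) show ?thesis by simp
  next
    case False
    then show ?thesis using h_nz[OF x] Qh(2)[OF x] by auto
  qed
  \<comment> \<open>The value 0 at the origin agrees with the vanishing of the quotient in the
    punctured ball of radius \<open>r\<close>.\<close>
  define \<theta> where "\<theta> x = (if x = 0 then 0 else Q x * inverse (Qh x))" for x
  have eq: "\<rho> x = h x * \<theta> x" for x
  proof (cases "x = 0")
    case True
    then show ?thesis using near[of 0] r(1) by (simp add: \<theta>_def)
  next
    case False
    then show ?thesis using Qh_nz[OF False] by (simp add: \<theta>_def Q(2)[OF False] Qh(2)[OF False])
  qed
  have \<theta>0: "\<theta> x = 0" if "norm x < r" for x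
  proof (cases "x = 0")
    case False
    have "norm x \<noteq> 1" using that r(2) by simp
    then have "h x \<noteq> 0" by (rule h_nz[OF False])
    then show ?thesis using eq[of x] near[OF that] by simp
  qed (simp add: \<theta>_def)
  have "smooth_on (- {0}) (\<lambda>x. Q x * inverse (Qh x))"
    by (rule smooth_on_mult[OF Q(1) smooth_on_inverse[OF Qh(1)]]) (use Qh_nz in simp)
  then have s0: "smooth_on (- {0}) \<theta>" by (rule smooth_on_cong) (simp add: \<theta>_def)
  have s1: "smooth_on (ball 0 r) \<theta>"
    by (rule smooth_on_cong[OF smooth_on_const[OF open_ball, of 0]]) (use \<theta>0 in simp)
  have s: "smooth_on UNIV \<theta>"
  proof (rule smooth_on_local[OF open_UNIV])
    fix x :: "real^'n"
    show "\<exists>V. x \<in> V \<and> smooth_on V \<theta>"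
    proof (cases "x = 0")
      case True
      then have "x \<in> ball 0 r" using r(1) by simp
      with s1 show ?thesis by (intro exI[of _ "ball 0 r"] conjI)
    next
      case False
      then have "x \<in> - {0}" by simp
      with s0 show ?thesis by (intro exI[of _ "- {0}"] conjI)
    qed
  qed
  have \<rho>f: "\<rho> \<in> flat_space" by (rule vanishing_near_zero_flat[OF \<rho> r(1) near])
  \<comment> \<open>A region away from the sphere on which monotonicity of f gives the lower bound
    f(9/4) - f(1) for h, since 9/4 is the square of 3/2. Together with the compact ball of radius 2
    it covers the space.\<close>
  define W where "W = {x::real^'n. 3 / 2 < norm x}"
  have W: "open W" "W \<subseteq> - {0}"
    unfolding W_def by (auto intro!: open_Collect_less continuous_intros)
  have c: "0 < f (9 / 4) - f 1" using bernstein_strict_mono[OF f nc, of 1 "9 / 4"] by simp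
  have hc: "f (9 / 4) - f 1 \<le> norm (h x)" if "x \<in> W" for x
  proof -
    have "(3 / 2)\<^sup>2 < (norm x)\<^sup>2" using that unfolding W_def by (intro power_strict_mono) auto
    then have "9 / 4 < (norm x)\<^sup>2" by (simp add: power2_eq_square)
    then have "f (9 / 4) < f ((norm x)\<^sup>2)" by (intro bernstein_strict_mono[OF f nc]) auto
    moreover have "norm (h x) = \<bar>f ((norm x)\<^sup>2) - f 1\<bar>"
    proof -
      have "h x = complex_of_real (f ((norm x)\<^sup>2) - f 1)" by (simp add: h_def symbol_def)
      then show ?thesis by (simp only: norm_of_real)
    qed
    ultimately show ?thesis by simp
  qed
  have inv: "slowly_increasing n W punctured_weight (\<lambda>x. inverse (h x))" for n
    by (rule slowly_increasing_inverse[OF punctured_weight_ge_1 slowly_increasing_subset[OF si W] hc c])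
  have "\<theta> \<in> schwartz_space"
  proof (rule schwartz_spaceI[OF s])
    fix k and "is" :: "'n list"
    obtain C1 where C1: "\<forall>x\<in>cball 0 2. norm (partial_derivs is \<theta> x) \<le> C1" "0 \<le> C1"
      using smooth_bounded_on_compact[OF s compact_cball[of 0 2], of "is"] by auto
    obtain C2 where C2: "\<forall>x\<in>W. punctured_weight x ^ k * norm (partial_derivs is (\<lambda>x. inverse (h x) * \<rho> x) x) \<le> C2"
      using flat_mult_bound[OF inv W(2) \<rho>f] by blast
    have "norm x ^ k * norm (partial_derivs is \<theta> x) \<le> max (2 ^ k * C1) C2" for x
    proof (cases "norm x \<le> 2")
      case True
      then have "norm x ^ k * norm (partial_derivs is \<theta> x) \<le> 2 ^ k * C1"
        using C1 by (intro mult_mono power_mono) auto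
      then show ?thesis by simp
    next
      case False
      then have xW: "x \<in> W" by (simp add: W_def)
      have "partial_derivs is \<theta> x = partial_derivs is (\<lambda>x. inverse (h x) * \<rho> x) x"
      proof (rule partial_derivs_cong_open[OF W(1) _ xW])
        fix y assume "y \<in> W"
        then have "h y \<noteq> 0" using hc c by force
        then show "\<theta> y = inverse (h y) * \<rho> y" by (simp add: eq[of y])
      qed
      moreover have "norm x ^ k \<le> punctured_weight x ^ k"
        using punctured_weight_ge[of x] by (intro power_mono) auto
      ultimately have "norm x ^ k * norm (partial_derivs is \<theta> x)
          \<le> punctured_weight x ^ k * norm (partial_derivs is (\<lambda>x. inverse (h x) * \<rho> x) x)"
        by (simp add: mult_right_mono)
      then show ?thesis using C2 xW by force
    qed
    then show "\<exists>C. \<forall>x. norm x ^ k * norm (partial_derivs is \<theta> x) \<le> C" by blast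
  qed
  then have "\<theta> \<in> flat_space" by (rule vanishing_near_zero_flat[OF _ r(1) \<theta>0])
  moreover have "\<rho> = (\<lambda>x. (symbol f x - complex_of_real (f 1)) * \<theta> x)"
    by (rule ext) (simp add: eq[unfolded h_def])
  ultimately show ?thesis by blast
qed

section \<open>A continuous linear extension operator from the sphere to the Schwartz space\<close>

section \<open>Extension of functions from the sphere\<close>

text \<open>A derivative of order n of a function invariant under dilation by c scales with c^n.
  This carries bounds from the sphere to the surrounding shell.\<close>

lemma partial_derivs_homogeneous:
  assumes G: "smooth_on (- {0}) G" "\<And>y. G (c *\<^sub>R y) = G y" and c: "0 < c" and y: "y \<noteq> 0"
  shows "partial_derivs is G y = c ^ length is *\<^sub>R partial_derivs is G (c *\<^sub>R y)"
  using y
proof (induction "is" arbitrary: y)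
  case Nil
  then show ?case by (simp add: G(2))
next
  case (Cons i "is")
  let ?F = "partial_derivs is G"
  have cy: "c *\<^sub>R y \<in> - {0}" using Cons.prems c by simp
  have "partial_derivs [i] ?F y = partial_derivs [i] (\<lambda>y. c ^ length is *\<^sub>R ?F (c *\<^sub>R y)) y"
    by (rule partial_derivs_cong_open[OF open_punctured]) (use Cons in auto)
  also have "\<dots> = c ^ length is *\<^sub>R frechet_derivative ?F (at (c *\<^sub>R y)) (c *\<^sub>R axis i 1)"
  proof -
    have 1: "(?F has_derivative frechet_derivative ?F (at (c *\<^sub>R y))) (at (c *\<^sub>R y))"
      using smooth_on_differentiable[OF smooth_on_partial_derivs[OF G(1)] cy]
      by (simp add: frechet_derivative_works)
    have "((\<lambda>y. c *\<^sub>R y) has_derivative (\<lambda>v. c *\<^sub>R v)) (at y)"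
      by (rule has_derivative_scaleR_right[OF has_derivative_ident])
    from has_derivative_scaleR_right[OF has_derivative_compose[OF this 1], of "c ^ length is"]
    show ?thesis by (simp add: partial_deriv_eqI)
  qed
  also have "\<dots> = c ^ length (i # is) *\<^sub>R partial_deriv i ?F (c *\<^sub>R y)"
  proof -
    have "linear (frechet_derivative ?F (at (c *\<^sub>R y)))"
      by (rule linear_frechet_derivative[OF smooth_on_differentiable[OF smooth_on_partial_derivs[OF G(1)] cy]])
    then show ?thesis by (simp add: linear_cmul partial_deriv_def mult.commute)
  qed
  finally show ?case by simp
qed

text \<open>A right inverse of restriction to the sphere: linear, continuous into the Schwartz
  space, and zero near the origin.\<close>

definition shell_extension :: "(real^'n::finite \<Rightarrow> complex) \<Rightarrow> real^'n \<Rightarrow> complex" where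
  "shell_extension g x = shell_cutoff x * homogeneous_extension g x"

lemma shell_extension_eq_0: "norm x \<le> 1 / 2 \<or> 2 \<le> norm x \<Longrightarrow> shell_extension g x = 0"
  by (simp add: shell_extension_def shell_cutoff_eq_0)

lemma shell_extension_schwartz:
  assumes "g \<in> sphere_functions"
  shows "shell_extension g \<in> schwartz_space"
proof (rule bounded_support_schwartz)
  have s0: "smooth_on (- {0}) (shell_extension g)"
    unfolding shell_extension_def[abs_def]
    by (rule smooth_on_mult[OF smooth_on_subset[OF smooth_on_shell_cutoff open_punctured]
          sphere_functions_smooth[OF assms]]) simp
  have s1: "smooth_on (ball 0 (1 / 2)) (shell_extension g)"
    by (rule smooth_on_cong[OF smooth_on_const[OF open_ball, of 0]]) (simp add: shell_extension_eq_0)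
  show "smooth_on UNIV (shell_extension g)"
  proof (rule smooth_on_local[OF open_UNIV])
    fix x :: "real^'a"
    show "\<exists>V. x \<in> V \<and> smooth_on V (shell_extension g)"
    proof (cases "x = 0")
      case True
      then have "x \<in> ball 0 (1 / 2)" by simp
      with s1 show ?thesis by (intro exI[of _ "ball 0 (1 / 2)"] conjI)
    next
      case False
      then have "x \<in> - {0}" by simp
      with s0 show ?thesis by (intro exI[of _ "- {0}"] conjI)
    qed
  qed
  show "shell_extension g x = 0" if "2 < norm x" for x using that by (simp add: shell_extension_eq_0)
qed

lemma shell_extension_add:
  "shell_extension (\<lambda>x\<in>sphere 0 1. \<phi> x + \<psi> x) = (\<lambda>x. shell_extension \<phi> x + shell_extension \<psi> x)"
proof
  fix x
  show "shell_extension (\<lambda>x\<in>sphere 0 1. \<phi> x + \<psi> x) x = shell_extension \<phi> x + shell_extension \<psi> x"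
    by (cases "x = 0") (simp_all add: shell_extension_eq_0, simp add: shell_extension_def homogeneous_extension_add distrib_left)
qed

lemma shell_extension_cmult:
  "shell_extension (\<lambda>x\<in>sphere 0 1. c * \<phi> x) = (\<lambda>x. c * shell_extension \<phi> x)"
proof
  fix x
  show "shell_extension (\<lambda>x\<in>sphere 0 1. c * \<phi> x) x = c * shell_extension \<phi> x"
    by (cases "x = 0") (simp_all add: shell_extension_eq_0, simp add: shell_extension_def homogeneous_extension_cmult)
qed

text \<open>Dilation by c = 1/|x| <= 2 moves x to the sphere, at the price of one factor c per
  derivative.\<close>

lemma homogeneous_derivs_bound:
  assumes g: "g \<in> sphere_functions" and x: "1 / 2 \<le> norm x"
  shows "norm (partial_derivs is (homogeneous_extension g) x) \<le> 2 ^ length is * sphere_seminorm is g"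
proof -
  let ?G = "homogeneous_extension g"
  define c where "c = inverse (norm x)"
  have x0: "x \<noteq> 0" using x by auto
  have c: "0 < c" "c \<le> 2"
    using x x0 le_imp_inverse_le[OF x] by (simp_all add: c_def)
  have n: "norm (c *\<^sub>R x) = 1" using x0 by (simp add: c_def)
  have hom: "?G (c *\<^sub>R y) = ?G y" for y
  proof -
    have "inverse c * inverse (norm y) * c = inverse (norm y)"
      using c(1) by (cases "y = 0") (simp_all add: field_simps)
    moreover have "?G (c *\<^sub>R y) = g ((inverse c * inverse (norm y) * c) *\<^sub>R y)"
      using c(1) by (simp add: homogeneous_extension_def)
    ultimately show ?thesis by (simp only: homogeneous_extension_def)
  qed
  have "norm (partial_derivs is ?G x) = c ^ length is * norm (partial_derivs is ?G (c *\<^sub>R x))"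
    unfolding partial_derivs_homogeneous[OF sphere_functions_smooth[OF g] hom c(1) x0, of "is"]
    using c by simp
  also have "\<dots> \<le> 2 ^ length is * sphere_seminorm is g"
    using c by (intro mult_mono power_mono sphere_seminorm_upper[OF g n]) auto
  finally show ?thesis .
qed

text \<open>In the Leibniz formula the derivatives of the cutoff are bounded, those of the
  homogeneous extension are controlled by sphere seminorms, and |x| <= 2 on the shell.\<close>

lemma shell_extension_dominated:
  fixes "is" :: "'n::finite list"
  shows "dominated sphere_functions (range sphere_seminorm) (\<lambda>g. schwartz_seminorm k is (shell_extension g))"
proof -
  have "\<forall>a. \<exists>C\<ge>0. \<forall>x. norm (partial_derivs a (shell_cutoff :: real^'n \<Rightarrow> complex) x) \<le> C"
    by (intro allI bounded_support_derivs_bounded[OF smooth_on_shell_cutoff, of 2]) (simp add: shell_cutoff_eq_0)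
  from choice[OF this] obtain C where
    C': "\<forall>a. 0 \<le> C a \<and> (\<forall>x. norm (partial_derivs a (shell_cutoff :: real^'n \<Rightarrow> complex) x) \<le> C a)"
    by (elim exE)
  have C: "0 \<le> C a" "norm (partial_derivs a (shell_cutoff :: real^'n \<Rightarrow> complex) x) \<le> C a" for a x
    using C' by simp_all
  define q where "q g = (\<Sum>p\<leftarrow>leibniz_splits is. (2 ^ k * C (fst p) * 2 ^ length (snd p)) * sphere_seminorm (snd p) g)"
    for g :: "real^'n \<Rightarrow> complex"
  have nonneg: "\<forall>p\<in>range sphere_seminorm. \<forall>\<phi>\<in>sphere_functions. 0 \<le> p (\<phi> :: real^'n \<Rightarrow> complex)"
    using sphere.nonneg by blast
  have "dominated sphere_functions (range sphere_seminorm) q"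
    unfolding q_def[abs_def]
    by (rule dominated_sum_list[OF nonneg]) (rule dominated_cmult[OF dominated_member], use C(1) in auto)
  then show ?thesis
  proof (rule dominated_mono)
    fix g :: "real^'n \<Rightarrow> complex" assume g: "g \<in> sphere_functions"
    have sn: "0 \<le> sphere_seminorm b g" for b using nonneg g by blast
    have q0: "0 \<le> q g" unfolding q_def using sn C(1) by (intro sum_list_nonneg) auto
    show "schwartz_seminorm k is (shell_extension g) \<le> q g"
    proof (rule schwartz_seminorm_least)
      fix x :: "real^'n"
      consider "norm x < 1 / 2" | "2 < norm x" | "1 / 2 \<le> norm x" "norm x \<le> 2" by linarith
      then show "norm x ^ k * norm (partial_derivs is (shell_extension g) x) \<le> q g"
      proof cases
        case 1
        have "partial_derivs is (shell_extension g) x = 0"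
          by (rule partial_derivs_near_zero[OF _ _ 1]) (simp_all add: shell_extension_eq_0)
        with q0 show ?thesis by simp
      next
        case 2
        have "partial_derivs is (shell_extension g) x = 0"
          by (rule partial_derivs_outside[OF _ 2]) (simp add: shell_extension_eq_0)
        with q0 show ?thesis by simp
      next
        case 3
        then have x: "x \<in> - {0}" by auto
        let ?S = "\<Sum>p\<leftarrow>leibniz_splits is. norm (partial_derivs (fst p) shell_cutoff x)
            * norm (partial_derivs (snd p) (homogeneous_extension g) x)"
        have "norm (partial_derivs is (shell_extension g) x) \<le> ?S"
          unfolding shell_extension_def[abs_def]
          by (rule norm_partial_derivs_mult_le[OF smooth_on_subset[OF smooth_on_shell_cutoff open_punctured]
                sphere_functions_smooth[OF g] x]) simp
        then have "norm x ^ k * norm (partial_derivs is (shell_extension g) x) \<le> norm x ^ k * ?S"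
          by (rule mult_left_mono) simp
        also have "norm x ^ k * ?S = (\<Sum>p\<leftarrow>leibniz_splits is. norm x ^ k * (norm (partial_derivs (fst p) shell_cutoff x)
            * norm (partial_derivs (snd p) (homogeneous_extension g) x)))"
          by (rule sum_list_const_mult[symmetric])
        also have "\<dots> \<le> q g"
          unfolding q_def
        proof (rule sum_list_mono)
          fix p :: "'n list \<times> 'n list"
          have "norm x ^ k * (norm (partial_derivs (fst p) shell_cutoff x)
              * norm (partial_derivs (snd p) (homogeneous_extension g) x))
            \<le> 2 ^ k * (C (fst p) * (2 ^ length (snd p) * sphere_seminorm (snd p) g))"
            using 3 C by (intro mult_mono power_mono homogeneous_derivs_bound[OF g 3(1)]) (auto intro: mult_nonneg_nonneg)
          then show "norm x ^ k * (norm (partial_derivs (fst p) shell_cutoff x)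
              * norm (partial_derivs (snd p) (homogeneous_extension g) x))
            \<le> (2 ^ k * C (fst p) * 2 ^ length (snd p)) * sphere_seminorm (snd p) g"
            by (simp only: mult.assoc)
        qed
        finally show ?thesis .
      qed
    qed
  qed
qed

section \<open>Every solution comes from a sphere distribution\<close>

section \<open>Solutions are given by sphere distributions\<close>

text \<open>Each \<psi> in the Schwartz space is the sum of the shell extension of its restriction
  to the sphere, a piece near the origin, and a remainder \<rho> that vanishes near the origin and
  on the sphere. The transformed solution annihilates the second part by the support condition and
  the third by \<open>symbol_division\<close> and the equation; the first part defines T.\<close>

lemma solution_sphere_solution:
  fixes u :: "(real^'n::finite \<Rightarrow> complex) \<Rightarrow> complex"
  assumes f: "bernstein_function f" and nc: "\<not> f constant_on {0<..}"
    and u: "u \<in> canonical_extension ` solution_space f"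
  shows "\<exists>T\<in>sphere_distributions. u = sphere_solution T"
proof -
  have ut: "u \<in> tempered_distributions" and supp: "0 \<notin> distribution_support (fourier_distribution u)"
    and eqn: "\<forall>\<phi>\<in>Z_space. u (bernstein_laplacian f \<phi>) = u (\<lambda>x. complex_of_real (f 1) * \<phi> x)"
    using u unfolding canonical_solution_iff[OF f] by blast+
  obtain r where r: "r > 0"
    "\<forall>\<phi>. smooth_on UNIV \<phi> \<longrightarrow> (\<forall>x. r \<le> norm x \<longrightarrow> \<phi> x = 0) \<longrightarrow> u (fourier \<phi>) = 0"
    using supp unfolding zero_notin_support_iff by blast
  \<comment> \<open>Up to a constant and a reflection this is the Fourier transform of
    \<open>u\<close>. In this form the equation reads \<open>V_symbol\<close>, and u(\<phi>) = V(F
    \<phi>).\<close>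
  define V where "V \<psi> = u (inverse_fourier \<psi>)" for \<psi>
  have V_add: "V (\<lambda>x. \<phi> x + \<psi> x) = V \<phi> + V \<psi>" if "\<phi> \<in> schwartz_space" "\<psi> \<in> schwartz_space" for \<phi> \<psi>
    using that ut by (simp add: V_def inverse_fourier_add tempered_add inverse_fourier_schwartz)
  have V_cmult: "V (\<lambda>x. c * \<phi> x) = c * V \<phi>" if "\<phi> \<in> schwartz_space" for c \<phi>
    using that ut by (simp add: V_def inverse_fourier_cmult tempered_cmult inverse_fourier_schwartz)
  have V_dom: "schwartz_dominated (\<lambda>\<psi>. norm (V \<psi>))"
  proof -
    have "schwartz_dominated (\<lambda>\<phi>. norm (u \<phi>))" using ut by (simp add: tempered_distributions_iff)
    from schwartz_operator_dominated[OF schwartz_operator_inverse_fourier this] show ?thesis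
      by (simp add: V_def)
  qed
  have V_near: "V \<psi> = 0" if \<psi>: "smooth_on UNIV \<psi>" "\<And>x. r \<le> norm x \<Longrightarrow> \<psi> x = 0" for \<psi>
  proof -
    have S: "\<psi> \<in> schwartz_space" by (rule bounded_support_schwartz[OF \<psi>(1), of r]) (use \<psi>(2) in simp)
    have R: "(\<lambda>x. \<psi> (- x)) \<in> schwartz_space" by (rule schwartz_operator_mem[OF schwartz_operator_reflect S])
    have "u (fourier (\<lambda>x. \<psi> (- x))) = 0" using r(2) schwartz_smooth[OF R] \<psi>(2) by simp
    moreover have "V \<psi> = inverse (complex_of_real ((2 * pi) ^ CARD('n))) * u (fourier (\<lambda>x. \<psi> (- x)))"
      unfolding V_def inverse_fourier_eq fourier_reflect[OF S]
      by (rule tempered_cmult[OF ut fourier_schwartz[OF R], unfolded fourier_reflect[OF S]])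
    ultimately show ?thesis by simp
  qed
  have V_symbol: "V (\<lambda>x. (symbol f x - complex_of_real (f 1)) * \<theta> x) = 0" if \<theta>: "\<theta> \<in> flat_space" for \<theta>
  proof -
    let ?a = "\<lambda>x. symbol f x * \<theta> x" and ?b = "\<lambda>x. complex_of_real (f 1) * \<theta> x"
    have S: "\<theta> \<in> schwartz_space" by (rule flat_schwartz[OF \<theta>])
    have a: "?a \<in> schwartz_space"
      by (rule flat_schwartz[OF flat_mult[OF bernstein_symbol_slowly_increasing[OF f] \<theta>]])
    have b: "?b \<in> schwartz_space" by (rule schwartz_cmult_mem[OF S])
    have "u (bernstein_laplacian f (inverse_fourier \<theta>)) = u (\<lambda>x. complex_of_real (f 1) * inverse_fourier \<theta> x)"
      using eqn inverse_fourier_Z_space[OF \<theta>] by blast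
    then have "V ?a = V ?b"
      unfolding V_def bernstein_laplacian_eq fourier_inverse_fourier[OF S] inverse_fourier_cmult .
    moreover have "(\<lambda>x. (symbol f x - complex_of_real (f 1)) * \<theta> x) = (\<lambda>x. ?a x + (- 1) * ?b x)"
      by (simp add: algebra_simps)
    ultimately show ?thesis
      by (simp only: V_add[OF a schwartz_cmult_mem[OF b]] V_cmult[OF b]) simp
  qed
  define T where "T = (\<lambda>g\<in>sphere_functions. V (shell_extension g))"
  have T: "T \<in> sphere_distributions"
    unfolding sphere_distributions_iff
  proof (intro conjI ballI allI)
    show "T \<in> extensional sphere_functions" by (simp add: T_def)
    fix \<phi> \<psi> :: "real^'n \<Rightarrow> complex" and c
    assume \<phi>: "\<phi> \<in> sphere_functions"
    show "T (\<lambda>x\<in>sphere 0 1. c * \<phi> x) = c * T \<phi>"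
      unfolding T_def restrict_apply'[OF \<phi>] restrict_apply'[OF sphere_functions_cmult(1)[OF \<phi>]] shell_extension_cmult
      by (rule V_cmult[OF shell_extension_schwartz[OF \<phi>]])
    assume \<psi>: "\<psi> \<in> sphere_functions"
    show "T (\<lambda>x\<in>sphere 0 1. \<phi> x + \<psi> x) = T \<phi> + T \<psi>"
      unfolding T_def restrict_apply'[OF \<phi>] restrict_apply'[OF \<psi>] restrict_apply'[OF sphere_functions_add(1)[OF \<phi> \<psi>]]
        shell_extension_add
      by (rule V_add[OF shell_extension_schwartz[OF \<phi>] shell_extension_schwartz[OF \<psi>]])
  next
    have nonneg: "\<forall>p\<in>range sphere_seminorm. \<forall>\<phi>\<in>sphere_functions. 0 \<le> p (\<phi> :: real^'n \<Rightarrow> complex)"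
      using sphere.nonneg by blast
    have "dominated sphere_functions (range sphere_seminorm) (\<lambda>g. norm (V (shell_extension g)))"
    proof (rule dominated_compose[where A=shell_extension and q="\<lambda>\<psi>. norm (V \<psi>)", OF nonneg _ _ V_dom])
      show "shell_extension g \<in> schwartz_space" if "g \<in> sphere_functions" for g :: "real^'n \<Rightarrow> complex"
        by (rule shell_extension_schwartz[OF that])
      fix p :: "(real^'n \<Rightarrow> complex) \<Rightarrow> real" assume "p \<in> schwartz_seminorms"
      then obtain k "is" where "p = schwartz_seminorm k is" unfolding schwartz_seminorms_def by blast
      then show "dominated sphere_functions (range sphere_seminorm) (\<lambda>g. p (shell_extension g))"
        using shell_extension_dominated by simp
    qed
    then show "dominated sphere_functions (range sphere_seminorm) (\<lambda>g. norm (T g))"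
      by (rule dominated_mono) (simp add: T_def)
  qed
  \<comment> \<open>The bound by \<open>r\<close> places the inner piece where \<open>V\<close>
    vanishes; the bound by 1/2 keeps it away from the sphere and makes the shell extension vanish
    wherever this piece can be nonzero.\<close>
  define m where "m = min r (1 / 2)"
  have m: "m > 0" "m \<le> 1 / 2" "m \<le> r" using r(1) by (simp_all add: m_def)
  obtain \<chi>0 :: "real^'n \<Rightarrow> complex" where \<chi>0: "smooth_on UNIV \<chi>0"
    "\<And>x. norm x \<le> m / 2 \<Longrightarrow> \<chi>0 x = 1" "\<And>x. m \<le> norm x \<Longrightarrow> \<chi>0 x = 0" using ball_cutoff[OF m(1)] by blast
  have "u \<phi> = sphere_solution T \<phi>" if \<phi>: "\<phi> \<in> schwartz_space" for \<phi>
  proof -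
    define \<psi> where "\<psi> = fourier \<phi>"
    have \<psi>: "\<psi> \<in> schwartz_space" unfolding \<psi>_def by (rule fourier_schwartz[OF \<phi>])
    define g where "g = restrict \<psi> (sphere 0 1)"
    have g: "g \<in> sphere_functions" unfolding g_def by (rule restrict_sphere_mem[OF schwartz_smooth[OF \<psi>]])
    define \<alpha> where "\<alpha> x = \<chi>0 x * \<psi> x" for x
    have \<alpha>: "\<alpha> \<in> schwartz_space"
      unfolding \<alpha>_def using \<chi>0(3) by (intro schwartz_mult_bounded_support[OF \<chi>0(1) _ \<psi>, of m]) simp
    note \<beta> = schwartz_add(1)[OF shell_extension_schwartz[OF g] \<alpha>]
    \<comment> \<open>For |x| < m/2 the cutoff is 1 and the shell extension is 0, while on the
      sphere the cutoff is 0 and the shell extension equals \<open>\<psi>\<close>; hence the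
      remainder vanishes in both places.\<close>
    define \<rho> where "\<rho> x = \<psi> x - (shell_extension g x + \<alpha> x)" for x
    have \<rho>: "\<rho> \<in> schwartz_space" unfolding \<rho>_def by (rule schwartz_diff[OF \<psi> \<beta>])
    have "\<exists>\<theta>\<in>flat_space. \<rho> = (\<lambda>x. (symbol f x - complex_of_real (f 1)) * \<theta> x)"
    proof (rule symbol_division[OF f nc \<rho>, of "m / 2"])
      show "\<rho> x = 0" if "norm x < m / 2" for x
        using that m \<chi>0(2)[of x] by (simp add: \<rho>_def \<alpha>_def shell_extension_eq_0)
      show "\<rho> x = 0" if "norm x = 1" for x
      proof -
        have "x \<noteq> 0" using that by auto
        then show ?thesis
          using that m \<chi>0(3)[of x]
          by (simp add: \<rho>_def \<alpha>_def shell_extension_def shell_cutoff_sphere g_def homogeneous_extension_restrict)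
      qed
    qed (use m in simp_all)
    then have "V \<rho> = 0" using V_symbol by metis
    moreover have "V \<alpha> = 0"
      by (rule V_near[OF schwartz_smooth[OF \<alpha>]]) (use m(3) \<chi>0(3) in \<open>simp add: \<alpha>_def\<close>)
    moreover have "V \<psi> = V \<rho> + (V (shell_extension g) + V \<alpha>)"
    proof -
      have "\<psi> = (\<lambda>x. \<rho> x + (shell_extension g x + \<alpha> x))" by (simp add: \<rho>_def)
      then have "V \<psi> = V (\<lambda>x. \<rho> x + (shell_extension g x + \<alpha> x))" by (rule arg_cong)
      then show ?thesis
        by (simp only: V_add[OF \<rho> \<beta>] V_add[OF shell_extension_schwartz[OF g] \<alpha>])
    qed
    moreover have "V \<psi> = u \<phi>" by (simp add: V_def \<psi>_def inverse_fourier_fourier[OF \<phi>])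
    moreover have "sphere_solution T \<phi> = V (shell_extension g)"
      using g by (simp add: sphere_solution_def \<phi> T_def g_def \<psi>_def)
    ultimately show ?thesis by simp
  qed
  moreover have "u \<in> extensional schwartz_space" using ut by (simp add: tempered_distributions_iff)
  moreover have "sphere_solution T \<in> extensional schwartz_space" by (simp add: sphere_solution_def)
  ultimately have "u = sphere_solution T" by (intro extensionalityI[of u schwartz_space]) auto
  with T show ?thesis by blast
qed

theorem theorem1p6:
  fixes f :: "real \<Rightarrow> real"
    and u :: "(real^'n::finite \<Rightarrow> complex) \<Rightarrow> complex"
  assumes "bernstein_function f"
    and "\<not> f constant_on {0<..}"
  shows "u \<in> canonical_extension ` solution_space f \<longleftrightarrow>
    (\<exists>T\<in>sphere_distributions.
       distribution_given_by u (\<lambda>x. T (restrict (plane_wave x) (sphere 0 1))))"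
proof
  assume "u \<in> canonical_extension ` solution_space f"
  then obtain T where "T \<in> sphere_distributions" "u = sphere_solution T"
    using solution_sphere_solution[OF assms] by blast
  then show "\<exists>T\<in>sphere_distributions. distribution_given_by u (\<lambda>x. T (restrict (plane_wave x) (sphere 0 1)))"
    using distribution_given_by_iff by blast
next
  assume "\<exists>T\<in>sphere_distributions. distribution_given_by u (\<lambda>x. T (restrict (plane_wave x) (sphere 0 1)))"
  then obtain T where T: "T \<in> sphere_distributions" "u = sphere_solution T"
    using distribution_given_by_iff by blast
  then show "u \<in> canonical_extension ` solution_space f"
    using sphere_solution_solves[OF assms(1)] by simp
qed

end
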